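(* Let $G$ be a Polish group whose universal minimal flow $M(G)$ is metrizable. Then there exists a closed, co-precompact, extremely amenable subgroup $G^* \leq G$ such that $M(G) = \widehat{G/G^*}$, i.e., $M(G)$ is isomorphic, as a $G$-flow, to the completion $\widehat{G/G^*}$ of $G/G^*$.
   Context: A Polish group is a separable, completely metrizable topological group. A $G$-flow is a continuous action of a topological group $G$ on a compact Hausdorff space; it is minimal if all of its orbits are dense. The universal minimal flow $M(G)$ of $G$ is the (unique up to isomorphism) minimal $G$-flow that maps continuously and $G$-equivariantly onto every minimal $G$-flow. A topological group is extremely amenable if its universal minimal flow is a point. The right uniformity of $G$ has as basis of entourages the sets $\{(g,h) \in G^2 : gh^{-1} \in U\}$, where $U$ ranges over the neighbourhoods of $1_G$. For a subgroup $H \leq G$, the quotient $G/H$ (left cosets $gH$) is equipped with the quotient of the right uniformity of $G$, and $\widehat{G/H}$ denotes the completion of this uniform space; the left translation action of $G$ on $G/H$ extends to $\widehat{G/H}$. The subgroup $H$ is called co-precompact if $\widehat{G/H}$ is compact; equivalently, if for every open $V \ni 1_G$ there is a finite $F \subseteq G$ such that $VFH = G$. In that case $\widehat{G/H}$ is a $G$-flow. *)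

theory Defs
  imports "HOL-Analysis.Analysis" "HOL-Algebra.Group_Action" "HOL-Algebra.Left_Coset"
begin

no_notation eq_closure_of (\<open>closure'_of\<index>\<close>)

section \<open>Polish groups and their flows\<close>

locale topological_group = group G for G :: "('a, 'b) monoid_scheme" (structure) +
  fixes T :: "'a topology"
  assumes topspace_eq_carrier: "topspace T = carrier G"
    and continuous_mult: "continuous_map (prod_topology T T) T (\<lambda>(g, h). g \<otimes> h)"
    and continuous_inv: "continuous_map T T (\<lambda>g. inv g)"

definition polish_group :: "('a, 'b) monoid_scheme \<Rightarrow> 'a topology \<Rightarrow> bool" where
  "polish_group G T \<longleftrightarrow>
     topological_group G T \<and> separable_space T \<and> completely_metrizable_space T"

text \<open>\<^const>\<open>group_action\<close> requires \<open>\<alpha> g\<close> to be \<^const>\<open>undefined\<close> outside \<open>topspace X\<close>.\<close>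

definition flow ::
    "('a, 'b) monoid_scheme \<Rightarrow> 'a topology \<Rightarrow> 'x topology \<Rightarrow> ('a \<Rightarrow> 'x \<Rightarrow> 'x) \<Rightarrow> bool" where
  "flow G T X \<alpha> \<longleftrightarrow>
     compact_space X \<and> Hausdorff_space X \<and> group_action G (topspace X) \<alpha> \<and>
     continuous_map (prod_topology T X) X (\<lambda>(g, x). \<alpha> g x)"

definition minimal_flow ::
    "('a, 'b) monoid_scheme \<Rightarrow> 'a topology \<Rightarrow> 'x topology \<Rightarrow> ('a \<Rightarrow> 'x \<Rightarrow> 'x) \<Rightarrow> bool" where
  "minimal_flow G T X \<alpha> \<longleftrightarrow>
     flow G T X \<alpha> \<and> topspace X \<noteq> {} \<and>
     (\<forall>x\<in>topspace X. X closure_of orbit G \<alpha> x = topspace X)"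

definition equivariant ::
    "('a, 'b) monoid_scheme \<Rightarrow> 'x topology \<Rightarrow> ('a \<Rightarrow> 'x \<Rightarrow> 'x) \<Rightarrow> ('a \<Rightarrow> 'y \<Rightarrow> 'y) \<Rightarrow> ('x \<Rightarrow> 'y) \<Rightarrow> bool"
  where "equivariant G X \<alpha> \<beta> f \<longleftrightarrow>
     (\<forall>g\<in>carrier G. \<forall>x\<in>topspace X. f (\<alpha> g x) = \<beta> g (f x))"

definition flow_isomorphic ::
    "('a, 'b) monoid_scheme \<Rightarrow> 'a topology \<Rightarrow> 'x topology \<Rightarrow> ('a \<Rightarrow> 'x \<Rightarrow> 'x) \<Rightarrow>
     'y topology \<Rightarrow> ('a \<Rightarrow> 'y \<Rightarrow> 'y) \<Rightarrow> bool" where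
  "flow_isomorphic G T X \<alpha> Y \<beta> \<longleftrightarrow>
     flow G T X \<alpha> \<and> flow G T Y \<beta> \<and>
     (\<exists>f. homeomorphic_map X Y f \<and> equivariant G X \<alpha> \<beta> f)"

text \<open>
  A definition cannot quantify over all types, so the test flows \<open>Y\<close> below live on the type
  \<^typ>\<open>'a set set\<close>.  This is no restriction: a minimal flow has a dense orbit and is Hausdorff, hence
  has at most as many points as \<^typ>\<open>'a set set\<close> and is isomorphic to a flow on that type.
  The lemma \<open>universal_minimal_flow_any_type\<close> below states the resulting universality over
  all types.
\<close>

definition universal_minimal_flow ::
    "('a, 'b) monoid_scheme \<Rightarrow> 'a topology \<Rightarrow> 'm topology \<Rightarrow> ('a \<Rightarrow> 'm \<Rightarrow> 'm) \<Rightarrow> bool" where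
  "universal_minimal_flow G T M \<mu> \<longleftrightarrow>
     minimal_flow G T M \<mu> \<and>
     (\<forall>(Y :: 'a set set topology) \<beta>. minimal_flow G T Y \<beta> \<longrightarrow>
        (\<exists>f. continuous_map M Y f \<and> f ` topspace M = topspace Y \<and> equivariant G M \<mu> \<beta> f))"

definition extremely_amenable :: "('a, 'b) monoid_scheme \<Rightarrow> 'a topology \<Rightarrow> bool" where
  "extremely_amenable G T \<longleftrightarrow>
     (\<exists>(M :: 'a set set topology) \<mu>. universal_minimal_flow G T M \<mu> \<and> (\<exists>x. topspace M = {x}))"

lemma minimal_flow_transfer:
  fixes Y :: "'y topology" and \<phi> :: "'y \<Rightarrow> 'z"
  assumes Y: "minimal_flow G T Y \<beta>" and inj: "inj_on \<phi> (topspace Y)"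
  obtains Z \<gamma> where "minimal_flow G T Z \<gamma>" "homeomorphic_map Y Z \<phi>" "equivariant G Y \<beta> \<gamma> \<phi>"
proof -
  let ?S = "topspace Y"
  define \<psi> where "\<psi> = inv_into ?S \<phi>"
  define Z where "Z = pullback_topology (\<phi> ` ?S) \<psi> Y"
  define \<gamma> where "\<gamma> = (\<lambda>g. \<lambda>z\<in>\<phi> ` ?S. \<phi> (\<beta> g (\<psi> z)))"
  have fl: "flow G T Y \<beta>" and ne: "?S \<noteq> {}"
    and dense: "\<And>x. x \<in> ?S \<Longrightarrow> Y closure_of orbit G \<beta> x = ?S"
    using Y by (auto simp: minimal_flow_def)
  interpret A: group_action G ?S \<beta> using fl by (simp add: flow_def)
  interpret grp: group G using A.group_hom by (simp add: group_hom_def)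
  have \<psi>\<phi>: "\<psi> (\<phi> x) = x" if "x \<in> ?S" for x
    using that inj by (simp add: \<psi>_def)
  have \<psi>S: "\<psi> z \<in> ?S" and \<phi>\<psi>: "\<phi> (\<psi> z) = z" if "z \<in> \<phi> ` ?S" for z
    using that \<psi>\<phi> by auto
  have tZ: "topspace Z = \<phi> ` ?S"
    using \<psi>S by (auto simp: Z_def topspace_pullback_topology)
  have cont\<psi>: "continuous_map Z Y \<psi>"
    unfolding Z_def using continuous_map_pullback[of Y Y id "\<phi> ` ?S" \<psi>] by (simp add: id_def o_def)
  have cont\<phi>: "continuous_map Y Z \<phi>"
    unfolding Z_def
  proof (rule continuous_map_pullback')
    show "continuous_map Y Y (\<psi> \<circ> \<phi>)"
      by (rule continuous_map_eq[OF continuous_map_id]) (simp add: \<psi>\<phi>)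
  qed auto
  have hom: "homeomorphic_map Y Z \<phi>"
    unfolding homeomorphic_map_maps homeomorphic_maps_def
    using cont\<phi> cont\<psi> \<psi>\<phi> \<phi>\<psi> tZ by blast
  have \<beta>S: "\<beta> g x \<in> ?S" if "g \<in> carrier G" "x \<in> ?S" for g x
    using that A.element_image by blast
  have eq: "equivariant G Y \<beta> \<gamma> \<phi>"
    by (simp add: equivariant_def \<gamma>_def \<psi>\<phi>)
  have \<gamma>Bij: "\<gamma> g \<in> Bij (\<phi> ` ?S)" if g: "g \<in> carrier G" for g
  proof -
    have "bij_betw (\<lambda>z. \<phi> (\<beta> g (\<psi> z))) (\<phi> ` ?S) (\<phi> ` ?S)"
    proof (rule bij_betwI[where g = "\<lambda>z. \<phi> (\<beta> (inv\<^bsub>G\<^esub> g) (\<psi> z))"])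
      show "\<phi> (\<beta> (inv\<^bsub>G\<^esub> g) (\<psi> (\<phi> (\<beta> g (\<psi> x))))) = x" if "x \<in> \<phi> ` ?S" for x
        using that g \<psi>S \<psi>\<phi> \<phi>\<psi> \<beta>S A.orbit_sym_aux by metis
      show "\<phi> (\<beta> g (\<psi> (\<phi> (\<beta> (inv\<^bsub>G\<^esub> g) (\<psi> y))))) = y" if "y \<in> \<phi> ` ?S" for y
        using that g \<psi>S \<psi>\<phi> \<phi>\<psi> \<beta>S A.orbit_sym_aux grp.inv_closed grp.inv_inv by metis
    qed (use g \<psi>S \<beta>S in auto)
    then have "bij_betw (\<gamma> g) (\<phi> ` ?S) (\<phi> ` ?S)"
      by (subst bij_betw_cong[where g = "\<lambda>z. \<phi> (\<beta> g (\<psi> z))"]) (simp_all add: \<gamma>_def)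
    then show ?thesis by (simp add: Bij_def \<gamma>_def)
  qed
  have "group_action G (\<phi> ` ?S) \<gamma>"
    unfolding group_action_def group_hom_def group_hom_axioms_def
  proof (intro conjI homI)
    show "group G" by (rule grp.group_axioms)
    show "group (BijGroup (\<phi> ` ?S))" by (rule group_BijGroup)
    show "\<gamma> g \<in> carrier (BijGroup (\<phi> ` ?S))" if "g \<in> carrier G" for g
      using \<gamma>Bij[OF that] by (simp add: BijGroup_def)
    fix g h assume gh: "g \<in> carrier G" "h \<in> carrier G"
    have "\<gamma> (g \<otimes>\<^bsub>G\<^esub> h) = compose (\<phi> ` ?S) (\<gamma> g) (\<gamma> h)"
    proof (rule extensionalityI[where A = "\<phi> ` ?S"])
      show "\<gamma> (g \<otimes>\<^bsub>G\<^esub> h) x = compose (\<phi> ` ?S) (\<gamma> g) (\<gamma> h) x" if "x \<in> \<phi> ` ?S" for x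
        using that gh \<psi>S \<psi>\<phi> \<beta>S A.composition_rule by (auto simp: \<gamma>_def compose_def)
    qed (auto simp: \<gamma>_def)
    then show "\<gamma> (g \<otimes>\<^bsub>G\<^esub> h) = \<gamma> g \<otimes>\<^bsub>BijGroup (\<phi> ` ?S)\<^esub> \<gamma> h"
      using gh \<gamma>Bij by (simp add: BijGroup_def)
  qed
  moreover have "continuous_map (prod_topology T Z) Z (\<lambda>(g, z). \<gamma> g z)"
  proof -
    have "continuous_map (prod_topology T Z) (prod_topology T Y) (\<lambda>p. (fst p, \<psi> (snd p)))"
      using continuous_map_compose[OF continuous_map_snd cont\<psi>]
      by (auto intro!: continuous_map_pairedI continuous_map_fst simp: o_def)
    then have "continuous_map (prod_topology T Z) Y ((\<lambda>(g, x). \<beta> g x) \<circ> (\<lambda>p. (fst p, \<psi> (snd p))))"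
      using fl continuous_map_compose by (fastforce simp: flow_def)
    then have "continuous_map (prod_topology T Z) Z
        (\<phi> \<circ> ((\<lambda>(g, x). \<beta> g x) \<circ> (\<lambda>p. (fst p, \<psi> (snd p)))))"
      using cont\<phi> continuous_map_compose by blast
    then show ?thesis
      by (rule continuous_map_eq) (auto simp: \<gamma>_def tZ)
  qed
  moreover have "compact_space Z" "Hausdorff_space Z"
    using fl homeomorphic_map_imp_homeomorphic_space[OF hom]
      homeomorphic_compact_space homeomorphic_Hausdorff_space
    by (auto simp: flow_def)
  ultimately have "flow G T Z \<gamma>"
    by (simp add: flow_def tZ)
  moreover have "Z closure_of orbit G \<gamma> z = topspace Z" if z: "z \<in> topspace Z" for z
  proof -
    obtain x where x: "x \<in> ?S" "z = \<phi> x" using z tZ by auto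
    have "orbit G \<gamma> z = \<phi> ` orbit G \<beta> x"
      using x by (auto simp: orbit_def \<gamma>_def \<psi>\<phi>)
    moreover have "orbit G \<beta> x \<subseteq> ?S"
      using x \<beta>S by (auto simp: orbit_def)
    ultimately have "Z closure_of orbit G \<gamma> z = \<phi> ` (Y closure_of orbit G \<beta> x)"
      using homeomorphic_map_closure_of[OF hom] by metis
    then show ?thesis using dense[OF x(1)] tZ by simp
  qed
  ultimately have "minimal_flow G T Z \<gamma>"
    using ne tZ by (simp add: minimal_flow_def)
  then show thesis using that hom eq by blast
qed

lemma minimal_flow_injects:
  fixes Y :: "'y topology" and G :: "('a, 'b) monoid_scheme"
  assumes Y: "minimal_flow G T Y \<beta>"
  obtains \<phi> :: "'y \<Rightarrow> 'a set set" where "inj_on \<phi> (topspace Y)"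
proof -
  have H: "Hausdorff_space Y" and ne: "topspace Y \<noteq> {}"
    using Y by (simp_all add: minimal_flow_def flow_def)
  obtain x0 where x0: "x0 \<in> topspace Y"
    using ne unfolding ex_in_conv[symmetric] by (rule exE)
  have dense: "Y closure_of orbit G \<beta> x0 = topspace Y"
    using Y x0 by (simp add: minimal_flow_def)
  define \<phi> where "\<phi> x = {A. A \<subseteq> carrier G \<and> x \<in> Y closure_of ((\<lambda>g. \<beta> g x0) ` A)}" for x
  have "inj_on \<phi> (topspace Y)"
  proof (rule inj_onI, rule ccontr)
    fix x y assume xy: "x \<in> topspace Y" "y \<in> topspace Y" "\<phi> x = \<phi> y" "x \<noteq> y"
    obtain U V where UV: "openin Y U" "openin Y V" "x \<in> U" "y \<in> V" "disjnt U V"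
      using H xy(1,2,4) unfolding Hausdorff_space_def by metis
    define A where "A = {g \<in> carrier G. \<beta> g x0 \<in> U}"
    have "x \<in> Y closure_of ((\<lambda>g. \<beta> g x0) ` A)"
      unfolding in_closure_of
    proof (intro conjI allI impI)
      fix W assume W: "x \<in> W \<and> openin Y W"
      then have "openin Y (U \<inter> W)" "x \<in> U \<inter> W" using UV by auto
      moreover have "\<forall>V. x \<in> V \<and> openin Y V \<longrightarrow> (\<exists>z. z \<in> orbit G \<beta> x0 \<and> z \<in> V)"
        using dense xy(1) in_closure_of[of x Y "orbit G \<beta> x0"] by simp
      ultimately obtain z where "z \<in> orbit G \<beta> x0" "z \<in> U \<inter> W"
        by meson
      then show "\<exists>z. z \<in> (\<lambda>g. \<beta> g x0) ` A \<and> z \<in> W"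
        by (auto simp: orbit_def A_def)
    qed (rule xy(1))
    moreover have "A \<subseteq> carrier G" by (simp add: A_def)
    ultimately have "A \<in> \<phi> x" unfolding \<phi>_def by blast
    then have "A \<in> \<phi> y" unfolding xy(3) .
    then have "y \<in> Y closure_of ((\<lambda>g. \<beta> g x0) ` A)" unfolding \<phi>_def by blast
    then have "\<forall>W. y \<in> W \<and> openin Y W \<longrightarrow> (\<exists>z. z \<in> (\<lambda>g. \<beta> g x0) ` A \<and> z \<in> W)"
      unfolding in_closure_of by (rule conjunct2)
    then obtain z where "z \<in> (\<lambda>g. \<beta> g x0) ` A" "z \<in> V"
      using UV by meson
    then show False using UV(5) by (auto simp: A_def disjnt_def)
  qed
  then show thesis by (rule that)
qed

lemma universal_minimal_flow_any_type:
  fixes Y :: "'y topology"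
  assumes M: "universal_minimal_flow G T M \<mu>" and Y: "minimal_flow G T Y \<beta>"
  shows "\<exists>f. continuous_map M Y f \<and> f ` topspace M = topspace Y \<and> equivariant G M \<mu> \<beta> f"
proof -
  obtain \<phi> :: "'y \<Rightarrow> 'a set set" where "inj_on \<phi> (topspace Y)"
    using minimal_flow_injects[OF Y] .
  then obtain Z \<gamma> where Z: "minimal_flow G T Z \<gamma>" and hom: "homeomorphic_map Y Z \<phi>"
    and eq\<phi>: "equivariant G Y \<beta> \<gamma> \<phi>"
    using minimal_flow_transfer[OF Y] by blast
  obtain f where f: "continuous_map M Z f" "f ` topspace M = topspace Z" "equivariant G M \<mu> \<gamma> f"
    using M Z unfolding universal_minimal_flow_def by blast
  obtain \<psi> where \<psi>: "homeomorphic_maps Y Z \<phi> \<psi>"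
    using hom by (auto simp: homeomorphic_map_maps)
  then have c: "continuous_map Z Y \<psi>" and \<psi>\<phi>: "\<And>y. y \<in> topspace Y \<Longrightarrow> \<psi> (\<phi> y) = y"
    and \<phi>\<psi>: "\<And>z. z \<in> topspace Z \<Longrightarrow> \<phi> (\<psi> z) = z"
    by (auto simp: homeomorphic_maps_def)
  interpret A: group_action G "topspace Y" \<beta> using Y by (simp add: minimal_flow_def flow_def)
  have \<psi>S: "\<psi> z \<in> topspace Y" if "z \<in> topspace Z" for z
    using c that by (auto simp: continuous_map_def)
  have "\<psi> ` topspace Z = topspace Y"
    using \<psi> homeomorphic_imp_surjective_map homeomorphic_maps_map by metis
  moreover have "equivariant G M \<mu> \<beta> (\<psi> \<circ> f)"
    unfolding equivariant_def
  proof (intro ballI)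
    fix g x assume g: "g \<in> carrier G" and x: "x \<in> topspace M"
    have fx: "f x \<in> topspace Z" using f(2) x by blast
    have "\<beta> g (\<psi> (f x)) \<in> topspace Y" using A.element_image g \<psi>S[OF fx] by blast
    moreover have "\<phi> (\<beta> g (\<psi> (f x))) = f (\<mu> g x)"
      using eq\<phi> f(3) g x fx \<psi>S \<phi>\<psi> by (simp add: equivariant_def)
    ultimately show "(\<psi> \<circ> f) (\<mu> g x) = \<beta> g ((\<psi> \<circ> f) x)"
      using \<psi>\<phi> by (metis comp_apply)
  qed
  ultimately show ?thesis
    using continuous_map_compose[OF f(1) c] f(2) by (metis image_comp)
qed

section \<open>Uniformities on a set and their completions\<close>

text \<open>
  A uniformity on a set \<open>S\<close> is given by its filter of entourages, with the axioms of the type class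
  \<^class>\<open>uniform_space\<close> relativised to \<open>S\<close>; as for filters, \<open>U \<le> V\<close> means that \<open>U\<close> is finer.
\<close>

definition uniformity_of :: "'s set \<Rightarrow> ('s \<times> 's) filter \<Rightarrow> bool" where
  "uniformity_of S U \<longleftrightarrow>
     U \<le> principal (S \<times> S) \<and>
     (\<forall>E. eventually E U \<longrightarrow> (\<forall>x\<in>S. E (x, x))) \<and>
     (\<forall>E. eventually E U \<longrightarrow> eventually (\<lambda>(x, y). E (y, x)) U) \<and>
     (\<forall>E. eventually E U \<longrightarrow>
        (\<exists>D. eventually D U \<and> (\<forall>x y z. D (x, y) \<longrightarrow> D (y, z) \<longrightarrow> E (x, z))))"

definition uniform_topology :: "'s set \<Rightarrow> ('s \<times> 's) filter \<Rightarrow> 's topology" where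
  "uniform_topology S U =
     topology (\<lambda>W. W \<subseteq> S \<and> (\<forall>x\<in>W. eventually (\<lambda>(x', y). x' = x \<longrightarrow> y \<in> W) U))"

lemma openin_uniform_topology:
  "openin (uniform_topology S U) W \<longleftrightarrow>
     W \<subseteq> S \<and> (\<forall>x\<in>W. eventually (\<lambda>(x', y). x' = x \<longrightarrow> y \<in> W) U)"
proof -
  have "istopology (\<lambda>W. W \<subseteq> S \<and> (\<forall>x\<in>W. eventually (\<lambda>(x', y). x' = x \<longrightarrow> y \<in> W) U))"
    unfolding istopology_def
  proof (intro conjI allI impI)
    fix V W
    assume V: "V \<subseteq> S \<and> (\<forall>x\<in>V. eventually (\<lambda>(x', y). x' = x \<longrightarrow> y \<in> V) U)"
      and W: "W \<subseteq> S \<and> (\<forall>x\<in>W. eventually (\<lambda>(x', y). x' = x \<longrightarrow> y \<in> W) U)"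
    show "V \<inter> W \<subseteq> S" using V by blast
    show "\<forall>x\<in>V \<inter> W. eventually (\<lambda>(x', y). x' = x \<longrightarrow> y \<in> V \<inter> W) U"
    proof
      fix x assume "x \<in> V \<inter> W"
      then have "eventually (\<lambda>(x', y). x' = x \<longrightarrow> y \<in> V) U"
        "eventually (\<lambda>(x', y). x' = x \<longrightarrow> y \<in> W) U" using V W by auto
      then show "eventually (\<lambda>(x', y). x' = x \<longrightarrow> y \<in> V \<inter> W) U"
        by (rule eventually_elim2) auto
    qed
  next
    fix K assume K: "\<forall>W\<in>K. W \<subseteq> S \<and> (\<forall>x\<in>W. eventually (\<lambda>(x', y). x' = x \<longrightarrow> y \<in> W) U)"
    then show "\<Union>K \<subseteq> S" by blast
    show "\<forall>x\<in>\<Union>K. eventually (\<lambda>(x', y). x' = x \<longrightarrow> y \<in> \<Union>K) U"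
    proof
      fix x assume "x \<in> \<Union>K"
      then obtain W where "W \<in> K" "x \<in> W" by blast
      then have "eventually (\<lambda>(x', y). x' = x \<longrightarrow> y \<in> W) U" using K by blast
      then show "eventually (\<lambda>(x', y). x' = x \<longrightarrow> y \<in> \<Union>K) U"
        using \<open>W \<in> K\<close> by (auto elim: eventually_mono)
    qed
  qed
  then show ?thesis by (simp add: uniform_topology_def)
qed

lemma topspace_uniform_topology:
  assumes "U \<le> principal (S \<times> S)"
  shows "topspace (uniform_topology S U) = S"
proof
  have "eventually (\<lambda>(x', y). x' = x \<longrightarrow> y \<in> S) U" for x
    using assms by (auto simp: le_principal elim: eventually_mono)
  then have "openin (uniform_topology S U) S"
    by (simp add: openin_uniform_topology)
  then show "S \<subseteq> topspace (uniform_topology S U)" by (rule openin_subset)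
  show "topspace (uniform_topology S U) \<subseteq> S"
    using openin_topspace[of "uniform_topology S U"] unfolding openin_uniform_topology by (rule conjunct1)
qed

text \<open>The quotient (final) uniformity on \<open>p ` S\<close>: the finest uniformity making \<open>p\<close> uniformly continuous.\<close>

definition quotient_uniformity :: "'s set \<Rightarrow> ('s \<times> 's) filter \<Rightarrow> ('s \<Rightarrow> 't) \<Rightarrow> ('t \<times> 't) filter" where
  "quotient_uniformity S U p =
     Inf {V. uniformity_of (p ` S) V \<and> filtermap (map_prod p p) U \<le> V}"

text \<open>
  The Hausdorff completion is realised on the set of minimal Cauchy filters.  \<^emph>\<open>Minimal\<close> refers to
  inclusion of filters as families of sets, so it is maximality for \<open>\<le>\<close> on \<^typ>\<open>'s filter\<close>.
  Two filters are close if they have a common small member.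
\<close>

definition cauchy_filter_on :: "'s set \<Rightarrow> ('s \<times> 's) filter \<Rightarrow> 's filter \<Rightarrow> bool" where
  "cauchy_filter_on S U F \<longleftrightarrow> F \<noteq> bot \<and> F \<le> principal S \<and> F \<times>\<^sub>F F \<le> U"

definition completion_points :: "'s set \<Rightarrow> ('s \<times> 's) filter \<Rightarrow> 's filter set" where
  "completion_points S U =
     {F. cauchy_filter_on S U F \<and> (\<forall>F'. cauchy_filter_on S U F' \<and> F \<le> F' \<longrightarrow> F' = F)}"

definition completion_uniformity ::
    "'s set \<Rightarrow> ('s \<times> 's) filter \<Rightarrow> ('s filter \<times> 's filter) filter" where
  "completion_uniformity S U =
     (INF E\<in>{E. eventually (\<lambda>z. z \<in> E) U}.
        principal {(F, F'). F \<in> completion_points S U \<and> F' \<in> completion_points S U \<and>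
          (\<exists>A. eventually (\<lambda>x. x \<in> A) F \<and> eventually (\<lambda>x. x \<in> A) F' \<and> A \<times> A \<subseteq> E)})"

section \<open>The completion of a coset space\<close>

definition right_uniformity :: "('a, 'b) monoid_scheme \<Rightarrow> 'a topology \<Rightarrow> ('a \<times> 'a) filter" where
  "right_uniformity G T =
     (INF U\<in>{U. openin T U \<and> \<one>\<^bsub>G\<^esub> \<in> U}.
        principal {(g, h). g \<in> carrier G \<and> h \<in> carrier G \<and> g \<otimes>\<^bsub>G\<^esub> inv\<^bsub>G\<^esub> h \<in> U})"

definition coset_uniformity ::
    "('a, 'b) monoid_scheme \<Rightarrow> 'a topology \<Rightarrow> 'a set \<Rightarrow> ('a set \<times> 'a set) filter" where
  "coset_uniformity G T H =
     quotient_uniformity (carrier G) (right_uniformity G T) (\<lambda>g. g <#\<^bsub>G\<^esub> H)"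

definition coset_completion ::
    "('a, 'b) monoid_scheme \<Rightarrow> 'a topology \<Rightarrow> 'a set \<Rightarrow> 'a set filter topology" where
  "coset_completion G T H =
     uniform_topology (completion_points (lcosets\<^bsub>G\<^esub> H) (coset_uniformity G T H))
       (completion_uniformity (lcosets\<^bsub>G\<^esub> H) (coset_uniformity G T H))"

text \<open>
  Left translation by \<open>g\<close> is an automorphism of the uniform space of left cosets, so its
  continuous extension to the completion is the direct image of minimal Cauchy filters.
\<close>

definition coset_completion_action ::
    "('a, 'b) monoid_scheme \<Rightarrow> 'a topology \<Rightarrow> 'a set \<Rightarrow> 'a \<Rightarrow> 'a set filter \<Rightarrow> 'a set filter" where
  "coset_completion_action G T H g =
     (\<lambda>F\<in>topspace (coset_completion G T H). filtermap (\<lambda>C. g <#\<^bsub>G\<^esub> C) F)"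

definition co_precompact :: "('a, 'b) monoid_scheme \<Rightarrow> 'a topology \<Rightarrow> 'a set \<Rightarrow> bool" where
  "co_precompact G T H \<longleftrightarrow> compact_space (coset_completion G T H)"

end

theory Submission
  imports Defs
begin

text \<open>
  The key point is that a metrizable \<open>M\<close> recurs uniformly: for every neighbourhood \<open>U\<close> of \<open>1\<close>, open
  sets \<open>V\<close> and \<open>V'\<close> around sufficiently close points satisfy \<open>UV \<inter> V' \<noteq> {}\<close>.  The reason is the one for which
  \<open>\<beta>\<nat>\<close> has no nontrivial convergent sequences: a convergent sequence violating this has
  neighbourhoods that are pairwise \<open>U\<close>-separated, so a right uniformly continuous function on \<open>G\<close> takes
  the value \<open>0\<close> on the even ones and \<open>1\<close> on the odd ones.  Since \<open>M\<close> is coalescent, the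
  map from the Samuel compactification of \<open>G\<close> to \<open>M\<close> has an equivariant section, along which the function
  becomes a continuous function on \<open>M\<close>; but it oscillates at the limit of the sequence.

  By Baire category there is then a point \<open>x\<^sub>0\<close> for which every \<open>Ux\<^sub>0\<close> is dense near \<open>x\<^sub>0\<close>, and an
  Effros-type back-and-forth shows that \<open>gH \<mapsto> gx\<^sub>0\<close>, with \<open>H\<close> the stabilizer of \<open>x\<^sub>0\<close>, is an isomorphism
  of uniform spaces onto the dense orbit of \<open>x\<^sub>0\<close>; hence \<open>M\<close> is the completion of \<open>G/H\<close>.  The image of
  \<open>x\<^sub>0\<close> in the Samuel compactification is fixed by \<open>H\<close> and is a limit of elements of \<open>H\<close>.  In an \<open>H\<close>-flow without
  fixed points, a finite cover by sets that elements of \<open>H\<close> move off themselves would give finitely many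
  uniformly continuous functions contradicting this, so \<open>H\<close> is extremely amenable.
\<close>

section \<open>Topological groups and flows\<close>

text \<open>Countability enters through the two metrics. That of \<open>M\<close> provides
  convergent sequences, on which recurrence is tested, and finite nets; with the balls around
  \<open>\<one>\<close> these leave only countably many dense open sets for Baire. Completeness of
  \<open>\<rho>\<close> makes the back-and-forth converge. But \<open>\<rho>\<close> need not be
  invariant on either side, so the displacement allowed at a step depends on the group element
  reached so far. It must not depend on the point of \<open>M\<close> as well, which is why
  recurrence is needed with one radius for all points. Coalescence makes up for the weak form of
  universality: \<open>M\<close> is only known to map onto every minimal flow, and injectivity of
  its endomorphisms turns such a map into a section. The section is used in two directions. For
  recurrence, functions on \<open>G\<close> are carried to \<open>M\<close>, where they must be
  continuous; for fixed points, the value of the section at one point is approximated by elements of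
  \<open>G\<close>, which are then corrected into \<open>H\<close>.\<close>

lemma continuous_map_euclideanreal_iff:
  "continuous_map X euclideanreal f \<longleftrightarrow>
     (\<forall>x\<in>topspace X. \<forall>e>0. \<exists>W. openin X W \<and> x \<in> W \<and> (\<forall>y\<in>W. \<bar>f y - f x\<bar> < e))"
  using Met_TC.continuous_map_to_metric[of X f]
  by (auto simp: dist_real_def abs_minus_commute)

lemma openin_prod_topologyE:
  assumes "openin (prod_topology X Y) S" "(x, y) \<in> S"
  obtains U V where "openin X U" "openin Y V" "x \<in> U" "y \<in> V" "U \<times> V \<subseteq> S"
  using assms by (metis openin_prod_topology_alt)

text \<open>Zorn's lemma for reverse inclusion, with compactness keeping intersections of chains
  nonempty. The property is left abstract because it is needed both for invariant sets and for
  subsemigroups.\<close>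

lemma minimal_closed_set:
  assumes X: "compact_space X" and Y: "closedin X Y" "Y \<noteq> {}" "P Y"
    and Inter: "\<And>\<C>. \<C> \<noteq> {} \<Longrightarrow> (\<And>K. K \<in> \<C> \<Longrightarrow> closedin X K \<and> P K) \<Longrightarrow> P (\<Inter>\<C>)"
  obtains N where "N \<subseteq> Y" "closedin X N" "N \<noteq> {}" "P N"
    "\<And>K. K \<subseteq> N \<Longrightarrow> closedin X K \<Longrightarrow> K \<noteq> {} \<Longrightarrow> P K \<Longrightarrow> K = N"
proof -
  define A where "A = {K. K \<subseteq> Y \<and> closedin X K \<and> K \<noteq> {} \<and> P K}"
  have "\<exists>m\<in>A. \<forall>a\<in>A. a \<subseteq> m \<longrightarrow> a = m"
  proof (rule predicate_Zorn[where P = "\<lambda>K L. L \<subseteq> K"])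
    show "partial_order_on A (relation_of (\<lambda>K L. L \<subseteq> K) A)"
      by (auto simp: partial_order_on_def preorder_on_def refl_on_def trans_def antisym_def
          relation_of_def)
    fix C assume C: "C \<in> Chains (relation_of (\<lambda>K L. L \<subseteq> K) A)"
    show "\<exists>u\<in>A. \<forall>a\<in>C. u \<subseteq> a"
    proof (cases "C = {}")
      case True
      then show ?thesis using Y by (auto simp: A_def)
    next
      case False
      have CA: "C \<subseteq> A" and lin: "\<And>K L. K \<in> C \<Longrightarrow> L \<in> C \<Longrightarrow> K \<subseteq> L \<or> L \<subseteq> K"
        using C by (auto simp: Chains_def relation_of_def)
      have "\<Inter>C \<noteq> {}"
      proof
        assume empty: "\<Inter>C = {}"
        have *: "(\<forall>U\<in>C. closedin X U) \<and> (\<forall>\<F>. finite \<F> \<and> \<F> \<subseteq> C \<longrightarrow> \<Inter>\<F> \<noteq> {}) \<longrightarrow> \<Inter>C \<noteq> {}"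
          using X unfolding compact_space_fip by (rule spec)
        have "\<exists>\<F>. finite \<F> \<and> \<F> \<subseteq> C \<and> \<Inter>\<F> = {}"
        proof (rule ccontr)
          assume no: "\<nexists>\<F>. finite \<F> \<and> \<F> \<subseteq> C \<and> \<Inter>\<F> = {}"
          have "\<forall>U\<in>C. closedin X U" using CA by (auto simp: A_def)
          with * no empty show False by blast
        qed
        then obtain \<F> where F: "finite \<F>" "\<F> \<subseteq> C" "\<Inter>\<F> = {}" by blast
        have "\<F> \<noteq> {}" using F(3) by auto
        \<comment> \<open>A finite nonempty subfamily of a chain has a least member, so its
          intersection cannot be empty.\<close>
        have "\<exists>K\<in>C. K \<subseteq> \<Inter>\<F>"
          using F(1) \<open>\<F> \<noteq> {}\<close> F(2)
        proof (induction \<F> rule: finite_ne_induct)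
          case (singleton K)
          then show ?case by auto
        next
          case (insert K \<F>)
          then obtain L where "L \<in> C" "L \<subseteq> \<Inter>\<F>" by auto
          then show ?case using lin[of K L] insert.prems by auto
        qed
        then show False using F(3) CA by (auto simp: A_def)
      qed
      moreover have "closedin X (\<Inter>C)" using CA False by (auto simp: A_def)
      moreover have "P (\<Inter>C)" using Inter[OF False] CA by (auto simp: A_def)
      ultimately have "\<Inter>C \<in> A" using CA False by (auto simp: A_def)
      then show ?thesis by blast
    qed
  qed
  then obtain m where m: "m \<in> A" and min: "\<And>K. K \<in> A \<Longrightarrow> K \<subseteq> m \<Longrightarrow> K = m" by blast
  have mA: "m \<subseteq> Y" "closedin X m" "m \<noteq> {}" "P m" using m by (simp_all add: A_def)
  have "K = m" if "K \<subseteq> m" "closedin X K" "K \<noteq> {}" "P K" for K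
    by (rule min) (use that mA in \<open>auto simp: A_def\<close>)
  then show thesis using that mA by metis
qed

section \<open>Neighbourhoods of the identity\<close>

context topological_group
begin

definition nbhd_one :: "'a set \<Rightarrow> bool" where
  "nbhd_one U \<longleftrightarrow> openin T U \<and> \<one> \<in> U"

lemma nbhd_one_subset: "nbhd_one U \<Longrightarrow> u \<in> U \<Longrightarrow> u \<in> carrier G"
  using openin_subset topspace_eq_carrier unfolding nbhd_one_def by blast

lemma nbhd_one_carrier: "nbhd_one (carrier G)"
  unfolding nbhd_one_def using openin_topspace[of T] topspace_eq_carrier by auto

lemma nbhd_one_Int: "nbhd_one U \<Longrightarrow> nbhd_one V \<Longrightarrow> nbhd_one (U \<inter> V)"
  by (auto simp: nbhd_one_def)

text \<open>The result is a smaller neighbourhood and not the intersection itself: over an empty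
  index set the latter would be the whole type, which need not be open in \<open>T\<close>.\<close>

lemma nbhd_one_INT:
  assumes "finite I" "\<And>i. i \<in> I \<Longrightarrow> nbhd_one (U i)"
  obtains V where "nbhd_one V" "\<And>i. i \<in> I \<Longrightarrow> V \<subseteq> U i"
proof -
  have "\<exists>V. nbhd_one V \<and> (\<forall>i\<in>I. V \<subseteq> U i)" using assms
  proof (induction I)
    case empty
    then show ?case using nbhd_one_carrier by auto
  next
    case (insert i I)
    then obtain V where "nbhd_one V" "\<forall>i\<in>I. V \<subseteq> U i" by auto
    then show ?case using insert.prems by (intro exI[of _ "V \<inter> U i"]) (auto intro: nbhd_one_Int)
  qed
  then show thesis using that by blast
qed

lemma continuous_left_translation: "g \<in> carrier G \<Longrightarrow> continuous_map T T (\<lambda>x. g \<otimes> x)"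
  using continuous_map_compose[OF _ continuous_mult, of T "\<lambda>x. (g, x)"] topspace_eq_carrier
  by (auto simp: o_def continuous_map_pairwise)

lemma continuous_right_translation: "g \<in> carrier G \<Longrightarrow> continuous_map T T (\<lambda>x. x \<otimes> g)"
  using continuous_map_compose[OF _ continuous_mult, of T "\<lambda>x. (x, g)"] topspace_eq_carrier
  by (auto simp: o_def continuous_map_pairwise)

lemma nbhd_one_preimage:
  assumes "continuous_map T T f" "nbhd_one U" "f \<one> \<in> U"
  shows "nbhd_one {x \<in> carrier G. f x \<in> U}"
  using assms openin_continuous_map_preimage[of T T f U] topspace_eq_carrier
  by (auto simp: nbhd_one_def)

lemma nbhd_one_conjugate:
  assumes "nbhd_one U" "g \<in> carrier G"
  obtains V where "nbhd_one V" "\<And>v. v \<in> V \<Longrightarrow> g \<otimes> v \<otimes> inv g \<in> U"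
proof -
  have "continuous_map T T (\<lambda>x. g \<otimes> x \<otimes> inv g)"
    using continuous_map_compose[OF continuous_left_translation continuous_right_translation, of g "inv g"]
      assms by (simp add: o_def)
  then have "nbhd_one {x \<in> carrier G. g \<otimes> x \<otimes> inv g \<in> U}"
    by (rule nbhd_one_preimage) (use assms in \<open>auto simp: nbhd_one_def\<close>)
  then show thesis using that by blast
qed

lemma nbhd_one_right_translate:
  assumes "openin T O'" "c \<in> O'"
  obtains V where "nbhd_one V" "\<And>v. v \<in> V \<Longrightarrow> v \<otimes> c \<in> O'"
proof -
  have c: "c \<in> carrier G" using assms openin_subset topspace_eq_carrier by blast
  have "openin T {x \<in> carrier G. x \<otimes> c \<in> O'}"
    using openin_continuous_map_preimage[OF continuous_right_translation[OF c] assms(1)]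
      topspace_eq_carrier by simp
  then have "nbhd_one {x \<in> carrier G. x \<otimes> c \<in> O'}" using c assms by (simp add: nbhd_one_def)
  then show thesis using that by blast
qed

lemma nbhd_one_sqrt:
  assumes U: "nbhd_one U"
  obtains V where "nbhd_one V" "\<And>v. v \<in> V \<Longrightarrow> inv v \<in> V" "\<And>v w. v \<in> V \<Longrightarrow> w \<in> V \<Longrightarrow> v \<otimes> w \<in> U"
proof -
  have "openin (prod_topology T T) {p \<in> topspace (prod_topology T T). (\<lambda>(g, h). g \<otimes> h) p \<in> U}"
    using openin_continuous_map_preimage[OF continuous_mult] U by (auto simp: nbhd_one_def)
  moreover have "(\<one>, \<one>) \<in> {p \<in> topspace (prod_topology T T). (\<lambda>(g, h). g \<otimes> h) p \<in> U}"
    using U topspace_eq_carrier by (auto simp: nbhd_one_def)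
  ultimately obtain A B where AB: "openin T A" "openin T B" "\<one> \<in> A" "\<one> \<in> B"
    "A \<times> B \<subseteq> {p \<in> topspace (prod_topology T T). (\<lambda>(g, h). g \<otimes> h) p \<in> U}"
    by (rule openin_prod_topologyE)
  define W where "W = A \<inter> B"
  have W: "nbhd_one W" using AB by (auto simp: W_def nbhd_one_def)
  have W': "nbhd_one {x \<in> carrier G. inv x \<in> W}"
    by (rule nbhd_one_preimage[OF continuous_inv W]) (use W in \<open>simp add: nbhd_one_def\<close>)
  show thesis
  proof (rule that[of "W \<inter> {x \<in> carrier G. inv x \<in> W}"])
    show "nbhd_one (W \<inter> {x \<in> carrier G. inv x \<in> W})" using W W' by (rule nbhd_one_Int)
    show "inv v \<in> W \<inter> {x \<in> carrier G. inv x \<in> W}" if "v \<in> W \<inter> {x \<in> carrier G. inv x \<in> W}" for v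
      using that by auto
    show "v \<otimes> w \<in> U" if "v \<in> W \<inter> {x \<in> carrier G. inv x \<in> W}" "w \<in> W \<inter> {x \<in> carrier G. inv x \<in> W}" for v w
      using subsetD[OF AB(5), of "(v, w)"] that by (simp add: W_def)
  qed
qed

lemma nbhd_one_cube_root:
  assumes U: "nbhd_one U"
  obtains V where "nbhd_one V" "\<And>v. v \<in> V \<Longrightarrow> inv v \<in> V" "V \<subseteq> U"
    "\<And>u v w. u \<in> V \<Longrightarrow> v \<in> V \<Longrightarrow> w \<in> V \<Longrightarrow> u \<otimes> v \<otimes> w \<in> U"
proof -
  obtain W where W: "nbhd_one W" "\<And>v w. v \<in> W \<Longrightarrow> w \<in> W \<Longrightarrow> v \<otimes> w \<in> U"
    using nbhd_one_sqrt[OF U] by metis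
  obtain V where V: "nbhd_one V" "\<And>v. v \<in> V \<Longrightarrow> inv v \<in> V"
    "\<And>v w. v \<in> V \<Longrightarrow> w \<in> V \<Longrightarrow> v \<otimes> w \<in> W"
    using nbhd_one_sqrt[OF W(1)] by metis
  have VW: "V \<subseteq> W" using V(3)[of _ \<one>] V(1) nbhd_one_subset[OF V(1)] by (fastforce simp: nbhd_one_def)
  have WU: "W \<subseteq> U" using W(2)[of _ \<one>] W(1) nbhd_one_subset[OF W(1)] by (fastforce simp: nbhd_one_def)
  show thesis
  proof (rule that[OF V(1,2)])
    show "V \<subseteq> U" using VW WU by simp
    show "u \<otimes> v \<otimes> w \<in> U" if "u \<in> V" "v \<in> V" "w \<in> V" for u v w
      using W(2)[OF V(3)[OF that(1,2)]] that(3) VW by auto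
  qed
qed

lemma flowI:
  assumes "compact_space X" "Hausdorff_space X"
    and closed: "\<And>g x. g \<in> carrier G \<Longrightarrow> x \<in> topspace X \<Longrightarrow> \<alpha> g x \<in> topspace X"
    and ext: "\<And>g. g \<in> carrier G \<Longrightarrow> \<alpha> g \<in> extensional (topspace X)"
    and one: "\<And>x. x \<in> topspace X \<Longrightarrow> \<alpha> \<one> x = x"
    and mult: "\<And>g h x. g \<in> carrier G \<Longrightarrow> h \<in> carrier G \<Longrightarrow> x \<in> topspace X \<Longrightarrow>
      \<alpha> (g \<otimes> h) x = \<alpha> g (\<alpha> h x)"
    and cont: "continuous_map (prod_topology T X) X (\<lambda>(g, x). \<alpha> g x)"
  shows "flow G T X \<alpha>"
proof -
  have bij: "\<alpha> g \<in> Bij (topspace X)" if g: "g \<in> carrier G" for g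
  proof -
    have "bij_betw (\<alpha> g) (topspace X) (topspace X)"
    proof (rule bij_betwI[where g = "\<alpha> (inv g)"])
      show "\<alpha> (inv g) (\<alpha> g x) = x" if "x \<in> topspace X" for x
        using that g mult[of "inv g" g x] one by simp
      show "\<alpha> g (\<alpha> (inv g) x) = x" if "x \<in> topspace X" for x
        using that g mult[of g "inv g" x] one by simp
    qed (use g closed in auto)
    then show ?thesis using ext[OF g] by (simp add: Bij_def)
  qed
  have "group_action G (topspace X) \<alpha>"
    unfolding group_action_def group_hom_def group_hom_axioms_def
  proof (intro conjI homI)
    show "group G" by (rule group_axioms)
    show "group (BijGroup (topspace X))" by (rule group_BijGroup)
    show "\<alpha> g \<in> carrier (BijGroup (topspace X))" if "g \<in> carrier G" for g
      using bij[OF that] by (simp add: BijGroup_def)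
    fix g h assume gh: "g \<in> carrier G" "h \<in> carrier G"
    have "\<alpha> (g \<otimes> h) = compose (topspace X) (\<alpha> g) (\<alpha> h)"
      by (rule extensionalityI[where A = "topspace X"])
        (use gh ext mult in \<open>auto simp: compose_def\<close>)
    then show "\<alpha> (g \<otimes> h) = \<alpha> g \<otimes>\<^bsub>BijGroup (topspace X)\<^esub> \<alpha> h"
      using gh bij by (simp add: BijGroup_def)
  qed
  then show ?thesis using assms by (simp add: flow_def)
qed

end

section \<open>Flows, invariant sets and minimal subflows\<close>

locale G_flow = topological_group G T for G :: "('a, 'b) monoid_scheme" (structure) and T +
  fixes X :: "'x topology" and \<alpha> :: "'a \<Rightarrow> 'x \<Rightarrow> 'x"
  assumes is_flow: "flow G T X \<alpha>"
begin

sublocale group_action G "topspace X" \<alpha>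
  using is_flow by (simp add: flow_def)

lemma compact: "compact_space X" and Hausdorff: "Hausdorff_space X"
  and continuous_action: "continuous_map (prod_topology T X) X (\<lambda>(g, x). \<alpha> g x)"
  using is_flow by (simp_all add: flow_def)

lemma act_closed [simp]: "g \<in> carrier G \<Longrightarrow> x \<in> topspace X \<Longrightarrow> \<alpha> g x \<in> topspace X"
  using element_image by blast

lemma act_mult: "g \<in> carrier G \<Longrightarrow> h \<in> carrier G \<Longrightarrow> x \<in> topspace X \<Longrightarrow> \<alpha> (g \<otimes> h) x = \<alpha> g (\<alpha> h x)"
  using composition_rule by blast

lemma act_one [simp]: "x \<in> topspace X \<Longrightarrow> \<alpha> \<one> x = x"
  using id_eq_one by (metis restrict_apply')

lemma act_inv [simp]:
  "g \<in> carrier G \<Longrightarrow> x \<in> topspace X \<Longrightarrow> \<alpha> (inv g) (\<alpha> g x) = x"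
  "g \<in> carrier G \<Longrightarrow> x \<in> topspace X \<Longrightarrow> \<alpha> g (\<alpha> (inv g) x) = x"
  by (simp_all flip: act_mult)

lemma continuous_act: "g \<in> carrier G \<Longrightarrow> continuous_map X X (\<alpha> g)"
  using continuous_map_compose[OF _ continuous_action, of X "\<lambda>x. (g, x)"] topspace_eq_carrier
  by (auto simp: o_def continuous_map_pairwise)

lemma continuous_orbit_map: "x \<in> topspace X \<Longrightarrow> continuous_map T X (\<lambda>g. \<alpha> g x)"
  using continuous_map_compose[OF _ continuous_action, of T "\<lambda>g. (g, x)"]
  by (auto simp: o_def continuous_map_pairwise)

lemma openin_act_preimage:
  assumes "g \<in> carrier G" "openin X V"
  shows "openin X {x \<in> topspace X. \<alpha> g x \<in> V}"
  using openin_continuous_map_preimage[OF continuous_act] assms by blast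

lemma act_image_eq:
  assumes "g \<in> carrier G" "V \<subseteq> topspace X"
  shows "\<alpha> g ` V = {x \<in> topspace X. \<alpha> (inv g) x \<in> V}"
proof -
  have "x \<in> \<alpha> g ` V" if "x \<in> topspace X" "\<alpha> (inv g) x \<in> V" for x
    using that assms act_inv(2)[of g x] by (metis image_eqI)
  then show ?thesis using assms by auto
qed

lemma openin_act_image:
  assumes "g \<in> carrier G" "openin X V"
  shows "openin X (\<alpha> g ` V)"
  using act_image_eq[OF assms(1) openin_subset[OF assms(2)]] openin_act_preimage[of "inv g" V] assms
  by simp

lemma act_nbhd:
  assumes "x \<in> topspace X" "openin X P" "x \<in> P"
  obtains V W where "nbhd_one V" "openin X W" "x \<in> W" "\<And>v y. v \<in> V \<Longrightarrow> y \<in> W \<Longrightarrow> \<alpha> v y \<in> P"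
proof -
  let ?S = "{p \<in> topspace (prod_topology T X). (\<lambda>(g, x). \<alpha> g x) p \<in> P}"
  have "openin (prod_topology T X) ?S"
    using openin_continuous_map_preimage[OF continuous_action assms(2)] .
  moreover have "(\<one>, x) \<in> ?S" using assms topspace_eq_carrier by auto
  ultimately obtain V W where "openin T V" "openin X W" "\<one> \<in> V" "x \<in> W" "V \<times> W \<subseteq> ?S"
    by (rule openin_prod_topologyE)
  then show thesis by (intro that[of V W]) (auto simp: nbhd_one_def)
qed

definition translates :: "'a set \<Rightarrow> 'x set \<Rightarrow> 'x set" where
  "translates U V = (\<Union>u\<in>U. \<alpha> u ` V)"

lemma translatesI: "u \<in> U \<Longrightarrow> x \<in> V \<Longrightarrow> \<alpha> u x \<in> translates U V"
  by (auto simp: translates_def)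

lemma openin_translates: "U \<subseteq> carrier G \<Longrightarrow> openin X V \<Longrightarrow> openin X (translates U V)"
  unfolding translates_def by (auto intro: openin_act_image)

definition invariant :: "'x set \<Rightarrow> bool" where
  "invariant N \<longleftrightarrow> (\<forall>g\<in>carrier G. \<forall>x\<in>N. \<alpha> g x \<in> N)"

lemma orbit_closure:
  assumes "x \<in> topspace X"
  shows "closedin X (X closure_of orbit G \<alpha> x)" "x \<in> X closure_of orbit G \<alpha> x"
    "invariant (X closure_of orbit G \<alpha> x)"
proof -
  have sub: "orbit G \<alpha> x \<subseteq> topspace X" using assms by (auto simp: orbit_def)
  show "closedin X (X closure_of orbit G \<alpha> x)" by simp
  have "x \<in> orbit G \<alpha> x" using assms by (rule orbit_refl)
  then show "x \<in> X closure_of orbit G \<alpha> x" using closure_of_subset[OF sub] by blast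
  show "invariant (X closure_of orbit G \<alpha> x)"
    unfolding invariant_def
  proof (intro ballI)
    fix g y assume g: "g \<in> carrier G" and y: "y \<in> X closure_of orbit G \<alpha> x"
    have "\<alpha> g ` (X closure_of orbit G \<alpha> x) \<subseteq> X closure_of (\<alpha> g ` orbit G \<alpha> x)"
      using continuous_map_image_closure_subset[OF continuous_act[OF g]] by blast
    moreover have "\<alpha> g ` orbit G \<alpha> x \<subseteq> orbit G \<alpha> x"
    proof
      fix z assume "z \<in> \<alpha> g ` orbit G \<alpha> x"
      then obtain h where "h \<in> carrier G" "z = \<alpha> g (\<alpha> h x)" by (auto simp: orbit_def)
      then show "z \<in> orbit G \<alpha> x"
        using g assms act_mult[of g h x] unfolding orbit_def by (intro CollectI exI[of _ "g \<otimes> h"]) simp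
    qed
    ultimately show "\<alpha> g y \<in> X closure_of orbit G \<alpha> x"
      using closure_of_mono y by blast
  qed
qed

lemma flow_restrict:
  assumes N: "closedin X N" "invariant N"
  shows "flow G T (subtopology X N) (\<lambda>g. restrict (\<alpha> g) N)"
proof (rule flowI)
  have NX: "N \<subseteq> topspace X" using N(1) closedin_subset by blast
  have tN: "topspace (subtopology X N) = N" using NX by auto
  show "compact_space (subtopology X N)"
    using closedin_compact_space[OF compact N(1)] compact_space_subtopology by blast
  show "Hausdorff_space (subtopology X N)" using Hausdorff by (rule Hausdorff_space_subtopology)
  have "continuous_map (prod_topology T (subtopology X N)) X (\<lambda>(g, x). \<alpha> g x)"
    using continuous_map_from_subtopology[OF continuous_action, of "topspace T \<times> N"]
    by (metis prod_topology_subtopology(2) subtopology_Times subtopology_topspace)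
  then have "continuous_map (prod_topology T (subtopology X N)) (subtopology X N) (\<lambda>(g, x). \<alpha> g x)"
    using N(2) NX topspace_eq_carrier by (auto simp: continuous_map_in_subtopology invariant_def)
  then show "continuous_map (prod_topology T (subtopology X N)) (subtopology X N) (\<lambda>(g, x). restrict (\<alpha> g) N x)"
    by (rule continuous_map_eq) (auto simp: tN)
  show "restrict (\<alpha> g) N x \<in> topspace (subtopology X N)"
    if "g \<in> carrier G" "x \<in> topspace (subtopology X N)" for g x
    using that N(2) unfolding tN by (simp add: invariant_def)
  show "restrict (\<alpha> g) N \<in> extensional (topspace (subtopology X N))" for g
    unfolding tN by simp
  show "restrict (\<alpha> \<one>) N x = x" if "x \<in> topspace (subtopology X N)" for x
    using that NX unfolding tN by auto
  show "restrict (\<alpha> (g \<otimes> h)) N x = restrict (\<alpha> g) N (restrict (\<alpha> h) N x)"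
    if "g \<in> carrier G" "h \<in> carrier G" "x \<in> topspace (subtopology X N)" for g h x
    using that NX N(2) act_mult[of g h x] unfolding tN by (auto simp: invariant_def)
qed

text \<open>Each orbit closure is itself a closed invariant nonempty subset of \<open>N\<close>, so
  minimality among subsets forces every orbit to be dense.\<close>

lemma minimal_flow_restrict:
  assumes N: "closedin X N" "invariant N" "N \<noteq> {}"
    and min: "\<And>K. K \<subseteq> N \<Longrightarrow> closedin X K \<Longrightarrow> K \<noteq> {} \<Longrightarrow> invariant K \<Longrightarrow> K = N"
  shows "minimal_flow G T (subtopology X N) (\<lambda>g. restrict (\<alpha> g) N)"
proof -
  have NX: "N \<subseteq> topspace X" using N(1) closedin_subset by blast
  have tN: "topspace (subtopology X N) = N" using NX by auto
  have "subtopology X N closure_of orbit G (\<lambda>g. restrict (\<alpha> g) N) x = N" if x: "x \<in> N" for x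
  proof -
    have eq: "orbit G (\<lambda>g. restrict (\<alpha> g) N) x = orbit G \<alpha> x" using x by (auto simp: orbit_def)
    have sub: "orbit G \<alpha> x \<subseteq> N" using x N(2) by (auto simp: orbit_def invariant_def)
    have "X closure_of orbit G \<alpha> x = N"
      using orbit_closure[of x] x NX closure_of_minimal[OF sub N(1)] by (intro min) auto
    then show ?thesis unfolding eq using closure_of_subtopology_subset closure_of_subtopology[of X N "orbit G \<alpha> x"] sub
      by (metis inf.absorb2 inf.idem)
  qed
  then show ?thesis using flow_restrict[OF N(1,2)] N(3) by (simp add: minimal_flow_def tN del: topspace_subtopology)
qed

lemma minimal_subflow:
  assumes "closedin X Y" "invariant Y" "Y \<noteq> {}"
  obtains N where "N \<subseteq> Y" "closedin X N" "N \<noteq> {}" "invariant N"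
    "\<And>K. K \<subseteq> N \<Longrightarrow> closedin X K \<Longrightarrow> K \<noteq> {} \<Longrightarrow> invariant K \<Longrightarrow> K = N"
proof (rule minimal_closed_set[where P = invariant, OF compact assms(1,3,2)])
  show "invariant (\<Inter>\<C>)" if "\<C> \<noteq> {}" "\<And>K. K \<in> \<C> \<Longrightarrow> closedin X K \<and> invariant K" for \<C>
    using that by (auto simp: invariant_def)
next
  fix N
  assume "N \<subseteq> Y" "closedin X N" "N \<noteq> {}" "invariant N"
    "\<And>K. K \<subseteq> N \<Longrightarrow> closedin X K \<Longrightarrow> K \<noteq> {} \<Longrightarrow> invariant K \<Longrightarrow> K = N"
  then show thesis by (rule that)
qed

end

section \<open>Coalescence of the universal minimal flow\<close>

lemma (in G_flow) closed_invariant_minimal: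
  assumes "minimal_flow G T X \<alpha>" "closedin X N" "invariant N" "N \<noteq> {}"
  shows "N = topspace X"
proof -
  obtain x where x: "x \<in> N" using assms by blast
  have "orbit G \<alpha> x \<subseteq> N" using x assms(3) by (auto simp: orbit_def invariant_def)
  then have "X closure_of orbit G \<alpha> x \<subseteq> N" using closure_of_minimal assms(2) by blast
  moreover have "X closure_of orbit G \<alpha> x = topspace X"
    using assms(1,2) x closedin_subset unfolding minimal_flow_def by blast
  ultimately show ?thesis using closedin_subset[OF assms(2)] by blast
qed

text \<open>With the phase space itself as index set this is the flow of all self-maps, in which the
  Ellis semigroup lives.\<close>

lemma (in G_flow) flow_power:
  fixes I :: "'i set"
  defines "P \<equiv> product_topology (\<lambda>_. X) I"
  shows "flow G T P (\<lambda>g. \<lambda>p\<in>topspace P. \<lambda>i\<in>I. \<alpha> g (p i))"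
proof (rule flowI)
  have tP: "topspace P = I \<rightarrow>\<^sub>E topspace X" by (simp add: P_def)
  show "compact_space P" unfolding P_def using compact by (simp add: compact_space_product_topology)
  show "Hausdorff_space P" unfolding P_def using Hausdorff by (simp add: Hausdorff_space_product_topology)
  have "continuous_map (prod_topology T P) P (\<lambda>q. \<lambda>i\<in>I. \<alpha> (fst q) (snd q i))"
    unfolding P_def continuous_map_componentwise
  proof (intro conjI ballI)
    fix i assume i: "i \<in> I"
    have "continuous_map (prod_topology T (product_topology (\<lambda>_. X) I)) (prod_topology T X) (\<lambda>q. (fst q, snd q i))"
      using i by (intro continuous_map_pairedI continuous_map_fst)
        (auto intro!: continuous_map_componentwise_UNIV continuous_map_compose[OF continuous_map_snd continuous_map_product_projection, unfolded o_def])
    from continuous_map_compose[OF this continuous_action]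
    show "continuous_map (prod_topology T (product_topology (\<lambda>_. X) I)) X (\<lambda>q. (\<lambda>i\<in>I. \<alpha> (fst q) (snd q i)) i)"
      using i by (simp add: o_def)
  qed auto
  then show "continuous_map (prod_topology T P) P (\<lambda>(g, p). (\<lambda>p\<in>topspace P. \<lambda>i\<in>I. \<alpha> g (p i)) p)"
    by (rule continuous_map_eq) auto
  show "(\<lambda>p\<in>topspace P. \<lambda>i\<in>I. \<alpha> g (p i)) p \<in> topspace P"
    if "g \<in> carrier G" "p \<in> topspace P" for g p
    using that unfolding tP by (auto simp: PiE_def Pi_def)
  show "(\<lambda>p\<in>topspace P. \<lambda>i\<in>I. \<alpha> \<one> (p i)) p = p" if "p \<in> topspace P" for p
    using that unfolding tP by (auto simp: PiE_def Pi_def extensional_def restrict_def)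
  show "(\<lambda>p\<in>topspace P. \<lambda>i\<in>I. \<alpha> (g \<otimes> h) (p i)) p =
      (\<lambda>p\<in>topspace P. \<lambda>i\<in>I. \<alpha> g (p i)) ((\<lambda>p\<in>topspace P. \<lambda>i\<in>I. \<alpha> h (p i)) p)"
    if "g \<in> carrier G" "h \<in> carrier G" "p \<in> topspace P" for g h p
  proof -
    have "(\<lambda>i\<in>I. \<alpha> h (p i)) \<in> topspace P" using that unfolding tP by (auto simp: PiE_def Pi_def)
    then show ?thesis using that act_mult[of g h] unfolding tP
      by (auto simp: PiE_def Pi_def restrict_def)
  qed
qed auto

text \<open>In a minimal closed subsemigroup \<open>A\<close> with \<open>u\<close> in
  \<open>A\<close>, both \<open>A u\<close> and the set of \<open>p\<close> in \<open>A\<close> with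
  \<open>p u = u\<close> are closed subsemigroups, hence all of \<open>A\<close>. Closedness of the
  two sets takes only continuity in the left factor, which is all that composition of maps
  offers.\<close>

lemma ellis_numakura_idempotent:
  assumes K: "compact_space X" "Hausdorff_space X"
    and N: "closedin X N" "N \<noteq> {}" "\<And>p q. p \<in> N \<Longrightarrow> q \<in> N \<Longrightarrow> f p q \<in> N"
    and assoc: "\<And>p q r. p \<in> N \<Longrightarrow> q \<in> N \<Longrightarrow> r \<in> N \<Longrightarrow> f (f p q) r = f p (f q r)"
    and cont: "\<And>q. q \<in> N \<Longrightarrow> continuous_map X X (\<lambda>p. f p q)"
  obtains u where "u \<in> N" "f u u = u"
proof -
  define P where "P A \<longleftrightarrow> (\<forall>p\<in>A. \<forall>q\<in>A. f p q \<in> A)" for A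
  have PN: "P N" using N by (simp add: P_def)
  have PI: "P (\<Inter>\<C>)" if "\<C> \<noteq> {}" "\<And>K. K \<in> \<C> \<Longrightarrow> closedin X K \<and> P K" for \<C>
    using that by (auto simp: P_def)
  obtain A where A: "A \<subseteq> N" "closedin X A" "A \<noteq> {}" "P A"
    and min: "\<And>K. K \<subseteq> A \<Longrightarrow> closedin X K \<Longrightarrow> K \<noteq> {} \<Longrightarrow> P K \<Longrightarrow> K = A"
  proof (rule minimal_closed_set[where P = P, OF K(1) N(1,2) PN])
    show "P (\<Inter>\<C>)" if "\<C> \<noteq> {}" "\<And>K. K \<in> \<C> \<Longrightarrow> closedin X K \<and> P K" for \<C>
      using PI that .
  qed (rule that)
  obtain u where u: "u \<in> A" using A by blast
  have c: "continuous_map X X (\<lambda>p. f p u)" using cont u A by blast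
  have mA: "\<And>p q. p \<in> A \<Longrightarrow> q \<in> A \<Longrightarrow> f p q \<in> A" using A by (simp add: P_def)
  have asA: "\<And>p q r. p \<in> A \<Longrightarrow> q \<in> A \<Longrightarrow> r \<in> A \<Longrightarrow> f (f p q) r = f p (f q r)"
    using assoc A(1) by (meson subsetD)
  have "(\<lambda>p. f p u) ` A = A"
  proof (rule min)
    show "(\<lambda>p. f p u) ` A \<subseteq> A" using mA u by auto
    show "closedin X ((\<lambda>p. f p u) ` A)"
      using image_compactin[OF closedin_compact_space[OF K(1) A(2)] c] compactin_imp_closedin[OF K(2)] by simp
    show "P ((\<lambda>p. f p u) ` A)" unfolding P_def
    proof (intro ballI)
      fix p q assume "p \<in> (\<lambda>p. f p u) ` A" "q \<in> (\<lambda>p. f p u) ` A"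
      then obtain a b where ab: "a \<in> A" "b \<in> A" "p = f a u" "q = f b u" by auto
      then have "f p q = f (f p b) u" using u mA asA[of p b u] by simp
      then show "f p q \<in> (\<lambda>p. f p u) ` A" using ab mA u by auto
    qed
  qed (use A in auto)
  then obtain a where a: "a \<in> A" "f a u = u" using u by (metis (no_types, lifting) imageE)
  \<comment> \<open>Nonempty since \<open>A u = A\<close> contains \<open>u\<close>.\<close>
  let ?B = "{p \<in> topspace X. f p u \<in> {u}} \<inter> A"
  have "?B = A"
  proof (rule min)
    have "u \<in> topspace X" using u A closedin_subset by blast
    then show "closedin X ?B"
      using closedin_continuous_map_preimage[OF c, of "{u}"] A(2) closedin_Hausdorff_singleton[OF K(2)] closedin_Int by blast
    show "P ?B" unfolding P_def
    proof (intro ballI)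
      fix p q assume "p \<in> ?B" "q \<in> ?B"
      then show "f p q \<in> ?B" using mA asA[of p q u] u closedin_subset[OF A(2)] by auto
    qed
    show "?B \<noteq> {}" using a closedin_subset[OF A(2)] by auto
  qed auto
  then have "f u u = u" using u by auto
  then show thesis using that u A by blast
qed

locale universal_minimal = topological_group G T for G :: "('a, 'b) monoid_scheme" (structure) and T +
  fixes M :: "'m topology" and \<mu> :: "'a \<Rightarrow> 'm \<Rightarrow> 'm"
  assumes universal: "universal_minimal_flow G T M \<mu>"
begin

lemma minimal: "minimal_flow G T M \<mu>"
  using universal by (simp add: universal_minimal_flow_def)

sublocale G_flow G T M \<mu>
  using minimal by unfold_locales (simp add: minimal_flow_def)

lemma nonempty: "topspace M \<noteq> {}"
  using minimal by (simp add: minimal_flow_def)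

text \<open>
  A minimal left ideal of the Ellis semigroup of \<open>M\<close> contains an idempotent, and each of its
  endomorphisms is a right translation, hence injective.  Being universal, \<open>M\<close> inherits this.
\<close>
lemma coalescent:
  assumes \<kappa>: "continuous_map M M \<kappa>" "equivariant G M \<mu> \<mu> \<kappa>"
  shows "inj_on \<kappa> (topspace M)"
proof -
  define S where "S = topspace M"
  define P where "P = product_topology (\<lambda>_. M) S"
  define \<epsilon> where "\<epsilon> = (\<lambda>g. \<lambda>p\<in>topspace P. \<lambda>i\<in>S. \<mu> g (p i))"
  have tP: "topspace P = S \<rightarrow>\<^sub>E S" by (simp add: P_def S_def)
  interpret E: G_flow G T P \<epsilon>
    by unfold_locales (unfold P_def \<epsilon>_def, rule flow_power)
  define e where "e = (\<lambda>x\<in>S. x)"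
  have eP: "e \<in> topspace P" by (simp add: e_def tP)
  \<comment> \<open>The orbit of the identity map consists of the translations by group elements;
    its closure is the Ellis semigroup of \<open>M\<close>, with composition as product.\<close>
  define Y where "Y = P closure_of orbit G \<epsilon> e"
  have Y: "closedin P Y" "E.invariant Y" "Y \<noteq> {}"
    using E.orbit_closure[OF eP] by (auto simp: Y_def)
  obtain N where NY: "N \<subseteq> Y" and N: "closedin P N" "N \<noteq> {}" "E.invariant N"
    and min: "\<And>K. K \<subseteq> N \<Longrightarrow> closedin P K \<Longrightarrow> K \<noteq> {} \<Longrightarrow> E.invariant K \<Longrightarrow> K = N"
    by (rule E.minimal_subflow[OF Y]) (rule that)
  let ?c = "compose S"
  have NP: "N \<subseteq> topspace P" and YP: "Y \<subseteq> topspace P" using N Y closedin_subset by auto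
  have fn: "p \<in> S \<rightarrow> S" if "p \<in> topspace P" for p using that by (auto simp: tP)
  have cP: "?c p q \<in> topspace P" if "p \<in> topspace P" "q \<in> topspace P" for p q
    using fn[OF that(1)] fn[OF that(2)] unfolding tP by (auto simp: compose_def)
  have assoc: "?c (?c p q) r = ?c p (?c q r)" if "p \<in> topspace P" "q \<in> topspace P" "r \<in> topspace P" for p q r
    using compose_assoc[OF fn[OF that(3)], of p q] by simp
  have rcont: "continuous_map P P (\<lambda>p. ?c p q)" if q: "q \<in> topspace P" for q
  proof -
    have "continuous_map P P (\<lambda>p. \<lambda>x\<in>S. p (q x))"
      unfolding P_def continuous_map_componentwise
    proof (intro conjI ballI)
      fix x assume x: "x \<in> S"
      then have "q x \<in> S" using fn[OF q] by auto
      then show "continuous_map (product_topology (\<lambda>_. M) S) M (\<lambda>p. (\<lambda>x\<in>S. p (q x)) x)"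
        using x continuous_map_product_projection[of "q x" S "\<lambda>_. M"] by simp
    qed auto
    then show ?thesis by (simp add: compose_def)
  qed
  have act_c: "?c (\<epsilon> g p) q = \<epsilon> g (?c p q)" if "g \<in> carrier G" "p \<in> topspace P" "q \<in> topspace P" for g p q
    using that fn[OF that(3)] cP[OF that(2,3)] by (auto simp: \<epsilon>_def compose_def Pi_iff intro!: restrict_ext)
  have e_c: "?c e q = q" if "q \<in> topspace P" for q
    using that fn[OF that] unfolding tP by (auto simp: e_def compose_def PiE_def extensional_def restrict_def fun_eq_iff Pi_iff)
  have orbP: "orbit G \<epsilon> e \<subseteq> topspace P" using eP by (auto simp: orbit_def)
  \<comment> \<open>\<open>N\<close> is a left ideal: the maps that send \<open>q\<close> into
    \<open>N\<close> by composition form a closed set containing the orbit of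
    \<open>e\<close>.\<close>
  have YN: "?c p q \<in> N" if "p \<in> Y" "q \<in> N" for p q
  proof -
    let ?K = "{p \<in> topspace P. ?c p q \<in> N}"
    have q: "q \<in> topspace P" using that NP by auto
    have "closedin P ?K" using closedin_continuous_map_preimage[OF rcont[OF q] N(1)] .
    moreover have "orbit G \<epsilon> e \<subseteq> ?K"
      using orbP act_c eP q e_c N(3) that(2) unfolding E.invariant_def orbit_def by auto
    ultimately have "Y \<subseteq> ?K" unfolding Y_def by (rule closure_of_minimal[rotated])
    then show ?thesis using that by auto
  qed
  have NN: "?c p q \<in> N" if "p \<in> N" "q \<in> N" for p q using YN that NY by blast
  obtain u where u: "u \<in> N" "?c u u = u"
  proof (rule ellis_numakura_idempotent[OF E.compact E.Hausdorff N(1,2), where f = ?c])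
    show "?c p q \<in> N" if "p \<in> N" "q \<in> N" for p q using NN that .
    show "?c (?c p q) r = ?c p (?c q r)" if "p \<in> N" "q \<in> N" "r \<in> N" for p q r
      by (rule assoc) (use that NP in blast)+
    show "continuous_map P P (\<lambda>p. ?c p q)" if "q \<in> N" for q
      by (rule rcont) (use that NP in blast)
  qed (rule that)
  \<comment> \<open>As a closed invariant subset of the minimal set \<open>N\<close>, the set
    \<open>N q\<close> is everything.\<close>
  have ideal: "(\<lambda>p. ?c p q) ` N = N" if q: "q \<in> N" for q
  proof (rule min)
    have qP: "q \<in> topspace P" using q NP by auto
    show "(\<lambda>p. ?c p q) ` N \<subseteq> N" using NN q by auto
    show "closedin P ((\<lambda>p. ?c p q) ` N)"
      using image_compactin[OF closedin_compact_space[OF E.compact N(1)] rcont[OF qP]]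
        compactin_imp_closedin[OF E.Hausdorff] by simp
    show "E.invariant ((\<lambda>p. ?c p q) ` N)"
      unfolding E.invariant_def
    proof (intro ballI)
      fix g r assume g: "g \<in> carrier G" and "r \<in> (\<lambda>p. ?c p q) ` N"
      then obtain p where p: "p \<in> N" "r = ?c p q" by auto
      then have "\<epsilon> g r = ?c (\<epsilon> g p) q" using act_c[OF g _ qP] NP by auto
      then show "\<epsilon> g r \<in> (\<lambda>p. ?c p q) ` N" using p g N(3) unfolding E.invariant_def by auto
    qed
  qed (use N in auto)
  have right_id: "?c p u = p" if p: "p \<in> N" for p
  proof -
    obtain p' where p': "p' \<in> N" "p = ?c p' u" using ideal[OF u(1)] p by (metis (no_types, lifting) imageE)
    then show ?thesis using assoc[of p' u u] u NP by auto
  qed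
  define Z where "Z = subtopology P N"
  define \<zeta> where "\<zeta> = (\<lambda>g. restrict (\<epsilon> g) N)"
  have tZ: "topspace Z = N" using NP by (auto simp: Z_def)
  have Zmin: "minimal_flow G T Z \<zeta>"
    unfolding Z_def \<zeta>_def by (rule E.minimal_flow_restrict[OF N(1,3,2) min])
  have inj: "inj_on \<eta> N" if \<eta>: "continuous_map Z Z \<eta>" "equivariant G Z \<zeta> \<zeta> \<eta>" for \<eta>
  proof -
    have \<eta>N: "\<eta> p \<in> N" if "p \<in> N" for p using continuous_map_funspace[OF \<eta>(1)] that tZ by auto
    define w where "w = \<eta> u"
    have w: "w \<in> N" using \<eta>N u by (simp add: w_def)
    \<comment> \<open>Both sides are continuous in \<open>p\<close> and agree on the orbit of
      \<open>e\<close> by equivariance. As \<open>u\<close> is a right identity of \<open>N\<close>,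
      this makes \<eta> the right translation by \<open>w\<close>.\<close>
    have transl: "\<eta> (?c p u) = ?c p w" if p: "p \<in> Y" for p
    proof (rule forall_in_closure_of_eq[where f = "\<lambda>p. \<eta> (?c p u)" and g = "\<lambda>p. ?c p w"])
      show "p \<in> subtopology P Y closure_of orbit G \<epsilon> e"
        using p closure_of_subset[OF orbP] unfolding closure_of_subtopology_subset
        by (auto simp: closure_of_subtopology Y_def inf.absorb2)
      show "Hausdorff_space P" by (rule E.Hausdorff)
      have uP: "u \<in> topspace P" "w \<in> topspace P" using u w NP by auto
      have "continuous_map (subtopology P Y) Z (\<lambda>p. ?c p u)"
        unfolding Z_def continuous_map_in_subtopology
        using continuous_map_from_subtopology[OF rcont[OF uP(1)]] YN[OF _ u(1)] by auto
      then have "continuous_map (subtopology P Y) Z (\<lambda>p. \<eta> (?c p u))"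
        using continuous_map_compose[OF _ \<eta>(1)] by (auto simp: o_def)
      then show "continuous_map (subtopology P Y) P (\<lambda>p. \<eta> (?c p u))"
        unfolding Z_def continuous_map_in_subtopology by simp
      show "continuous_map (subtopology P Y) P (\<lambda>p. ?c p w)"
        using continuous_map_from_subtopology[OF rcont[OF uP(2)]] .
      fix q assume "q \<in> orbit G \<epsilon> e"
      then obtain g where g: "g \<in> carrier G" "q = \<epsilon> g e" by (auto simp: orbit_def)
      then have "?c q u = \<zeta> g u" "?c q w = \<zeta> g w"
        using act_c[OF _ eP] uP e_c u w by (auto simp: \<zeta>_def)
      then show "\<eta> (?c q u) = ?c q w"
        using \<eta>(2) g u tZ by (simp add: equivariant_def w_def)
    qed
    have \<eta>eq: "\<eta> p = ?c p w" if "p \<in> N" for p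
      using transl[of p] right_id[OF that] NY that by auto
    have uw: "?c u w = w" using \<eta>eq[OF u(1)] by (simp add: w_def)
    \<comment> \<open>To undo right translation by \<open>w\<close>: \<open>v'\<close> is a left
      inverse of \<open>w\<close> relative to \<open>u\<close>, and \<open>t'\<close> a left inverse
      of \<open>v'\<close>. Then \<open>t' = t' (v' w) = u w = w\<close>, so
      \<open>w v' = u\<close>.\<close>
    obtain v where v: "v \<in> N" "?c v w = u" using ideal[OF w] u by (metis (no_types, lifting) imageE)
    define v' where "v' = ?c u v"
    have v': "v' \<in> N" using NN u v by (simp add: v'_def)
    obtain t where t: "t \<in> N" "?c t v' = u" using ideal[OF v'] u by (metis (no_types, lifting) imageE)
    define t' where "t' = ?c u t"
    have t': "t' \<in> N" using NN u t by (simp add: t'_def)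
    have as: "?c (?c p q) r = ?c p (?c q r)" if "p \<in> N" "q \<in> N" "r \<in> N" for p q r
      by (rule assoc) (use that NP in blast)+
    have v'w: "?c v' w = u" using as[of u v w] u v w by (simp add: v'_def)
    have t'v': "?c t' v' = u" using as[of u t v'] u t v' by (simp add: t'_def)
    have "t' = ?c t' (?c v' w)" using right_id[OF t'] v'w by simp
    also have "\<dots> = w" using as[of t' v' w] t' v' w t'v' uw by simp
    finally have wv': "?c w v' = u" using t'v' by simp
    show ?thesis
    proof (rule inj_onI)
      fix p q assume pq: "p \<in> N" "q \<in> N" "\<eta> p = \<eta> q"
      then have "?c (?c p w) v' = ?c (?c q w) v'" using \<eta>eq by simp
      then have "?c p u = ?c q u" using as pq w v' wv' by simp
      then show "p = q" using right_id pq by simp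
    qed
  qed
  obtain \<theta> where \<theta>: "continuous_map M Z \<theta>" "equivariant G M \<mu> \<zeta> \<theta>"
    using universal_minimal_flow_any_type[OF universal Zmin] by blast
  obtain x where x: "x \<in> S" using nonempty unfolding S_def by blast
  let ?ev = "\<lambda>p. p x"
  have ev: "continuous_map Z M ?ev"
    unfolding Z_def P_def
    by (rule continuous_map_from_subtopology, rule continuous_map_product_projection[OF x])
  have ev_eq: "equivariant G Z \<zeta> \<mu> ?ev"
    using NP x by (auto simp: equivariant_def tZ \<zeta>_def \<epsilon>_def)
  have "?ev ` N = topspace M"
  proof (rule closed_invariant_minimal[OF minimal])
    have "compactin Z N" using closedin_compact_space[OF E.compact N(1)] by (simp add: Z_def compactin_subtopology)
    then show "closedin M (?ev ` N)"
      using image_compactin[OF _ ev] compactin_imp_closedin[OF Hausdorff] by blast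
    show "invariant (?ev ` N)"
      unfolding invariant_def
    proof (intro ballI)
      fix g y assume g: "g \<in> carrier G" "y \<in> ?ev ` N"
      then obtain p where p: "p \<in> N" "y = p x" by auto
      have "\<mu> g y = ?ev (\<epsilon> g p)" using p NP x by (auto simp: \<epsilon>_def)
      then show "\<mu> g y \<in> ?ev ` N" using p g N(3) unfolding E.invariant_def by blast
    qed
  qed (use N in auto)
  \<comment> \<open>Evaluation at \<open>x\<close>, then \<kappa>, then \<theta> is an endomorphism
    of \<open>N\<close>, hence injective. Since evaluation is onto \<open>M\<close>, injectivity
    passes to \<kappa>.\<close>
  moreover have "inj_on (\<lambda>p. \<theta> (\<kappa> (p x))) N"
  proof (rule inj)
    show "continuous_map Z Z (\<lambda>p. \<theta> (\<kappa> (p x)))"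
      using continuous_map_compose[OF continuous_map_compose[OF ev \<kappa>(1)] \<theta>(1)] by (simp add: o_def)
    show "equivariant G Z \<zeta> \<zeta> (\<lambda>p. \<theta> (\<kappa> (p x)))"
      using ev_eq \<kappa>(2) \<theta>(2) continuous_map_funspace[OF ev] continuous_map_funspace[OF \<kappa>(1)]
      unfolding equivariant_def by (simp add: Pi_iff)
  qed
  ultimately show ?thesis
    by (smt (verit, ccfv_threshold) image_iff inj_on_def)
qed

end

section \<open>Right uniformly continuous functions\<close>

context topological_group
begin

text \<open>The pair of \<open>u \<otimes> x\<close> and \<open>x\<close> has quotient
  \<open>u\<close>, so closeness is that of the right uniformity. Values are confined to the unit
  interval so that evaluations lie in a compact product.\<close>

definition ruc :: "('a \<Rightarrow> real) set" where
  "ruc = {f \<in> carrier G \<rightarrow>\<^sub>E {0..1}.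
     \<forall>e>0. \<exists>U. nbhd_one U \<and> (\<forall>u\<in>U. \<forall>x\<in>carrier G. \<bar>f (u \<otimes> x) - f x\<bar> < e)}"

lemma ruc_uniform:
  assumes "f \<in> ruc" "e > 0"
  obtains U where "nbhd_one U" "\<And>u x. u \<in> U \<Longrightarrow> x \<in> carrier G \<Longrightarrow> \<bar>f (u \<otimes> x) - f x\<bar> < e"
  using assms unfolding ruc_def by blast

lemma ruc_range: "f \<in> ruc \<Longrightarrow> x \<in> carrier G \<Longrightarrow> f x \<in> {0..1}"
  by (auto simp: ruc_def)

text \<open>
  The exponents of a word record a chain of small moves; \<open>V (Suc n)\<close> being a cube root of \<open>V n\<close>, a
  word of weight below \<open>2\<^sup>-\<^sup>m\<close> stays in \<open>V m\<close>, as in Frink's metrization lemma.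
\<close>
lemma frink_words:
  fixes V :: "nat \<Rightarrow> 'a set" and W :: "nat list \<Rightarrow> 'a set"
  assumes V1: "\<And>n. \<one> \<in> V n" and VG: "\<And>n. V n \<subseteq> carrier G"
    and V3: "\<And>n u v w. u \<in> V (Suc n) \<Longrightarrow> v \<in> V (Suc n) \<Longrightarrow> w \<in> V (Suc n) \<Longrightarrow> u \<otimes> v \<otimes> w \<in> V n"
    and W: "W [] = {\<one>}" "\<And>n ns. W (n # ns) = {v \<otimes> w |v w. v \<in> V n \<and> w \<in> W ns}"
  shows "(\<Sum>n\<leftarrow>ns. (1/2) ^ n) < (1/2 :: real) ^ m \<Longrightarrow> W ns \<subseteq> V m"
proof (induction "length ns" arbitrary: ns m rule: less_induct)
  case less
  let ?wt = "\<lambda>ns. \<Sum>n\<leftarrow>ns. (1/2 :: real) ^ n"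
  have WG: "W ns \<subseteq> carrier G" for ns
    by (induction ns) (auto simp: W intro!: m_closed dest: subsetD[OF VG])
  have split: "W (xs @ ys) = {x \<otimes> y |x y. x \<in> W xs \<and> y \<in> W ys}" for xs ys
  proof (induction xs)
    case Nil
    then show ?case using W(1) WG[of ys] by (force simp: subset_iff)
  next
    case (Cons n xs)
    show ?case
    proof
      show "W ((n # xs) @ ys) \<subseteq> {x \<otimes> y |x y. x \<in> W (n # xs) \<and> y \<in> W ys}"
      proof
        fix z assume "z \<in> W ((n # xs) @ ys)"
        then obtain v x y where *: "v \<in> V n" "x \<in> W xs" "y \<in> W ys" "z = v \<otimes> (x \<otimes> y)"
          using Cons W(2) by auto
        then have "z = (v \<otimes> x) \<otimes> y" using WG VG m_assoc by (metis subsetD)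
        then show "z \<in> {x \<otimes> y |x y. x \<in> W (n # xs) \<and> y \<in> W ys}" using * W(2) by blast
      qed
      show "{x \<otimes> y |x y. x \<in> W (n # xs) \<and> y \<in> W ys} \<subseteq> W ((n # xs) @ ys)"
      proof
        fix z assume "z \<in> {x \<otimes> y |x y. x \<in> W (n # xs) \<and> y \<in> W ys}"
        then obtain v x y where *: "v \<in> V n" "x \<in> W xs" "y \<in> W ys" "z = (v \<otimes> x) \<otimes> y"
          using W(2) by auto
        then have "z = v \<otimes> (x \<otimes> y)" using WG VG m_assoc by (metis subsetD)
        then show "z \<in> W ((n # xs) @ ys)" using * Cons W(2) by auto
      qed
    qed
  qed
  have VS: "V (Suc n) \<subseteq> V n" for n
  proof
    fix v assume "v \<in> V (Suc n)"
    then show "v \<in> V n" using V3[of v n \<one> \<one>] V1[of "Suc n"] VG[of "Suc n"] by auto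
  qed
  have Vmono: "V n \<subseteq> V k" if "k \<le> n" for n k
    using that by (rule lift_Suc_antimono_le[of V, OF VS])
  have wt0: "?wt xs \<ge> 0" for xs by (rule sum_list_nonneg) auto
  show ?case
  proof (cases "ns = []")
    case True
    then show ?thesis using W(1) V1 by simp
  next
    case False
    then have pos: "?wt ns > 0"
      using wt0 by (cases ns) (auto simp: add_pos_nonneg)
    \<comment> \<open>The longest prefix of at most half the weight. The letter after it crosses the
      half, so the remaining suffix weighs less than half, and the word becomes a product of three
      factors.\<close>
    define i where "i = (GREATEST i. i \<le> length ns \<and> ?wt (take i ns) \<le> ?wt ns / 2)"
    have i: "i \<le> length ns \<and> ?wt (take i ns) \<le> ?wt ns / 2"
      unfolding i_def by (rule GreatestI_nat[where k = 0 and b = "length ns"]) (use pos in auto)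
    have "i < length ns" using i pos by (cases "i = length ns") auto
    have "\<not> (Suc i \<le> length ns \<and> ?wt (take (Suc i) ns) \<le> ?wt ns / 2)"
      using Greatest_le_nat[of "\<lambda>i. i \<le> length ns \<and> ?wt (take i ns) \<le> ?wt ns / 2" "Suc i" "length ns"]
      unfolding i_def[symmetric] by auto
    then have big: "?wt (take (Suc i) ns) > ?wt ns / 2" using \<open>i < length ns\<close> by auto
    define xs ys k where "xs = take i ns" and "ys = drop (Suc i) ns" and "k = ns ! i"
    have ns: "ns = xs @ k # ys"
      using id_take_nth_drop[OF \<open>i < length ns\<close>] by (simp add: xs_def ys_def k_def)
    have "?wt (take (Suc i) ns) = ?wt xs + (1/2) ^ k"
      using \<open>i < length ns\<close> by (simp add: take_Suc_conv_app_nth xs_def k_def)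
    moreover have wns: "?wt ns = ?wt xs + (1/2) ^ k + ?wt ys" by (simp add: ns)
    ultimately have "?wt ys < ?wt ns / 2" using big by simp
    then have "?wt ys < (1/2) ^ Suc m" "?wt xs < (1/2) ^ Suc m"
      using less.prems i by (auto simp: xs_def)
    then have sub: "W ys \<subseteq> V (Suc m)" "W xs \<subseteq> V (Suc m)"
      using less.hyps[of ys "Suc m"] less.hyps[of xs "Suc m"] by (auto simp: ns)
    \<comment> \<open>Weights of letters are powers of two: a single letter lighter than
      \<open>(1/2) ^ m\<close> already has exponent at least \<open>Suc m\<close>, although it may
      weigh more than half of the word.\<close>
    have "(1/2 :: real) ^ k < (1/2) ^ m" using wns wt0[of xs] wt0[of ys] less.prems by linarith
    then have "Suc m \<le> k" by simp
    then have subk: "V k \<subseteq> V (Suc m)" by (rule Vmono)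
    show ?thesis
    proof
      fix z assume "z \<in> W ns"
      then obtain x v y where z: "x \<in> W xs" "v \<in> V k" "y \<in> W ys" "z = x \<otimes> (v \<otimes> y)"
        unfolding ns split W(2) by blast
      then have "z = x \<otimes> v \<otimes> y" using WG VG m_assoc by (metis subsetD)
      then show "z \<in> V m" using V3 z sub subk by (simp add: subset_iff)
    qed
  qed
qed

text \<open>A Urysohn function for the right uniformity: \<open>h x\<close> is the infimum, capped
  at 1, of the weights of words leading from \<open>A\<close> to \<open>x\<close>. Prefixing the
  letter \<open>n\<close> costs at most \<open>(1/2) ^ n\<close>, whence uniform continuity; a word
  of weight below 1 stays in \<open>V 0\<close>, inside \<open>U\<close>, and cannot reach
  \<open>B\<close>.\<close>

lemma ruc_separation:
  assumes U: "nbhd_one U" and A: "A \<subseteq> carrier G" and B: "B \<subseteq> carrier G"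
    and disj: "\<And>u a. u \<in> U \<Longrightarrow> a \<in> A \<Longrightarrow> u \<otimes> a \<notin> B"
  obtains f where "f \<in> ruc" "\<And>a. a \<in> A \<Longrightarrow> f a = 0" "\<And>b. b \<in> B \<Longrightarrow> f b = 1"
proof -
  let ?ok = "\<lambda>V. nbhd_one V \<and> (\<forall>v\<in>V. inv v \<in> V) \<and> V \<subseteq> U"
  have "\<exists>V. \<forall>n :: nat. ?ok (V n) \<and>
      (\<forall>u\<in>V (Suc n). \<forall>v\<in>V (Suc n). \<forall>w\<in>V (Suc n). u \<otimes> v \<otimes> w \<in> V n)"
  proof (rule dependent_nat_choice)
    show "\<exists>V. ?ok V" by (rule nbhd_one_cube_root[OF U]) blast
    fix V and n :: nat assume "?ok V"
    then show "\<exists>V'. ?ok V' \<and> (\<forall>u\<in>V'. \<forall>v\<in>V'. \<forall>w\<in>V'. u \<otimes> v \<otimes> w \<in> V)"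
      using nbhd_one_cube_root[of V] by (metis order_trans)
  qed
  then obtain V :: "nat \<Rightarrow> 'a set" where V: "\<And>n. nbhd_one (V n)" "\<And>n v. v \<in> V n \<Longrightarrow> inv v \<in> V n"
    "\<And>n. V n \<subseteq> U"
    and V3: "\<And>n u v w. u \<in> V (Suc n) \<Longrightarrow> v \<in> V (Suc n) \<Longrightarrow> w \<in> V (Suc n) \<Longrightarrow> u \<otimes> v \<otimes> w \<in> V n"
    by blast
  have V1: "\<one> \<in> V n" for n using V(1) by (simp add: nbhd_one_def)
  have VG: "V n \<subseteq> carrier G" for n using nbhd_one_subset[OF V(1)] by auto
  define W where "W = rec_list {\<one>} (\<lambda>n (_::nat list) S. {v \<otimes> w |v w. v \<in> V n \<and> w \<in> S})"
  have W: "W [] = {\<one>}" "\<And>n ns. W (n # ns) = {v \<otimes> w |v w. v \<in> V n \<and> w \<in> W ns}"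
    by (simp_all add: W_def)
  have WG: "W ns \<subseteq> carrier G" for ns
    by (induction ns) (auto simp: W intro!: m_closed dest: subsetD[OF VG])
  let ?wt = "\<lambda>ns. \<Sum>n\<leftarrow>ns. (1/2 :: real) ^ n"
  have wt0: "?wt xs \<ge> 0" for xs by (rule sum_list_nonneg) auto
  \<comment> \<open>The added 1 caps the function and keeps \<open>R x\<close> nonempty at points
    that no word reaches.\<close>
  define R where "R x = insert 1 {?wt ns |ns. \<exists>w\<in>W ns. \<exists>a\<in>A. x = w \<otimes> a}" for x
  have R0: "0 \<le> s" if "s \<in> R x" for s x using that wt0 by (auto simp: R_def)
  have Rne: "R x \<noteq> {}" for x by (simp add: R_def)
  have bdd: "bdd_below (R x)" for x using R0 by (meson bdd_belowI)
  define h where "h x = Inf (R x)" for x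
  have h01: "h x \<in> {0..1}" for x
    using cInf_greatest[OF Rne R0] cInf_lower[OF _ bdd, of 1 x] by (auto simp: h_def R_def)
  have hA: "h a = 0" if a: "a \<in> A" for a
  proof -
    have "a = \<one> \<otimes> a" using a A by auto
    then have "\<exists>w\<in>W []. \<exists>a'\<in>A. a = w \<otimes> a'" using W(1) a by blast
    then have "?wt [] \<in> R a" unfolding R_def by blast
    then have "h a \<le> 0" using cInf_lower[OF _ bdd] by (auto simp: h_def)
    then show ?thesis using h01[of a] by auto
  qed
  have hB: "h b = 1" if b: "b \<in> B" for b
  proof -
    have "1 \<le> s" if s: "s \<in> R b" for s
    proof (rule ccontr)
      assume "\<not> 1 \<le> s"
      then obtain ns w a where "s = ?wt ns" and *: "w \<in> W ns" "a \<in> A" "b = w \<otimes> a"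
        using s unfolding R_def by blast
      then have "?wt ns < (1/2) ^ 0" using \<open>\<not> 1 \<le> s\<close> by simp
      then have "w \<in> V 0" using * frink_words[OF V1 VG V3 W] by blast
      then show False using disj V(3) * b by blast
    qed
    then have "1 \<le> h b" unfolding h_def using cInf_greatest[OF Rne] by blast
    then show ?thesis using h01[of b] by auto
  qed
  have step: "h (v \<otimes> x) \<le> h x + (1/2) ^ n" if v: "v \<in> V n" and x: "x \<in> carrier G" for v x n
  proof -
    have "h (v \<otimes> x) - (1/2) ^ n \<le> s" if s: "s \<in> R x" for s
    proof (cases "s = 1")
      case True
      have "h (v \<otimes> x) \<le> 1" using h01[of "v \<otimes> x"] by simp
      moreover have "(0::real) \<le> (1/2) ^ n" by simp
      ultimately show ?thesis using True by linarith
    next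
      case False
      then obtain ns w a where *: "s = ?wt ns" "w \<in> W ns" "a \<in> A" "x = w \<otimes> a"
        using s unfolding R_def by blast
      then have "v \<otimes> x = (v \<otimes> w) \<otimes> a" using v WG VG A m_assoc by (metis subsetD)
      moreover have "v \<otimes> w \<in> W (n # ns)" using W(2) v * by blast
      ultimately have "?wt (n # ns) \<in> R (v \<otimes> x)" unfolding R_def using * by blast
      then have "h (v \<otimes> x) \<le> ?wt (n # ns)" unfolding h_def using cInf_lower[OF _ bdd] by blast
      then show ?thesis using * by simp
    qed
    then have "h (v \<otimes> x) - (1/2) ^ n \<le> h x" unfolding h_def[of x] using cInf_greatest[OF Rne] by blast
    then show ?thesis by simp
  qed
  have unif: "\<bar>h (v \<otimes> x) - h x\<bar> \<le> (1/2) ^ n" if v: "v \<in> V n" and x: "x \<in> carrier G" for v x n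
  proof -
    have "v \<in> carrier G" using v VG by auto
    then have "inv v \<otimes> (v \<otimes> x) = x" using x by (simp flip: m_assoc)
    then show ?thesis using step[OF v x] step[OF V(2)[OF v], of "v \<otimes> x"] \<open>v \<in> carrier G\<close> x by auto
  qed
  show thesis
  proof (rule that[of "restrict h (carrier G)"])
    show "restrict h (carrier G) \<in> ruc"
      unfolding ruc_def
    proof (intro CollectI conjI allI impI)
      show "restrict h (carrier G) \<in> carrier G \<rightarrow>\<^sub>E {0..1}" using h01 by auto
      fix e :: real assume "e > 0"
      then obtain n where n: "(1/2 :: real) ^ n < e" using real_arch_pow_inv[of e "1/2"] by auto
      have "\<forall>u\<in>V n. \<forall>x\<in>carrier G. \<bar>restrict h (carrier G) (u \<otimes> x) - restrict h (carrier G) x\<bar> < e"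
      proof (intro ballI)
        fix u x assume "u \<in> V n" "x \<in> carrier G"
        then show "\<bar>restrict h (carrier G) (u \<otimes> x) - restrict h (carrier G) x\<bar> < e"
          using unif[of u n x] n VG[of n] by auto
      qed
      then show "\<exists>U. nbhd_one U \<and> (\<forall>u\<in>U. \<forall>x\<in>carrier G. \<bar>restrict h (carrier G) (u \<otimes> x) - restrict h (carrier G) x\<bar> < e)"
        using V(1) by blast
    qed
  qed (use hA hB A B in auto)
qed

end

section \<open>The Samuel compactification as a flow\<close>

lemma in_closure_ofE:
  assumes "x \<in> X closure_of S" "openin X W" "x \<in> W"
  obtains y where "y \<in> S" "y \<in> W"
  using assms by (auto simp: in_closure_of)

lemma continuous_map_into_subtopology_of:
  "Z = subtopology Y L \<Longrightarrow> continuous_map X Y h \<Longrightarrow> h \<in> topspace X \<rightarrow> topspace Z \<Longrightarrow> continuous_map X Z h"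
  by (auto simp: continuous_map_in_subtopology)

context topological_group
begin

definition translate :: "'a \<Rightarrow> ('a \<Rightarrow> real) \<Rightarrow> 'a \<Rightarrow> real" where
  "translate g f = (\<lambda>x\<in>carrier G. f (g \<otimes> x))"

text \<open>Since \<open>g v x = (g v inv g) (g x)\<close>, a neighbourhood that \<open>g\<close>
  conjugates into \<open>U\<close> serves for the translate.\<close>

lemma translate_ruc:
  assumes f: "f \<in> ruc" and g: "g \<in> carrier G"
  shows "translate g f \<in> ruc"
  unfolding ruc_def
proof (intro CollectI conjI allI impI)
  show "translate g f \<in> carrier G \<rightarrow>\<^sub>E {0..1}"
    using ruc_range[OF f] g by (auto simp: translate_def)
  fix e :: real assume "e > 0"
  then obtain U where U: "nbhd_one U" "\<And>u x. u \<in> U \<Longrightarrow> x \<in> carrier G \<Longrightarrow> \<bar>f (u \<otimes> x) - f x\<bar> < e"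
    using ruc_uniform[OF f] by blast
  obtain V where V: "nbhd_one V" "\<And>v. v \<in> V \<Longrightarrow> g \<otimes> v \<otimes> inv g \<in> U"
    using nbhd_one_conjugate[OF U(1) g] by blast
  have "\<bar>translate g f (v \<otimes> x) - translate g f x\<bar> < e" if v: "v \<in> V" and x: "x \<in> carrier G" for v x
  proof -
    have vG: "v \<in> carrier G" using nbhd_one_subset[OF V(1) v] .
    have "inv g \<otimes> (g \<otimes> x) = x" using g x by (simp flip: m_assoc)
    then have "(g \<otimes> v \<otimes> inv g) \<otimes> (g \<otimes> x) = g \<otimes> (v \<otimes> x)"
      using g x vG by (simp add: m_assoc)
    then show ?thesis using U(2)[OF V(2)[OF v], of "g \<otimes> x"] g x vG by (simp add: translate_def)
  qed
  then show "\<exists>U. nbhd_one U \<and> (\<forall>u\<in>U. \<forall>x\<in>carrier G. \<bar>translate g f (u \<otimes> x) - translate g f x\<bar> < e)"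
    using V(1) by blast
qed

lemma translate_one: "f \<in> ruc \<Longrightarrow> translate \<one> f = f"
  by (auto simp: translate_def ruc_def PiE_def extensional_def fun_eq_iff)

lemma translate_mult:
  "g \<in> carrier G \<Longrightarrow> h \<in> carrier G \<Longrightarrow> translate (g \<otimes> h) f = translate h (translate g f)"
  by (auto simp: translate_def m_assoc fun_eq_iff)

text \<open>
  Every point of the Samuel compactification of the right uniformity of \<open>G\<close> evaluates functions in
  \<open>ruc\<close> and is 1-Lipschitz for the uniform norm; no further property of its points is needed.
\<close>
definition ambit :: "(('a \<Rightarrow> real) \<Rightarrow> real) topology" where
  "ambit = subtopology (product_topology (\<lambda>_. top_of_set {0..1}) ruc)
     {p. \<forall>f\<in>ruc. \<forall>f'\<in>ruc. \<forall>e. (\<forall>x\<in>carrier G. \<bar>f x - f' x\<bar> \<le> e) \<longrightarrow> \<bar>p f - p f'\<bar> \<le> e}"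

text \<open>\<open>translate\<close> reverses products, so precomposing with it gives a left action;
  on evaluations it is left multiplication.\<close>

definition ambit_action :: "'a \<Rightarrow> (('a \<Rightarrow> real) \<Rightarrow> real) \<Rightarrow> ('a \<Rightarrow> real) \<Rightarrow> real" where
  "ambit_action g = (\<lambda>p\<in>topspace ambit. \<lambda>f\<in>ruc. p (translate g f))"

definition evaluation :: "'a \<Rightarrow> ('a \<Rightarrow> real) \<Rightarrow> real" where
  "evaluation g = (\<lambda>f\<in>ruc. f g)"

lemma topspace_ambit:
  "p \<in> topspace ambit \<longleftrightarrow> p \<in> ruc \<rightarrow>\<^sub>E {0..1} \<and>
     (\<forall>f\<in>ruc. \<forall>f'\<in>ruc. \<forall>e. (\<forall>x\<in>carrier G. \<bar>f x - f' x\<bar> \<le> e) \<longrightarrow> \<bar>p f - p f'\<bar> \<le> e)"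
  by (auto simp: ambit_def)

lemma ambit_lipschitz:
  assumes "p \<in> topspace ambit" "f \<in> ruc" "f' \<in> ruc" "\<And>x. x \<in> carrier G \<Longrightarrow> \<bar>f x - f' x\<bar> \<le> e"
  shows "\<bar>p f - p f'\<bar> \<le> e"
  using assms unfolding topspace_ambit by blast

lemma continuous_ambit_coordinate:
  assumes "f \<in> ruc"
  shows "continuous_map ambit euclideanreal (\<lambda>p. p f)"
proof -
  have "continuous_map (product_topology (\<lambda>_. top_of_set {0..1::real}) ruc) euclideanreal (\<lambda>p. p f)"
    using continuous_map_product_projection[OF assms, of "\<lambda>_. top_of_set {0..1::real}"]
      continuous_map_in_subtopology by blast
  then show ?thesis unfolding ambit_def by (rule continuous_map_from_subtopology)
qed

lemma ambit_action_apply: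
  "p \<in> topspace ambit \<Longrightarrow> f \<in> ruc \<Longrightarrow> ambit_action g p f = p (translate g f)"
  unfolding ambit_action_def restrict_def by (simp only: if_True)

lemma ambit_action_undefined:
  "p \<in> topspace ambit \<Longrightarrow> f \<notin> ruc \<Longrightarrow> ambit_action g p f = undefined"
  unfolding ambit_action_def restrict_def by (simp only: if_True if_False)

lemma evaluation_ambit: "g \<in> carrier G \<Longrightarrow> evaluation g \<in> topspace ambit"
  using ruc_range by (auto simp: topspace_ambit evaluation_def)

lemma ambit_action_evaluation:
  assumes "g \<in> carrier G" "h \<in> carrier G"
  shows "ambit_action g (evaluation h) = evaluation (g \<otimes> h)"
proof
  fix f
  show "ambit_action g (evaluation h) f = evaluation (g \<otimes> h) f"
  proof (cases "f \<in> ruc")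
    case True
    then have "ambit_action g (evaluation h) f = translate g f h"
      using assms evaluation_ambit translate_ruc by (simp add: ambit_action_def evaluation_def)
    then show ?thesis using True assms by (simp add: evaluation_def translate_def)
  qed (use assms evaluation_ambit in \<open>simp add: ambit_action_def, simp add: evaluation_def\<close>)
qed

lemma ambit_action_closed:
  assumes g: "g \<in> carrier G" and p: "p \<in> topspace ambit"
  shows "ambit_action g p \<in> topspace ambit"
proof -
  have "\<bar>p (translate g f) - p (translate g f')\<bar> \<le> e"
    if "f \<in> ruc" "f' \<in> ruc" "\<forall>x\<in>carrier G. \<bar>f x - f' x\<bar> \<le> e" for f f' e
    using that g by (intro ambit_lipschitz[OF p]) (auto simp: translate_ruc, auto simp: translate_def)
  moreover have "p (translate g f) \<in> {0..1}" if "f \<in> ruc" for f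
    using p translate_ruc[OF that g] unfolding topspace_ambit by blast
  ultimately show ?thesis using p unfolding topspace_ambit[of "ambit_action g p"]
    by (auto simp: ambit_action_def)
qed

lemma compact_Hausdorff_ambit: "compact_space ambit" "Hausdorff_space ambit"
proof -
  let ?P = "product_topology (\<lambda>_. top_of_set {0..1::real}) (ruc :: ('a \<Rightarrow> real) set)"
  have cP: "compact_space ?P" and hP: "Hausdorff_space ?P"
    by (simp_all add: compact_space_product_topology Hausdorff_space_product_topology
        compact_space_subtopology Hausdorff_space_subtopology)
  have proj: "continuous_map ?P euclideanreal (\<lambda>p. p f)" if "f \<in> ruc" for f
    using continuous_map_product_projection[OF that, of "\<lambda>_. top_of_set {0..1::real}"]
      continuous_map_in_subtopology by blast
  define K where "K f f' e = {p \<in> topspace ?P. \<bar>p f - p f'\<bar> \<in> {..e}}" for f f' :: "'a \<Rightarrow> real" and e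
  define Q where "Q = {(f, f', e). f \<in> ruc \<and> f' \<in> ruc \<and> (\<forall>x\<in>carrier G. \<bar>f x - f' x\<bar> \<le> e)}"
  have clK: "closedin ?P (K f f' e)" if "f \<in> ruc" "f' \<in> ruc" for f f' e
    unfolding K_def
    by (rule closedin_continuous_map_preimage[where Y = euclideanreal])
      (auto intro!: continuous_map_real_abs continuous_map_diff proj that simp flip: closed_closedin)
  have "closedin ?P (topspace ?P \<inter> (\<Inter>(f, f', e)\<in>Q. K f f' e))"
  proof (cases "Q = {}")
    case False
    then show ?thesis by (intro closedin_Int[OF closedin_topspace] closedin_INT) (auto simp: Q_def intro: clK simp del: topspace_product_topology)
  qed (simp del: topspace_product_topology)
  moreover have "ambit = subtopology ?P (topspace ?P \<inter> (\<Inter>(f, f', e)\<in>Q. K f f' e))"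
  proof -
    define L where "L = {p :: ('a \<Rightarrow> real) \<Rightarrow> real. \<forall>f\<in>ruc. \<forall>f'\<in>ruc. \<forall>e.
      (\<forall>x\<in>carrier G. \<bar>f x - f' x\<bar> \<le> e) \<longrightarrow> \<bar>p f - p f'\<bar> \<le> e}"
    have "p \<in> L \<longleftrightarrow> p \<in> (\<Inter>(f, f', e)\<in>Q. K f f' e)" if "p \<in> topspace ?P" for p
      using that unfolding L_def Q_def K_def by (simp del: topspace_product_topology) blast
    then have "topspace ?P \<inter> L = topspace ?P \<inter> (\<Inter>(f, f', e)\<in>Q. K f f' e)" by blast
    moreover have "ambit = subtopology ?P (topspace ?P \<inter> L)"
      unfolding ambit_def L_def subtopology_restrict by (rule refl)
    ultimately show ?thesis by simp
  qed
  ultimately show "compact_space ambit" "Hausdorff_space ambit"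
    using closedin_compact_space[OF cP] hP by (simp_all add: compact_space_subtopology Hausdorff_space_subtopology)
qed

text \<open>Joint continuity is what the Lipschitz condition is for: as \<open>g\<close> approaches
  \<open>g0\<close>, the translates of \<open>f\<close> converge uniformly, so their values under
  \<open>p\<close> converge uniformly in \<open>p\<close>.\<close>

lemma flow_ambit: "flow G T ambit ambit_action"
proof -
  have one: "ambit_action \<one> p = p" if p: "p \<in> topspace ambit" for p
  proof
    fix f
    show "ambit_action \<one> p f = p f"
    proof (cases "f \<in> ruc")
      case True
      then show ?thesis by (simp only: ambit_action_apply[OF p] translate_one)
    next
      case False
      have "p \<in> ruc \<rightarrow>\<^sub>E {0..1}" using p unfolding topspace_ambit by (rule conjunct1)
      then have "p f = undefined" using False by (rule PiE_arb)
      then show ?thesis using ambit_action_undefined[OF p False] by simp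
    qed
  qed
  have mult: "ambit_action (g \<otimes> h) p = ambit_action g (ambit_action h p)"
    if gh: "g \<in> carrier G" "h \<in> carrier G" and p: "p \<in> topspace ambit" for g h p
  proof
    fix f
    have hp: "ambit_action h p \<in> topspace ambit" using ambit_action_closed gh p by blast
    show "ambit_action (g \<otimes> h) p f = ambit_action g (ambit_action h p) f"
      using ambit_action_apply[OF p] ambit_action_apply[OF hp] ambit_action_undefined[OF p]
        ambit_action_undefined[OF hp] translate_ruc[of f g] translate_mult[of g h f] gh
      by (cases "f \<in> ruc") simp_all
  qed
  have ext: "ambit_action g \<in> extensional (topspace ambit)" for g
    unfolding ambit_action_def by (rule restrict_extensional)
  let ?Q = "prod_topology T ambit"
  have tQ: "topspace ?Q = carrier G \<times> topspace ambit" using topspace_eq_carrier by simp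
  have coord: "continuous_map ?Q euclideanreal (\<lambda>(g, p). p (translate g f))" if f: "f \<in> ruc" for f
    unfolding continuous_map_euclideanreal_iff
  proof (intro ballI allI impI)
    fix q and e :: real assume q: "q \<in> topspace ?Q" and e: "e > 0"
    obtain g0 p0 where q0: "q = (g0, p0)" "g0 \<in> carrier G" "p0 \<in> topspace ambit"
      using q unfolding tQ by auto
    obtain U where U: "nbhd_one U" "\<And>u x. u \<in> U \<Longrightarrow> x \<in> carrier G \<Longrightarrow> \<bar>f (u \<otimes> x) - f x\<bar> < e / 2"
      using ruc_uniform[OF f, of "e / 2"] e by auto
    define A where "A = {g \<in> carrier G. g \<otimes> inv g0 \<in> U}"
    have "openin T A"
      using openin_continuous_map_preimage[OF continuous_right_translation[of "inv g0"], of U] U(1) q0(2)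
        topspace_eq_carrier by (simp add: A_def nbhd_one_def)
    moreover have "g0 \<in> A" using q0(2) U(1) by (simp add: A_def nbhd_one_def)
    moreover obtain B where "openin ambit B" "p0 \<in> B"
      "\<And>p. p \<in> B \<Longrightarrow> \<bar>p (translate g0 f) - p0 (translate g0 f)\<bar> < e / 2"
      using continuous_ambit_coordinate[OF translate_ruc[OF f q0(2)]] q0(3) e
      unfolding continuous_map_euclideanreal_iff by (meson half_gt_zero)
    note B = this
    have BA: "B \<subseteq> topspace ambit" using B(1) openin_subset by blast
    have "\<bar>p (translate g f) - p0 (translate g0 f)\<bar> < e" if "g \<in> A" "p \<in> B" for g p
    proof -
      have g: "g \<in> carrier G" using that by (simp add: A_def)
      have lip: "\<bar>translate g f x - translate g0 f x\<bar> \<le> e / 2" if x: "x \<in> carrier G" for x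
      proof -
        have "inv g0 \<otimes> (g0 \<otimes> x) = x" using q0(2) x by (simp flip: m_assoc)
        then have "g \<otimes> inv g0 \<otimes> (g0 \<otimes> x) = g \<otimes> x" using g q0(2) x by (simp add: m_assoc)
        then show ?thesis using U(2)[of "g \<otimes> inv g0" "g0 \<otimes> x"] \<open>g \<in> A\<close> g q0(2) x
          by (simp add: A_def translate_def)
      qed
      have "\<bar>p (translate g f) - p (translate g0 f)\<bar> \<le> e / 2"
        by (rule ambit_lipschitz[OF subsetD[OF BA that(2)] translate_ruc[OF f g] translate_ruc[OF f q0(2)] lip])
      then show ?thesis using B(3)[OF that(2)] by linarith
    qed
    then have "\<forall>y\<in>A \<times> B. \<bar>(case y of (g, p) \<Rightarrow> p (translate g f)) - (case q of (g, p) \<Rightarrow> p (translate g f))\<bar> < e"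
      by (auto simp: q0(1))
    moreover have "openin ?Q (A \<times> B)" "q \<in> A \<times> B"
      using \<open>openin T A\<close> \<open>g0 \<in> A\<close> B(1,2) q0(1) by (auto simp: openin_prod_Times_iff)
    ultimately show "\<exists>W. openin ?Q W \<and> q \<in> W \<and>
        (\<forall>y\<in>W. \<bar>(case y of (g, p) \<Rightarrow> p (translate g f)) - (case q of (g, p) \<Rightarrow> p (translate g f))\<bar> < e)"
      by blast
  qed
  have "continuous_map ?Q (product_topology (\<lambda>_. top_of_set {0..1}) ruc) (\<lambda>q. \<lambda>f\<in>ruc. snd q (translate (fst q) f))"
    unfolding continuous_map_componentwise
  proof (intro conjI ballI)
    fix f assume f: "f \<in> ruc"
    have "p (translate g f) \<in> {0..1}" if "g \<in> carrier G" "p \<in> topspace ambit" for g p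
      using that translate_ruc[OF f that(1)] unfolding topspace_ambit by blast
    then show "continuous_map ?Q (top_of_set {0..1}) (\<lambda>q. (\<lambda>f\<in>ruc. snd q (translate (fst q) f)) f)"
      using coord[OF f] f tQ by (auto simp: continuous_map_in_subtopology case_prod_unfold)
  qed auto
  then have "continuous_map ?Q (product_topology (\<lambda>_. top_of_set {0..1}) ruc) (\<lambda>(g, p). ambit_action g p)"
    by (rule continuous_map_eq) (auto simp: ambit_action_def)
  moreover have "(\<lambda>(g, p). ambit_action g p) \<in> topspace ?Q \<rightarrow> topspace ambit"
    using ambit_action_closed tQ by auto
  ultimately have cont: "continuous_map ?Q ambit (\<lambda>(g, p). ambit_action g p)"
    by (rule continuous_map_into_subtopology_of[OF ambit_def])
  show ?thesis
    by (intro flowI[OF compact_Hausdorff_ambit] ambit_action_closed ext one mult cont)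
qed

end

lemma (in G_flow) flow_prod:
  assumes "flow G T Y \<beta>"
  shows "flow G T (prod_topology X Y) (\<lambda>g. \<lambda>p\<in>topspace (prod_topology X Y). (\<alpha> g (fst p), \<beta> g (snd p)))"
proof -
  interpret Y: G_flow G T Y \<beta> by unfold_locales (rule assms)
  show ?thesis
  proof (rule flowI)
    show "compact_space (prod_topology X Y)" "Hausdorff_space (prod_topology X Y)"
      using compact Y.compact Hausdorff Y.Hausdorff
      by (simp_all add: compact_space_prod_topology Hausdorff_space_prod_topology)
    let ?Q = "prod_topology T (prod_topology X Y)"
    have "continuous_map ?Q (prod_topology T X) (\<lambda>q. (fst q, fst (snd q)))"
      "continuous_map ?Q (prod_topology T Y) (\<lambda>q. (fst q, snd (snd q)))"
      by (intro continuous_map_pairedI continuous_map_fst continuous_map_fst_of continuous_map_snd_of continuous_map_snd continuous_map_compose[OF continuous_map_snd, unfolded o_def])+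
    from this(1)[THEN continuous_map_compose, OF continuous_action]
      this(2)[THEN continuous_map_compose, OF Y.continuous_action]
    have "continuous_map ?Q (prod_topology X Y) (\<lambda>q. (\<alpha> (fst q) (fst (snd q)), \<beta> (fst q) (snd (snd q))))"
      by (intro continuous_map_pairedI) (simp_all add: o_def)
    then show "continuous_map ?Q (prod_topology X Y)
        (\<lambda>(g, p). (\<lambda>p\<in>topspace (prod_topology X Y). (\<alpha> g (fst p), \<beta> g (snd p))) p)"
      by (rule continuous_map_eq) auto
  qed (auto simp: act_mult Y.act_mult)
qed

section \<open>An equivariant section over the universal minimal flow\<close>

context universal_minimal
begin

text \<open>
  A minimal subset of the orbit closure of \<open>(1, x\<^sub>0)\<close> in \<open>ambit \<times> M\<close> maps onto \<open>M\<close>, injectively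
  because \<open>M\<close> is coalescent; it is therefore the graph of an equivariant map.
\<close>
lemma ambit_section:
  assumes x0: "x0 \<in> topspace M"
  obtains \<sigma> where "\<And>f. f \<in> ruc \<Longrightarrow> continuous_map M euclideanreal (\<lambda>p. \<sigma> p f)"
    and "\<And>f g p. f \<in> ruc \<Longrightarrow> g \<in> carrier G \<Longrightarrow> p \<in> topspace M \<Longrightarrow> \<sigma> (\<mu> g p) f = \<sigma> p (translate g f)"
    and "\<And>p V F e. openin M V \<Longrightarrow> p \<in> V \<Longrightarrow> finite F \<Longrightarrow> F \<subseteq> ruc \<Longrightarrow> e > 0 \<Longrightarrow>
      \<exists>g\<in>carrier G. \<mu> g x0 \<in> V \<and> (\<forall>f\<in>F. \<bar>f g - \<sigma> p f\<bar> < e)"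
proof -
  interpret A: G_flow G T ambit ambit_action by unfold_locales (rule flow_ambit)
  define Q where "Q = prod_topology ambit M"
  define \<gamma> where "\<gamma> = (\<lambda>g. \<lambda>p\<in>topspace Q. (ambit_action g (fst p), \<mu> g (snd p)))"
  interpret Q: G_flow G T Q \<gamma>
    by unfold_locales (unfold Q_def \<gamma>_def, rule A.flow_prod[OF is_flow])
  have tQ: "topspace Q = topspace ambit \<times> topspace M" by (simp add: Q_def)
  let ?b = "(evaluation \<one>, x0)"
  have b: "?b \<in> topspace Q" using evaluation_ambit x0 by (simp add: tQ)
  have \<gamma>b: "\<gamma> g ?b = (evaluation g, \<mu> g x0)" if "g \<in> carrier G" for g
    using b that ambit_action_evaluation by (simp add: \<gamma>_def)
  define Y where "Y = Q closure_of orbit G \<gamma> ?b"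
  have Y: "closedin Q Y" "Q.invariant Y" "Y \<noteq> {}"
    using Q.orbit_closure[OF b] by (auto simp: Y_def)
  obtain N where NY: "N \<subseteq> Y" and N: "closedin Q N" "N \<noteq> {}" "Q.invariant N"
    and min: "\<And>K. K \<subseteq> N \<Longrightarrow> closedin Q K \<Longrightarrow> K \<noteq> {} \<Longrightarrow> Q.invariant K \<Longrightarrow> K = N"
    by (rule Q.minimal_subflow[OF Y]) (rule that)
  have NQ: "N \<subseteq> topspace Q" using N(1) closedin_subset by blast
  define Z where "Z = subtopology Q N"
  define \<zeta> where "\<zeta> = (\<lambda>g. restrict (\<gamma> g) N)"
  have tZ: "topspace Z = N" using NQ by (auto simp: Z_def)
  have Zmin: "minimal_flow G T Z \<zeta>"
    unfolding Z_def \<zeta>_def by (rule Q.minimal_flow_restrict[OF N(1,3,2) min])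
  obtain \<psi> where \<psi>: "continuous_map M Z \<psi>" "equivariant G M \<mu> \<zeta> \<psi>"
    using universal_minimal_flow_any_type[OF universal Zmin] by blast
  have \<psi>N: "\<psi> p \<in> N" if "p \<in> topspace M" for p
    using continuous_map_funspace[OF \<psi>(1)] that tZ by auto
  have \<psi>Q: "\<psi> p \<in> topspace Q" if "p \<in> topspace M" for p using \<psi>N[OF that] NQ by blast
  have \<psi>e: "\<psi> (\<mu> g p) = \<gamma> g (\<psi> p)" if "g \<in> carrier G" "p \<in> topspace M" for g p
    using \<psi>(2) \<psi>N that by (simp add: equivariant_def \<zeta>_def)
  have cont\<psi>: "continuous_map M Q \<psi>"
    using \<psi>(1) unfolding Z_def continuous_map_in_subtopology by simp
  \<comment> \<open>The projection from \<open>N\<close> to \<open>M\<close> is not inverted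
    directly. Universality maps \<open>M\<close> into \<open>N\<close>, and following this map by
    the projection gives an endomorphism of \<open>M\<close>, which coalescence makes
    invertible.\<close>
  define \<kappa> where "\<kappa> = (\<lambda>p. snd (\<psi> p))"
  have \<kappa>c: "continuous_map M M \<kappa>"
    unfolding \<kappa>_def using continuous_map_compose[OF cont\<psi>[unfolded Q_def] continuous_map_snd] by (simp add: o_def)
  have \<kappa>M: "\<kappa> p \<in> topspace M" if "p \<in> topspace M" for p
    using continuous_map_funspace[OF \<kappa>c] that by auto
  have \<kappa>e: "\<kappa> (\<mu> g p) = \<mu> g (\<kappa> p)" if "g \<in> carrier G" "p \<in> topspace M" for g p
    using \<psi>e[OF that] \<psi>Q[OF that(2)] by (simp add: \<kappa>_def \<gamma>_def)
  have \<kappa>inj: "inj_on \<kappa> (topspace M)"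
    by (rule coalescent[OF \<kappa>c]) (simp add: equivariant_def \<kappa>e)
  have "\<kappa> ` topspace M = topspace M"
  proof (rule closed_invariant_minimal[OF minimal])
    show "closedin M (\<kappa> ` topspace M)"
      using image_compactin[OF _ \<kappa>c] compactin_imp_closedin[OF Hausdorff] compact
      unfolding compact_space_def by blast
    show "invariant (\<kappa> ` topspace M)"
      unfolding invariant_def using \<kappa>e by (metis (no_types, lifting) act_closed image_iff)
  qed (use nonempty in auto)
  with \<kappa>inj have "homeomorphic_map M M \<kappa>"
    using continuous_imp_homeomorphic_map[OF \<kappa>c compact Hausdorff] by blast
  then obtain \<rho> where \<rho>: "homeomorphic_maps M M \<kappa> \<rho>" by (auto simp: homeomorphic_map_maps)
  then have \<rho>c: "continuous_map M M \<rho>" and \<rho>\<kappa>: "\<And>p. p \<in> topspace M \<Longrightarrow> \<rho> (\<kappa> p) = p"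
    and \<kappa>\<rho>: "\<And>p. p \<in> topspace M \<Longrightarrow> \<kappa> (\<rho> p) = p"
    by (auto simp: homeomorphic_maps_def)
  have \<rho>M: "\<rho> p \<in> topspace M" if "p \<in> topspace M" for p
    using continuous_map_funspace[OF \<rho>c] that by auto
  have \<rho>e: "\<rho> (\<mu> g p) = \<mu> g (\<rho> p)" if "g \<in> carrier G" "p \<in> topspace M" for g p
    using \<kappa>e[OF that(1) \<rho>M[OF that(2)]] \<rho>\<kappa>[of "\<mu> g (\<rho> p)"] \<kappa>\<rho>[OF that(2)] that \<rho>M by simp
  \<comment> \<open>After correction by the inverse of \<kappa> the second coordinate becomes the
    identity, and \<sigma> is the first coordinate.\<close>
  define \<sigma> where "\<sigma> p = fst (\<psi> (\<rho> p))" for p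
  have pair: "\<psi> (\<rho> p) = (\<sigma> p, p)" if "p \<in> topspace M" for p
    using \<kappa>\<rho>[OF that] by (simp add: \<sigma>_def \<kappa>_def prod_eq_iff)
  have \<sigma>A: "\<sigma> p \<in> topspace ambit" if "p \<in> topspace M" for p
    using \<psi>Q[OF \<rho>M[OF that]] pair[OF that] by (simp add: tQ)
  have \<sigma>_cont: "continuous_map M euclideanreal (\<lambda>p. \<sigma> p f)" if f: "f \<in> ruc" for f
  proof -
    have "continuous_map M (prod_topology ambit M) (\<psi> \<circ> \<rho>)"
      using continuous_map_compose[OF \<rho>c cont\<psi>] unfolding Q_def .
    then have "continuous_map M ambit (fst \<circ> (\<psi> \<circ> \<rho>))"
      using continuous_map_fst by (rule continuous_map_compose)
    moreover have "fst \<circ> (\<psi> \<circ> \<rho>) = \<sigma>" by (simp add: fun_eq_iff \<sigma>_def)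
    ultimately have "continuous_map M ambit \<sigma>" by simp
    from continuous_map_compose[OF this continuous_ambit_coordinate[OF f]]
    show ?thesis unfolding o_def .
  qed
  have \<sigma>_equivariant: "\<sigma> (\<mu> g p) f = \<sigma> p (translate g f)"
    if f: "f \<in> ruc" and g: "g \<in> carrier G" and p: "p \<in> topspace M" for f g p
  proof -
    have "\<sigma> (\<mu> g p) = ambit_action g (\<sigma> p)"
    proof -
      have "\<psi> (\<rho> (\<mu> g p)) = \<gamma> g (\<sigma> p, p)"
        using \<psi>e[OF g \<rho>M[OF p]] \<rho>e[OF g p] pair[OF p] by simp
      moreover have "(\<sigma> p, p) \<in> topspace Q" using \<psi>Q[OF \<rho>M[OF p]] pair[OF p] by simp
      ultimately show ?thesis unfolding \<sigma>_def[of "\<mu> g p"] by (simp add: \<gamma>_def)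
    qed
    then show ?thesis using ambit_action_apply[OF \<sigma>A[OF p] f] by simp
  qed
  \<comment> \<open>The graph of \<sigma> lies in the closure of the pairs (evaluation at
    \<open>g\<close>, \<open>\<mu> g x0\<close>). Hence a single \<open>g\<close> controls both the
    position in \<open>M\<close> and finitely many function values.\<close>
  have \<sigma>_approx: "\<exists>g\<in>carrier G. \<mu> g x0 \<in> V \<and> (\<forall>f\<in>F. \<bar>f g - \<sigma> p f\<bar> < e)"
    if V: "openin M V" "p \<in> V" and F: "finite F" "F \<subseteq> ruc" and e: "e > 0" for p V F and e :: real
  proof -
    have p: "p \<in> topspace M" using V openin_subset by blast
    define B where "B = topspace ambit \<inter> (\<Inter>f\<in>F. {q \<in> topspace ambit. \<bar>q f - \<sigma> p f\<bar> \<in> {..<e}})"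
    have B: "openin ambit B"
    proof (cases "F = {}")
      case False
      then show ?thesis unfolding B_def
        by (intro openin_Int openin_INT2 openin_continuous_map_preimage[where Y = euclideanreal])
          (use F in \<open>auto intro!: continuous_map_real_abs continuous_map_diff continuous_ambit_coordinate simp flip: open_openin\<close>)
    qed (simp add: B_def)
    have "(\<sigma> p, p) \<in> Q closure_of orbit G \<gamma> ?b"
      using pair[OF p] \<psi>N[OF \<rho>M[OF p]] NY by (auto simp: Y_def)
    moreover have "openin Q (B \<times> V)" unfolding Q_def using B V by (simp add: openin_prod_Times_iff)
    moreover have "(\<sigma> p, p) \<in> B \<times> V" using \<sigma>A[OF p] V e by (auto simp: B_def)
    ultimately obtain q where "q \<in> orbit G \<gamma> ?b" "q \<in> B \<times> V"
      by (rule in_closure_ofE)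
    then obtain g where g: "g \<in> carrier G" "(evaluation g, \<mu> g x0) \<in> B \<times> V"
      using \<gamma>b by (auto simp: orbit_def)
    have "\<bar>f g - \<sigma> p f\<bar> < e" if "f \<in> F" for f
    proof -
      have "\<bar>evaluation g f - \<sigma> p f\<bar> < e" using g(2) that by (auto simp: B_def)
      moreover have "f \<in> ruc" using F that by blast
      ultimately show ?thesis by (simp add: evaluation_def)
    qed
    then show ?thesis using g by auto
  qed
  show thesis
    by (rule that[of \<sigma>]) (fact \<sigma>_cont \<sigma>_equivariant \<sigma>_approx)+
qed

text \<open>
  A uniformly continuous function on \<open>G\<close> separating the return sets \<open>{g. \<mu> g x \<in> V}\<close> and
  \<open>{g. \<mu> g x \<in> V'}\<close> descends to \<open>M\<close> along the section.
\<close>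
lemma separate_by_function:
  assumes U: "nbhd_one U" and V: "openin M V" "openin M V'" and disj: "translates U V \<inter> V' = {}"
  obtains F where "continuous_map M euclideanreal F" "\<And>p. p \<in> V \<Longrightarrow> F p = 0" "\<And>p. p \<in> V' \<Longrightarrow> F p = 1"
proof -
  obtain x where x: "x \<in> topspace M" using nonempty by blast
  obtain \<sigma> where \<sigma>: "\<And>f. f \<in> ruc \<Longrightarrow> continuous_map M euclideanreal (\<lambda>p. \<sigma> p f)"
    "\<And>p V F e. openin M V \<Longrightarrow> p \<in> V \<Longrightarrow> finite F \<Longrightarrow> F \<subseteq> ruc \<Longrightarrow> e > 0 \<Longrightarrow>
      \<exists>g\<in>carrier G. \<mu> g x \<in> V \<and> (\<forall>f\<in>F. \<bar>f g - \<sigma> p f\<bar> < e)"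
    by (rule ambit_section[OF x]) (rule that)
  define A B where "A = {g \<in> carrier G. \<mu> g x \<in> V}" and "B = {g \<in> carrier G. \<mu> g x \<in> V'}"
  obtain f where f: "f \<in> ruc" "\<And>a. a \<in> A \<Longrightarrow> f a = 0" "\<And>b. b \<in> B \<Longrightarrow> f b = 1"
  proof (rule ruc_separation[OF U, of A B])
    show "u \<otimes> a \<notin> B" if "u \<in> U" "a \<in> A" for u a
      using that disj x nbhd_one_subset[OF U, of u] translatesI[of u U "\<mu> a x" V] act_mult[of u a x]
      by (auto simp: A_def B_def)
    show "A \<subseteq> carrier G" "B \<subseteq> carrier G" by (auto simp: A_def B_def)
  qed (rule that)
  show thesis
  proof (rule that[OF \<sigma>(1)[OF f(1)]])
    fix p
    show "\<sigma> p f = 0" if p: "p \<in> V"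
    proof (rule ccontr)
      \<comment> \<open>The tolerance is the supposed distance from 0: an element of
        \<open>A\<close> would approximate the value more closely than that, yet \<open>f\<close>
        vanishes on \<open>A\<close>.\<close>
      assume "\<sigma> p f \<noteq> 0"
      then obtain g where "g \<in> A" "\<bar>f g - \<sigma> p f\<bar> < \<bar>\<sigma> p f\<bar>"
        using \<sigma>(2)[OF V(1) p, of "{f}" "\<bar>\<sigma> p f\<bar>"] f(1) by (auto simp: A_def)
      then show False using f(2) by auto
    qed
    show "\<sigma> p f = 1" if p: "p \<in> V'"
    proof (rule ccontr)
      assume "\<sigma> p f \<noteq> 1"
      then obtain g where "g \<in> B" "\<bar>f g - \<sigma> p f\<bar> < \<bar>1 - \<sigma> p f\<bar>"
        using \<sigma>(2)[OF V(2) p, of "{f}" "\<bar>1 - \<sigma> p f\<bar>"] f(1) by (auto simp: B_def)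
      then show False using f(3) by auto
    qed
  qed
qed

end

section \<open>Recurrence in metrizable universal minimal flows\<close>

lemma (in Metric_space) openin_mtopology_iff:
  "openin mtopology W \<longleftrightarrow> W \<subseteq> M \<and> (\<forall>x\<in>W. \<exists>r>0. \<forall>y\<in>M. d x y < r \<longrightarrow> y \<in> W)"
proof (cases "W \<subseteq> M")
  case True
  have "mball x r \<subseteq> W \<longleftrightarrow> (\<forall>y\<in>M. d x y < r \<longrightarrow> y \<in> W)" if "x \<in> W" for x r
    using that True unfolding mball_def by blast
  then show ?thesis using True by (simp add: openin_mtopology Ball_def)
qed (simp add: openin_mtopology)

locale polish_universal_minimal = universal_minimal G T M \<mu>
  for G :: "('a, 'b) monoid_scheme" (structure) and T and M :: "'m topology" and \<mu> +
  fixes d :: "'m \<Rightarrow> 'm \<Rightarrow> real" and \<rho> :: "'a \<Rightarrow> 'a \<Rightarrow> real"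
  assumes metric_M: "Metric_space (topspace M) d" and metric_topology_M: "Metric_space.mtopology (topspace M) d = M"
    and metric_G: "Metric_space (carrier G) \<rho>" and metric_topology_G: "Metric_space.mtopology (carrier G) \<rho> = T"
    and complete_G: "Metric_space.mcomplete (carrier G) \<rho>"
begin

interpretation M: Metric_space "topspace M" d by (rule metric_M)
interpretation G: Metric_space "carrier G" \<rho> by (rule metric_G)

lemma openin_M_iff:
  "openin M W \<longleftrightarrow> W \<subseteq> topspace M \<and> (\<forall>x\<in>W. \<exists>r>0. \<forall>y\<in>topspace M. d x y < r \<longrightarrow> y \<in> W)"
  using M.openin_mtopology_iff[of W] unfolding metric_topology_M .

lemma openin_T_iff:
  "openin T W \<longleftrightarrow> W \<subseteq> carrier G \<and> (\<forall>x\<in>W. \<exists>r>0. \<forall>y\<in>carrier G. \<rho> x y < r \<longrightarrow> y \<in> W)"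
  using G.openin_mtopology_iff[of W] unfolding metric_topology_G .

lemma openin_M_ball: "x \<in> topspace M \<Longrightarrow> openin M {y \<in> topspace M. d x y < r}"
  using M.openin_mball[of x r] unfolding metric_topology_M by (simp add: M.mball_def)

lemma openin_T_ball: "x \<in> carrier G \<Longrightarrow> openin T {y \<in> carrier G. \<rho> x y < r}"
  using G.openin_mball[of x r] unfolding metric_topology_G by (simp add: G.mball_def)

lemma openin_M_E:
  assumes "openin M W" "x \<in> W"
  obtains r where "r > 0" "\<And>y. y \<in> topspace M \<Longrightarrow> d x y < r \<Longrightarrow> y \<in> W"
  using assms unfolding openin_M_iff by blast

lemma openin_T_E:
  assumes "openin T W" "x \<in> W"
  obtains r where "r > 0" "\<And>y. y \<in> carrier G \<Longrightarrow> \<rho> x y < r \<Longrightarrow> y \<in> W"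
  using assms unfolding openin_T_iff by blast

lemma continuous_real_E:
  assumes "continuous_map M euclideanreal F" "x \<in> topspace M" "e > 0"
  obtains W where "openin M W" "x \<in> W" "\<And>y. y \<in> W \<Longrightarrow> \<bar>F y - F x\<bar> < e"
  using assms(1)[unfolded continuous_map_euclideanreal_iff, rule_format, OF assms(2,3)] that by metis

lemma finite_balls:
  assumes "e > 0"
  obtains K where "finite K" "K \<subseteq> topspace M" "\<And>x. x \<in> topspace M \<Longrightarrow> \<exists>y\<in>K. d y x < e"
proof -
  have "compactin M.mtopology (topspace M)"
    unfolding metric_topology_M using compact unfolding compact_space_def .
  then have tb: "M.mtotally_bounded (topspace M)" by (rule M.compactin_imp_mtotally_bounded)
  obtain K where K: "finite K" "K \<subseteq> topspace M" "topspace M \<subseteq> (\<Union>x\<in>K. M.mball x e)"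
    using tb[unfolded M.mtotally_bounded_def, rule_format, OF assms] by (elim exE conjE)
  show thesis
  proof (rule that[OF K(1,2)])
    show "\<exists>y\<in>K. d y x < e" if x: "x \<in> topspace M" for x
    proof -
      obtain y where "y \<in> K" "x \<in> M.mball y e" using K(3) x by blast
      then show ?thesis unfolding M.in_mball by blast
    qed
  qed
qed

text \<open>
  Otherwise there are \<open>q\<^sub>n\<close> converging to \<open>p\<close> with pairwise \<open>U\<close>-separated neighbourhoods \<open>V\<^sub>n\<close>, and a
  continuous function that is \<open>0\<close> on the even ones and \<open>1\<close> on the odd ones.
\<close>
lemma local_recurrence:
  assumes U: "nbhd_one U" and p: "p \<in> topspace M"
  obtains r where "r > 0" "\<And>q V O'. q \<in> topspace M \<Longrightarrow> d p q < r \<Longrightarrow> openin M V \<Longrightarrow> q \<in> V \<Longrightarrow>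
    openin M O' \<Longrightarrow> p \<in> O' \<Longrightarrow> translates U V \<inter> O' \<noteq> {}"
proof (rule ccontr)
  assume "\<not> thesis"
  note result = that
  have bad: "\<exists>q V O'. q \<in> topspace M \<and> d p q < r \<and> openin M V \<and> q \<in> V \<and>
      openin M O' \<and> p \<in> O' \<and> translates U V \<inter> O' = {}" if "r > 0" for r
  proof (rule ccontr)
    assume "\<not> ?thesis"
    then show False using \<open>\<not> thesis\<close> result[OF that] by blast
  qed
  obtain U' where U': "nbhd_one U'" "\<And>v. v \<in> U' \<Longrightarrow> inv v \<in> U'" "U' \<subseteq> U"
    using nbhd_one_cube_root[OF U] by metis
  \<comment> \<open>A stage is a point near \<open>p\<close>, a neighbourhood \<open>V\<close> of
    it, and a neighbourhood \<open>O'\<close> of \<open>p\<close> that misses \<open>UV\<close>.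
    Everything later is chosen inside \<open>O'\<close>, so one condition separates \<open>V\<close>
    from all later neighbourhoods at once.\<close>
  define P where "P n = (\<lambda>(q, V, O'). q \<in> topspace M \<and> d p q < 1 / Suc n \<and> openin M V \<and> q \<in> V \<and>
    openin M O' \<and> p \<in> O' \<and> translates U V \<inter> O' = {})" for n :: nat
  have "\<exists>s. \<forall>n. P n (s n) \<and>
      fst (snd (s (Suc n))) \<subseteq> snd (snd (s n)) \<and> snd (snd (s (Suc n))) \<subseteq> snd (snd (s n))"
  proof (rule dependent_nat_choice)
    show "\<exists>s. P 0 s" using bad[of 1] by (auto simp: P_def)
    fix s and n :: nat assume "P n s"
    then obtain q V O' where s: "s = (q, V, O')" "openin M O'" "p \<in> O'" unfolding P_def by (cases s) auto
    obtain r where r: "r > 0" "\<And>y. y \<in> topspace M \<Longrightarrow> d p y < r \<Longrightarrow> y \<in> O'"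
      using openin_M_E[OF s(2,3)] by blast
    obtain q' V' O'' where *: "q' \<in> topspace M" "d p q' < min r (1 / Suc (Suc n))" "openin M V'" "q' \<in> V'"
      "openin M O''" "p \<in> O''" "translates U V' \<inter> O'' = {}"
      using bad[of "min r (1 / Suc (Suc n))"] r(1) by auto
    have "q' \<in> O'" using r(2) * by simp
    then have "P (Suc n) (q', V' \<inter> O', O'' \<inter> O')"
      using * s(2,3) by (auto simp: P_def translates_def)
    then show "\<exists>s'. P (Suc n) s' \<and> fst (snd s') \<subseteq> snd (snd s) \<and> snd (snd s') \<subseteq> snd (snd s)"
      unfolding s(1) by (intro exI[of _ "(q', V' \<inter> O', O'' \<inter> O')"]) auto
  qed
  then obtain s where "\<forall>n. P n (s n) \<and>
      fst (snd (s (Suc n))) \<subseteq> snd (snd (s n)) \<and> snd (snd (s (Suc n))) \<subseteq> snd (snd (s n))"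
    by (rule exE)
  then have s: "P n (s n)" and s': "fst (snd (s (Suc n))) \<subseteq> snd (snd (s n))"
    "snd (snd (s (Suc n))) \<subseteq> snd (snd (s n))" for n
    by simp_all
  define q V O' where "q n = fst (s n)" and "V n = fst (snd (s n))" and "O' n = snd (snd (s n))" for n
  have seq: "q n \<in> topspace M" "d p (q n) < 1 / Suc n" "openin M (V n)" "q n \<in> V n"
    "translates U (V n) \<inter> O' n = {}" for n
    using s[of n] by (auto simp: P_def q_def V_def O'_def case_prod_unfold)
  have step: "V (Suc n) \<subseteq> O' n" "O' (Suc n) \<subseteq> O' n" for n
    using s'[of n] by (simp_all add: V_def O'_def)
  have O'mono: "O' m \<subseteq> O' n" if "n \<le> m" for n m
    using lift_Suc_antimono_le[of O', OF step(2) that] .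
  have VO: "V m \<subseteq> O' n" if nm: "n < m" for n m
  proof -
    obtain k where "m = Suc k" "n \<le> k" using nm by (cases m) auto
    then show ?thesis using step(1)[of k] O'mono[of n k] by auto
  qed
  have Vsub: "V n \<subseteq> topspace M" for n using seq(3) openin_subset by blast
  have sep1: "translates U' (V n) \<inter> V m = {}" if "n < m" for n m
    using seq(5)[of n] VO[OF that] U'(3) by (auto simp: translates_def)
  \<comment> \<open>The construction separates earlier from later; symmetry of \<open>U'\<close>
    gives the other order.\<close>
  have sep: "translates U' (V n) \<inter> V m = {}" if "n \<noteq> m" for n m
  proof (cases "n < m")
    case False
    then have "m < n" using that by simp
    show ?thesis
    proof (rule ccontr)
      assume "translates U' (V n) \<inter> V m \<noteq> {}"
      then obtain u y where u: "u \<in> U'" "y \<in> V n" "\<mu> u y \<in> V m" by (auto simp: translates_def)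
      then have "\<mu> (inv u) (\<mu> u y) = y" using nbhd_one_subset[OF U'(1)] Vsub by (simp add: subset_iff)
      then have "y \<in> translates U' (V m)" using translatesI[OF U'(2)[OF u(1)] u(3)] by simp
      then show False using sep1[OF \<open>m < n\<close>] u(2) by blast
    qed
  qed (rule sep1)
  define A B where "A = (\<Union>k. V (2 * k))" and "B = (\<Union>k. V (Suc (2 * k)))"
  have AB: "openin M A" "openin M B" using seq(3) by (auto simp: A_def B_def)
  have "translates U' A \<inter> B = {}"
  proof (rule ccontr)
    assume "translates U' A \<inter> B \<noteq> {}"
    then obtain k l where "translates U' (V (2 * k)) \<inter> V (Suc (2 * l)) \<noteq> {}"
      unfolding translates_def A_def B_def by blast
    moreover have "2 * k \<noteq> Suc (2 * l)" by presburger
    ultimately show False using sep by blast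
  qed
  then obtain F where F: "continuous_map M euclideanreal F" "\<And>p. p \<in> A \<Longrightarrow> F p = 0" "\<And>p. p \<in> B \<Longrightarrow> F p = 1"
    using separate_by_function[OF U'(1) AB] by blast
  obtain W where W: "openin M W" "p \<in> W" "\<And>y. y \<in> W \<Longrightarrow> \<bar>F y - F p\<bar> < 1 / 2"
    using continuous_real_E[OF F(1) p, of "1 / 2"] by auto
  obtain r where r: "r > 0" "\<And>y. y \<in> topspace M \<Longrightarrow> d p y < r \<Longrightarrow> y \<in> W"
    using openin_M_E[OF W(1,2)] by blast
  obtain n where n: "1 / real (Suc n) < r" using r(1) nat_approx_posE by blast
  have "q m \<in> W" if "n \<le> m" for m
  proof -
    have "1 / real (Suc m) \<le> 1 / real (Suc n)" using that by (simp add: frac_le)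
    then show ?thesis using seq(2)[of m] n by (intro r(2) seq(1)) linarith
  qed
  then have "q (2 * n) \<in> W" "q (Suc (2 * n)) \<in> W" by auto
  then have "\<bar>0 - F p\<bar> < 1 / 2" "\<bar>1 - F p\<bar> < 1 / 2"
    using W(3) F(2)[of "q (2 * n)"] F(3)[of "q (Suc (2 * n))"] seq(4) unfolding A_def B_def
    by (metis UNIV_I UN_I)+
  then show False by linarith
qed

text \<open>A second use of separation. If \<open>p\<close> and \<open>q\<close> are both near a
  centre \<open>x\<close>, local recurrence makes \<open>U'V\<close> and \<open>U'V'\<close> meet
  every neighbourhood of \<open>x\<close>; were \<open>UV\<close> to miss \<open>V'\<close>, a
  continuous function with values 0 and 1 on these two sets would oscillate at \<open>x\<close>.
  Finitely many centres then give one radius.\<close>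

lemma uniform_recurrence:
  assumes U: "nbhd_one U"
  obtains r where "r > 0" "\<And>p q V V'. p \<in> topspace M \<Longrightarrow> q \<in> topspace M \<Longrightarrow> d p q < r \<Longrightarrow>
    openin M V \<Longrightarrow> p \<in> V \<Longrightarrow> openin M V' \<Longrightarrow> q \<in> V' \<Longrightarrow> translates U V \<inter> V' \<noteq> {}"
proof -
  obtain U' where U': "nbhd_one U'" "\<And>v. v \<in> U' \<Longrightarrow> inv v \<in> U'"
    "\<And>u v w. u \<in> U' \<Longrightarrow> v \<in> U' \<Longrightarrow> w \<in> U' \<Longrightarrow> u \<otimes> v \<otimes> w \<in> U"
    using nbhd_one_cube_root[OF U] by metis
  have U'G: "u \<in> carrier G" if "u \<in> U'" for u using nbhd_one_subset[OF U'(1) that] .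
  have "\<exists>r. \<forall>x\<in>topspace M. r x > 0 \<and> (\<forall>q V O'. q \<in> topspace M \<longrightarrow> d x q < r x \<longrightarrow> openin M V \<longrightarrow> q \<in> V \<longrightarrow>
      openin M O' \<longrightarrow> x \<in> O' \<longrightarrow> translates U' V \<inter> O' \<noteq> {})"
    by (rule bchoice) (metis local_recurrence[OF U'(1)])
  then obtain r where r: "\<And>x. x \<in> topspace M \<Longrightarrow> r x > 0"
    and rec: "\<And>x q V O'. x \<in> topspace M \<Longrightarrow> q \<in> topspace M \<Longrightarrow> d x q < r x \<Longrightarrow> openin M V \<Longrightarrow> q \<in> V \<Longrightarrow>
      openin M O' \<Longrightarrow> x \<in> O' \<Longrightarrow> translates U' V \<inter> O' \<noteq> {}"
    by blast
  have loc: "translates U V \<inter> V' \<noteq> {}"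
    if x: "x \<in> topspace M" and p: "p \<in> topspace M" "d x p < r x" "openin M V" "p \<in> V"
      and q: "q \<in> topspace M" "d x q < r x" "openin M V'" "q \<in> V'" for x p q V V'
  proof
    assume disj: "translates U V \<inter> V' = {}"
    have sub: "V \<subseteq> topspace M" "V' \<subseteq> topspace M" using p q openin_subset by auto
    have "openin M (translates U' V)" "openin M (translates U' V')"
      using U'G p q by (auto intro: openin_translates)
    \<comment> \<open>A common point satisfies \<open>u v y = w z\<close>, so
      \<open>z = (inv w) u v y\<close>: three factors from \<open>U'\<close>, hence the cube
      root.\<close>
    moreover have "translates U' (translates U' V) \<inter> translates U' V' = {}"
    proof (rule ccontr)
      assume "translates U' (translates U' V) \<inter> translates U' V' \<noteq> {}"
      then obtain u v w y z where *: "u \<in> U'" "v \<in> U'" "w \<in> U'" "y \<in> V" "z \<in> V'" "\<mu> u (\<mu> v y) = \<mu> w z"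
        by (auto simp: translates_def)
      have yz: "y \<in> topspace M" "z \<in> topspace M" using * sub by auto
      have "z = \<mu> (inv w) (\<mu> u (\<mu> v y))" using * U'G yz by simp
      also have "\<dots> = \<mu> (inv w \<otimes> u \<otimes> v) y" using * U'G yz by (simp add: act_mult m_assoc)
      finally have "z \<in> translates U V" using * U'(2,3) by (auto intro: translatesI)
      then show False using disj * by blast
    qed
    ultimately obtain F where F: "continuous_map M euclideanreal F"
      "\<And>p. p \<in> translates U' V \<Longrightarrow> F p = 0" "\<And>p. p \<in> translates U' V' \<Longrightarrow> F p = 1"
      using separate_by_function[OF U'(1)] by metis
    obtain W where W: "openin M W" "x \<in> W" "\<And>y. y \<in> W \<Longrightarrow> \<bar>F y - F x\<bar> < 1 / 2"
      using continuous_real_E[OF F(1) x, of "1 / 2"] by auto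
    obtain a b where "a \<in> translates U' V \<inter> W" "b \<in> translates U' V' \<inter> W"
      using rec[OF x p W(1,2)] rec[OF x q W(1,2)] by blast
    then have "\<bar>0 - F x\<bar> < 1 / 2" "\<bar>1 - F x\<bar> < 1 / 2" using F(2,3) W(3) by (metis IntE)+
    then show False by linarith
  qed
  have "\<exists>\<F>. finite \<F> \<and> \<F> \<subseteq> (\<lambda>x. {y \<in> topspace M. d x y < r x / 2}) ` topspace M \<and> topspace M \<subseteq> \<Union>\<F>"
  proof -
    have "openin M B" if B: "B \<in> (\<lambda>x. {y \<in> topspace M. d x y < r x / 2}) ` topspace M" for B
    proof -
      obtain x where "x \<in> topspace M" "B = {y \<in> topspace M. d x y < r x / 2}" using B by (rule imageE)
      then show ?thesis by (simp only: openin_M_ball)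
    qed
    moreover have "topspace M \<subseteq> \<Union>((\<lambda>x. {y \<in> topspace M. d x y < r x / 2}) ` topspace M)"
      using r by fastforce
    ultimately show ?thesis
      by (intro compact[unfolded compact_space_alt, THEN spec, THEN mp] conjI ballI)
  qed
  then obtain \<F> where \<F>: "finite \<F>" "\<F> \<subseteq> (\<lambda>x. {y \<in> topspace M. d x y < r x / 2}) ` topspace M"
    "topspace M \<subseteq> \<Union>\<F>"
    by (elim exE conjE)
  obtain K where K: "K \<subseteq> topspace M" "finite K" "\<F> = (\<lambda>x. {y \<in> topspace M. d x y < r x / 2}) ` K"
    using finite_subset_image[OF \<F>(1,2)] by (elim exE conjE)
  \<comment> \<open>The cover used half radii, so moving by another half from \<open>p\<close> to
    \<open>q\<close> stays within the radius of the same centre.\<close>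
  define R where "R = Min (insert 1 ((\<lambda>x. r x / 2) ` K))"
  have R: "R > 0" using K(1,2) r by (auto simp: R_def subset_iff)
  show thesis
  proof (rule that[OF R])
    fix p q V V'
    assume *: "p \<in> topspace M" "q \<in> topspace M" "d p q < R" "openin M V" "p \<in> V" "openin M V'" "q \<in> V'"
    obtain x where x: "x \<in> K" "d x p < r x / 2" using \<F>(3) *(1) unfolding K(3) by blast
    have xM: "x \<in> topspace M" using x K by blast
    have "R \<le> r x / 2" unfolding R_def using x(1) K(2) by (intro Min_le) auto
    then have "d x q < r x" using M.triangle[OF xM *(1,2)] x *(3) by linarith
    moreover have "d x p < r x" using x r[OF xM] by linarith
    ultimately show "translates U V \<inter> V' \<noteq> {}" using loc[OF xM] * by blast
  qed
qed

section \<open>Generic points and Baire category\<close>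

definition generic :: "'m \<Rightarrow> bool" where
  "generic z \<longleftrightarrow> z \<in> topspace M \<and> (\<forall>U. nbhd_one U \<longrightarrow>
     (\<exists>W. openin M W \<and> z \<in> W \<and> W \<subseteq> M closure_of ((\<lambda>u. \<mu> u z) ` U)))"

definition returns :: "'a set \<Rightarrow> 'm set \<Rightarrow> 'm set" where
  "returns U V = {z \<in> topspace M. \<exists>u\<in>U. \<mu> u z \<in> V}"

lemma openin_returns:
  assumes "U \<subseteq> carrier G" "openin M V"
  shows "openin M (returns U V)"
proof -
  have "returns U V = (\<Union>u\<in>U. {z \<in> topspace M. \<mu> u z \<in> V})" by (auto simp: returns_def)
  moreover have "openin M {z \<in> topspace M. \<mu> u z \<in> V}" if "u \<in> U" for u
    using openin_act_preimage assms that by blast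
  ultimately show ?thesis by auto
qed

text \<open>\<open>g\<close> carries \<open>Vz\<close> to \<open>(g V inv g) (g z)\<close>, so
  density near \<open>z\<close> moves along with the point at the price of conjugating the
  neighbourhood of the identity. Effros' argument needs this because it restarts at points further
  along the orbit.\<close>

lemma generic_invariant:
  assumes z: "generic z" and g: "g \<in> carrier G"
  shows "generic (\<mu> g z)"
  unfolding generic_def
proof (intro conjI allI impI)
  have zM: "z \<in> topspace M" using z by (simp add: generic_def)
  then show "\<mu> g z \<in> topspace M" using g by simp
  fix U assume "nbhd_one U"
  then obtain V where V: "nbhd_one V" "\<And>v. v \<in> V \<Longrightarrow> g \<otimes> v \<otimes> inv g \<in> U"
    using nbhd_one_conjugate g by blast
  obtain W where W: "openin M W" "z \<in> W" "W \<subseteq> M closure_of ((\<lambda>u. \<mu> u z) ` V)"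
    using z V(1) unfolding generic_def by blast
  have "\<mu> g ` W \<subseteq> \<mu> g ` (M closure_of ((\<lambda>u. \<mu> u z) ` V))" using W(3) by blast
  also have "\<dots> \<subseteq> M closure_of (\<mu> g ` (\<lambda>u. \<mu> u z) ` V)"
    by (rule continuous_map_image_closure_subset[OF continuous_act[OF g]])
  also have "\<dots> \<subseteq> M closure_of ((\<lambda>u. \<mu> u (\<mu> g z)) ` U)"
  proof (rule closure_of_mono, rule subsetI)
    fix y assume "y \<in> \<mu> g ` (\<lambda>u. \<mu> u z) ` V"
    then obtain v where v: "v \<in> V" "y = \<mu> g (\<mu> v z)" by auto
    then have vG: "v \<in> carrier G" using nbhd_one_subset[OF V(1)] by blast
    then have "y = \<mu> (g \<otimes> v \<otimes> inv g) (\<mu> g z)" using v(2) zM g by (simp add: act_mult)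
    then show "y \<in> (\<lambda>u. \<mu> u (\<mu> g z)) ` U" using V(2)[OF v(1)] by blast
  qed
  finally show "\<exists>W. openin M W \<and> \<mu> g z \<in> W \<and> W \<subseteq> M closure_of ((\<lambda>u. \<mu> u (\<mu> g z)) ` U)"
    using openin_act_image[OF g W(1)] W(2) by blast
qed

text \<open>For a point \<open>q\<close> near \<open>z\<close>, recurrence only yields points
  arbitrarily near \<open>z\<close> that \<open>U n\<close> moves close to \<open>q\<close>. Baire
  category supplies a \<open>z\<close> for which \<open>z\<close> itself is such a point whenever it
  is a limit of them.\<close>

lemma generic_exists: "\<exists>z. generic z"
proof -
  define U where "U n = {y \<in> carrier G. \<rho> \<one> y < 1 / Suc n}" for n :: nat
  have U: "nbhd_one (U n)" for n using openin_T_ball by (simp add: nbhd_one_def U_def)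
  have UG: "U n \<subseteq> carrier G" for n by (auto simp: U_def)
  have "\<exists>K. \<forall>n :: nat. finite (K n) \<and> K n \<subseteq> topspace M \<and> (\<forall>x\<in>topspace M. \<exists>y\<in>K n. d y x < 1 / Suc n)"
    by (rule choice) (metis finite_balls of_nat_0_less_iff zero_less_Suc zero_less_divide_1_iff)
  then obtain K where K: "\<And>n :: nat. finite (K n)" "\<And>n. K n \<subseteq> topspace M"
    "\<And>n x. x \<in> topspace M \<Longrightarrow> \<exists>y\<in>K n. d y x < 1 / Suc n" by blast
  define B where "B n y = {x \<in> topspace M. d y x < 1 / Suc n}" for n :: nat and y
  \<comment> \<open>Adding the exterior makes the open set of returning points dense. For a point of
    its closure, membership in \<open>E\<close> means membership in the set itself.\<close>
  define E where "E n m y = returns (U n) (B m y) \<union> (topspace M - M closure_of (returns (U n) (B m y)))" for n m y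
  define \<G> where "\<G> = (\<Union>n. \<Union>m. E n m ` K m)"
  have BM: "openin M (B m y)" if "y \<in> K m" for m y
    using K(2) that openin_M_ball unfolding B_def by blast
  have "M closure_of \<Inter>\<G> = topspace M"
  proof (rule Baire_category)
    show "completely_metrizable_space M \<or> locally_compact_space M \<and> regular_space M"
      using compact Hausdorff compact_Hausdorff_or_regular_imp_normal_space
        compact_imp_locally_compact_space compact_Hausdorff_imp_regular_space by blast
    show "countable \<G>" unfolding \<G>_def
      by (intro countable_UN countable_image) (simp_all add: countable_finite K(1))
    fix S assume "S \<in> \<G>"
    then obtain n m y where y: "y \<in> K m" and S: "S = E n m y" by (auto simp: \<G>_def)
    let ?R = "returns (U n) (B m y)"
    have R: "openin M ?R" using openin_returns[OF UG BM[OF y]] .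
    show "openin M S \<and> M closure_of S = topspace M"
    proof
      show "openin M S" unfolding S E_def using R by (intro openin_Un openin_diff) simp_all
      have "topspace M \<subseteq> M closure_of ?R \<union> (topspace M - M closure_of ?R)" by blast
      also have "\<dots> \<subseteq> M closure_of ?R \<union> M closure_of (topspace M - M closure_of ?R)"
        using closure_of_subset[of "topspace M - M closure_of ?R" M] by blast
      also have "\<dots> = M closure_of S" by (simp add: S E_def closure_of_Un)
      finally show "M closure_of S = topspace M" by (intro subset_antisym closure_of_subset_topspace)
    qed
  qed
  then have "M closure_of (topspace M \<inter> \<Inter>\<G>) = topspace M"
    using closure_of_restrict[of M "\<Inter>\<G>"] by simp
  then have "topspace M \<inter> \<Inter>\<G> \<noteq> {}" using nonempty closure_of_empty[of M] by metis
  then obtain z where z: "z \<in> topspace M" "\<And>S. S \<in> \<G> \<Longrightarrow> z \<in> S" by blast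
  have "generic z"
    unfolding generic_def
  proof (intro conjI allI impI z(1))
    fix U' assume "nbhd_one U'"
    then obtain r where r: "r > 0" "\<And>y. y \<in> carrier G \<Longrightarrow> \<rho> \<one> y < r \<Longrightarrow> y \<in> U'"
      using openin_T_E[of U' \<one>] unfolding nbhd_one_def by blast
    obtain n where n: "1 / real (Suc n) < r" using r(1) nat_approx_posE by blast
    have UU': "U n \<subseteq> U'" using n r(2) by (auto simp: U_def)
    obtain s where s: "s > 0" "\<And>p q V V'. p \<in> topspace M \<Longrightarrow> q \<in> topspace M \<Longrightarrow> d p q < s \<Longrightarrow>
        openin M V \<Longrightarrow> p \<in> V \<Longrightarrow> openin M V' \<Longrightarrow> q \<in> V' \<Longrightarrow> translates (U n) V \<inter> V' \<noteq> {}"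
      by (rule uniform_recurrence[OF U[of n]]) (rule that)
    let ?W = "{y \<in> topspace M. d z y < s}"
    have "q \<in> M closure_of ((\<lambda>u. \<mu> u z) ` U')" if q: "q \<in> ?W" for q
      unfolding in_closure_of
    proof (intro conjI allI impI)
      show qM: "q \<in> topspace M" using q by simp
      fix O' assume O': "q \<in> O' \<and> openin M O'"
      then obtain t where t: "t > 0" "\<And>y. y \<in> topspace M \<Longrightarrow> d q y < t \<Longrightarrow> y \<in> O'"
        using openin_M_E by metis
      obtain m where m: "1 / real (Suc m) < t / 2" using t(1) nat_approx_posE[of "t / 2"] by auto
      obtain y where y: "y \<in> K m" "d y q < 1 / Suc m" using K(3)[OF qM] by blast
      have yM: "y \<in> topspace M" using y K(2) by blast
      have BO: "B m y \<subseteq> O'"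
      proof
        fix x assume "x \<in> B m y"
        then have x: "x \<in> topspace M" "d y x < 1 / Suc m" by (auto simp: B_def)
        have "d q x \<le> d q y + d y x" using M.triangle qM yM x(1) by blast
        then show "x \<in> O'" using x y m by (intro t(2)) (auto simp: M.commute[of q y])
      qed
      let ?R = "returns (U n) (B m y)"
      \<comment> \<open>Uniform recurrence with the pair \<open>z\<close>, \<open>q\<close>: every
        neighbourhood of \<open>z\<close> contains a point that \<open>U n\<close> moves into the
        small ball containing \<open>q\<close>.\<close>
      have "z \<in> M closure_of ?R"
        unfolding in_closure_of
      proof (intro conjI allI impI z(1))
        fix V assume V: "z \<in> V \<and> openin M V"
        have "q \<in> B m y" using y qM by (simp add: B_def)
        then obtain x where "x \<in> translates (U n) V \<inter> B m y"
          using s(2)[OF z(1) qM, of V "B m y"] q V BM[OF y(1)] by auto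
        then obtain u v where "u \<in> U n" "v \<in> V" "\<mu> u v \<in> B m y" by (auto simp: translates_def)
        then show "\<exists>y'. y' \<in> ?R \<and> y' \<in> V"
          using V openin_subset by (intro exI[of _ v]) (auto simp: returns_def)
      qed
      moreover have "z \<in> E n m y" using z(2) y(1) by (auto simp: \<G>_def)
      ultimately have "z \<in> ?R" by (simp add: E_def)
      then show "\<exists>y. y \<in> (\<lambda>u. \<mu> u z) ` U' \<and> y \<in> O'" using BO UU' by (auto simp: returns_def)
    qed
    moreover have "openin M ?W" "z \<in> ?W" using openin_M_ball z(1) s(1) by auto
    ultimately show "\<exists>W. openin M W \<and> z \<in> W \<and> W \<subseteq> M closure_of ((\<lambda>u. \<mu> u z) ` U')" by blast
  qed
  then show ?thesis by blast
qed

text \<open>Genericity alone gives a neighbourhood \<open>W\<close> depending on \<open>z\<close>;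
  recurrence has a radius that does not. From \<open>z\<close> one step in \<open>V\<close> comes
  near a point of \<open>W\<close>, and a second one leads from there to the vicinity of
  \<open>q\<close>.\<close>

lemma generic_uniform:
  assumes U: "nbhd_one U"
  obtains r where "r > 0" "\<And>z q. generic z \<Longrightarrow> q \<in> topspace M \<Longrightarrow> d z q < r \<Longrightarrow> q \<in> M closure_of ((\<lambda>u. \<mu> u z) ` U)"
proof -
  obtain V where V: "nbhd_one V" "\<And>v w. v \<in> V \<Longrightarrow> w \<in> V \<Longrightarrow> v \<otimes> w \<in> U"
    using nbhd_one_sqrt[OF U] by metis
  have VG: "V \<subseteq> carrier G" using nbhd_one_subset[OF V(1)] by blast
  obtain r where r: "r > 0" "\<And>p q V' O'. p \<in> topspace M \<Longrightarrow> q \<in> topspace M \<Longrightarrow> d p q < r \<Longrightarrow>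
        openin M V' \<Longrightarrow> p \<in> V' \<Longrightarrow> openin M O' \<Longrightarrow> q \<in> O' \<Longrightarrow> translates V V' \<inter> O' \<noteq> {}"
    by (rule uniform_recurrence[OF V(1)]) (rule that)
  show thesis
  proof (rule that[OF r(1)])
    fix z q assume z: "generic z" and q: "q \<in> topspace M" "d z q < r"
    have zM: "z \<in> topspace M" using z by (simp add: generic_def)
    obtain W where W: "openin M W" "z \<in> W" "W \<subseteq> M closure_of ((\<lambda>u. \<mu> u z) ` V)"
      using z V(1) unfolding generic_def by blast
    show "q \<in> M closure_of ((\<lambda>u. \<mu> u z) ` U)"
      unfolding in_closure_of
    proof (intro conjI allI impI q(1))
      fix O' assume O': "q \<in> O' \<and> openin M O'"
      then obtain w v where w: "w \<in> W" "v \<in> V" "\<mu> v w \<in> O'"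
        using r(2)[OF zM q W(1,2), of O'] by (auto simp: translates_def)
      have "w \<in> M closure_of ((\<lambda>u. \<mu> u z) ` V)" using w W(3) by blast
      moreover have "openin M (returns V O')" using openin_returns[OF VG] O' by blast
      moreover have "w \<in> returns V O'" using w W(1) openin_subset by (auto simp: returns_def)
      ultimately obtain v' where v': "v' \<in> V" "\<mu> v' z \<in> returns V O'" by (elim in_closure_ofE) auto
      then obtain v'' where v'': "v'' \<in> V" "\<mu> v'' (\<mu> v' z) \<in> O'" by (auto simp: returns_def)
      have "v'' \<in> carrier G" "v' \<in> carrier G" using VG v'(1) v''(1) by auto
      then have "\<mu> (v'' \<otimes> v') z \<in> O'" using act_mult[of v'' v' z] v''(2) zM by simp
      then show "\<exists>y. y \<in> (\<lambda>u. \<mu> u z) ` U \<and> y \<in> O'" using V(2)[OF v''(1) v'(1)] by blast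
    qed
  qed
qed

end

section \<open>Effros' theorem and stabilizers of generic points\<close>

lemma (in Metric_space) geometric_convergence:
  assumes "mcomplete" and a: "\<And>n. a n \<in> M" and step: "\<And>n. d (a n) (a (Suc n)) \<le> e / 2 ^ Suc n"
  obtains l where "limitin mtopology a l sequentially" "l \<in> M" "d (a 0) l \<le> e"
proof -
  have e0: "e \<ge> 0" using order_trans[OF nonneg step[of 0]] by simp
  \<comment> \<open>The remainder of the geometric series is kept exactly; with the bound
    \<open>e / 2 ^ n\<close> alone the induction would not close.\<close>
  have far: "d (a n) (a (n + k)) \<le> e / 2 ^ n - e / 2 ^ (n + k)" for n k
  proof (induction k)
    case 0
    then show ?case using a by simp
  next
    case (Suc k)
    have "d (a n) (a (n + Suc k)) \<le> d (a n) (a (n + k)) + d (a (n + k)) (a (n + Suc k))"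
      using triangle a by blast
    also have "\<dots> \<le> (e / 2 ^ n - e / 2 ^ (n + k)) + e / 2 ^ Suc (n + k)"
      using Suc step[of "n + k"] by simp
    also have "\<dots> = e / 2 ^ n - e / 2 ^ (n + Suc k)" by (simp add: field_simps)
    finally show ?case .
  qed
  have far': "d (a n) (a m) \<le> e / 2 ^ n" if nm: "n \<le> m" for n m
  proof -
    obtain k where "m = n + k" using nm le_Suc_ex by blast
    moreover have "0 \<le> e / 2 ^ (n + k)" using e0 by simp
    ultimately show ?thesis using far[of n k] by simp
  qed
  have "MCauchy a"
    unfolding MCauchy_def
  proof (intro conjI allI impI)
    show "range a \<subseteq> M" using a by auto
    fix \<epsilon> :: real assume \<epsilon>: "\<epsilon> > 0"
    obtain N where N: "e / 2 ^ N < \<epsilon> / 2"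
    proof -
      \<comment> \<open>Dividing by \<open>e + 1\<close> covers the case
        \<open>e = 0\<close>.\<close>
      obtain N where "(1 / 2 :: real) ^ N < \<epsilon> / 2 / (e + 1)"
        using real_arch_pow_inv[of "\<epsilon> / 2 / (e + 1)" "1 / 2"] \<epsilon> e0 by auto
      then have "(e + 1) * (1 / 2) ^ N < \<epsilon> / 2" using e0 by (simp add: field_simps)
      moreover have "e * (1 / 2) ^ N \<le> (e + 1) * (1 / 2) ^ N" by (simp add: mult_right_mono)
      ultimately have "e * (1 / 2) ^ N < \<epsilon> / 2" by linarith
      then have "e / 2 ^ N < \<epsilon> / 2" by (simp add: power_divide)
      then show thesis by (rule that)
    qed
    have "d (a n) (a n') < \<epsilon>" if "N \<le> n" "N \<le> n'" for n n'
    proof -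
      have "d (a n) (a n') \<le> d (a N) (a n) + d (a N) (a n')"
        using triangle[of "a n" "a N" "a n'"] a commute[of "a n" "a N"] by simp
      then show ?thesis using far'[OF that(1)] far'[OF that(2)] N by linarith
    qed
    then show "\<exists>N. \<forall>n n'. N \<le> n \<longrightarrow> N \<le> n' \<longrightarrow> d (a n) (a n') < \<epsilon>" by blast
  qed
  then obtain l where l: "limitin mtopology a l sequentially" using assms(1) unfolding mcomplete_def by blast
  then have lM: "l \<in> M" using limitin_topspace by fastforce
  have "d (a 0) l \<le> e + \<epsilon>" if \<epsilon>: "\<epsilon> > 0" for \<epsilon>
  proof -
    have "eventually (\<lambda>n. a n \<in> mball l \<epsilon>) sequentially"
      by (rule limitinD[OF l openin_mball]) (use lM \<epsilon> in simp)
    then obtain n where n: "a n \<in> mball l \<epsilon>" using eventually_happens'[OF sequentially_bot] by blast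
    have "d (a 0) l \<le> d (a 0) (a n) + d (a n) l" using triangle a lM by blast
    then show ?thesis using far'[of 0 n] n commute[of l "a n"] by simp
  qed
  then have "d (a 0) l \<le> e" by (rule field_le_epsilon)
  then show thesis using that l lM by blast
qed

lemma (in topological_group) topological_group_subgroup:
  assumes H: "subgroup H G"
  shows "topological_group (G\<lparr>carrier := H\<rparr>) (subtopology T H)"
proof -
  interpret H: group "G\<lparr>carrier := H\<rparr>" using subgroup.subgroup_is_group[OF H group_axioms] .
  have HG: "H \<subseteq> carrier G" using subgroup.subset[OF H] .
  have tH: "topspace (subtopology T H) = H" using HG topspace_eq_carrier by auto
  show ?thesis
  proof
    show "topspace (subtopology T H) = carrier (G\<lparr>carrier := H\<rparr>)" using tH by simp
    have "continuous_map (prod_topology (subtopology T H) (subtopology T H)) T (\<lambda>(g, h). g \<otimes> h)"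
      using continuous_map_from_subtopology[OF continuous_mult, of "H \<times> H"] by (simp add: subtopology_Times)
    then show "continuous_map (prod_topology (subtopology T H) (subtopology T H)) (subtopology T H)
        (\<lambda>(g, h). g \<otimes>\<^bsub>G\<lparr>carrier := H\<rparr>\<^esub> h)"
      using tH subgroup.m_closed[OF H] by (auto simp: continuous_map_in_subtopology)
    have "continuous_map (subtopology T H) (subtopology T H) (\<lambda>g. inv g)"
      using continuous_map_from_subtopology[OF continuous_inv, of H] subgroup.m_inv_closed[OF H] tH
      by (auto simp: continuous_map_in_subtopology)
    then show "continuous_map (subtopology T H) (subtopology T H) (\<lambda>g. inv\<^bsub>G\<lparr>carrier := H\<rparr>\<^esub> g)"
      by (rule continuous_map_eq) (use m_inv_consistent[OF H] tH in auto)
  qed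
qed

context polish_universal_minimal
begin

interpretation M: Metric_space "topspace M" d by (rule metric_M)
interpretation G: Metric_space "carrier G" \<rho> by (rule metric_G)

text \<open>One step of the back-and-forth, with \<open>c' = u c\<close>. The radius depends on
  \<open>c\<close>, through a neighbourhood \<open>V\<close> for which \<open>Vc\<close> is
  \<rho>-close to \<open>c\<close>, but not on \<open>z\<close>, \<open>q\<close> or the precision
  \<eta>.\<close>

lemma generic_approach:
  assumes c: "c \<in> carrier G" and e: "e > 0"
  obtains r where "r > 0" "\<And>z q \<eta>. generic z \<Longrightarrow> q \<in> topspace M \<Longrightarrow> d (\<mu> c z) q < r \<Longrightarrow> \<eta> > 0 \<Longrightarrow>
    \<exists>c'\<in>carrier G. \<rho> c c' < e \<and> d (\<mu> c' z) q < \<eta>"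
proof -
  obtain V where V: "nbhd_one V" "\<And>v. v \<in> V \<Longrightarrow> v \<otimes> c \<in> {y \<in> carrier G. \<rho> c y < e}"
    using nbhd_one_right_translate[OF openin_T_ball[OF c, of e], of c] c e by auto
  obtain r where r: "r > 0" "\<And>z q. generic z \<Longrightarrow> q \<in> topspace M \<Longrightarrow> d z q < r \<Longrightarrow> q \<in> M closure_of ((\<lambda>u. \<mu> u z) ` V)"
    by (rule generic_uniform[OF V(1)]) (rule that)
  show thesis
  proof (rule that[OF r(1)])
    fix z q and \<eta> :: real assume *: "generic z" "q \<in> topspace M" "d (\<mu> c z) q < r" "\<eta> > 0"
    have zM: "z \<in> topspace M" using *(1) by (simp add: generic_def)
    have "q \<in> M closure_of ((\<lambda>u. \<mu> u (\<mu> c z)) ` V)"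
      using r(2)[OF generic_invariant[OF *(1) c]] * by blast
    moreover have "openin M {y \<in> topspace M. d q y < \<eta>}" using openin_M_ball[OF *(2)] .
    moreover have "q \<in> {y \<in> topspace M. d q y < \<eta>}" using *(2,4) by simp
    ultimately obtain y where "y \<in> (\<lambda>u. \<mu> u (\<mu> c z)) ` V" "y \<in> {y \<in> topspace M. d q y < \<eta>}"
      by (rule in_closure_ofE)
    then obtain u where u: "u \<in> V" "d q (\<mu> u (\<mu> c z)) < \<eta>" by auto
    have "u \<in> carrier G" using nbhd_one_subset[OF V(1) u(1)] .
    then have "u \<otimes> c \<in> carrier G" "\<rho> c (u \<otimes> c) < e" "d (\<mu> (u \<otimes> c) z) q < \<eta>"
      using V(2)[OF u(1)] u(2) act_mult[OF _ c zM, of u] M.commute by auto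
    then show "\<exists>c'\<in>carrier G. \<rho> c c' < e \<and> d (\<mu> c' z) q < \<eta>" by blast
  qed
qed

text \<open>
  Effros' theorem by a back-and-forth construction: \<open>a\<^sub>n z\<close> and \<open>b\<^sub>n w\<close> approach each other while
  the group elements \<open>a\<^sub>n\<close> and \<open>b\<^sub>n\<close> form Cauchy sequences.
\<close>
lemma generic_effros:
  assumes U: "nbhd_one U"
  obtains r where "r > 0" "\<And>z w. generic z \<Longrightarrow> generic w \<Longrightarrow> d z w < r \<Longrightarrow> \<exists>u\<in>U. w = \<mu> u z"
proof -
  obtain V where V: "nbhd_one V" "\<And>v. v \<in> V \<Longrightarrow> inv v \<in> V" "\<And>v w. v \<in> V \<Longrightarrow> w \<in> V \<Longrightarrow> v \<otimes> w \<in> U"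
    using nbhd_one_sqrt[OF U] by metis
  obtain s where s: "s > 0" "\<And>y. y \<in> carrier G \<Longrightarrow> \<rho> \<one> y < s \<Longrightarrow> y \<in> V"
    using openin_T_E[of V \<one>] V(1) unfolding nbhd_one_def by metis
  \<comment> \<open>The steps add up to \<open>s / 2\<close>, so both limits stay strictly inside
    the ball of radius \<open>s\<close> and thus in \<open>V\<close>.\<close>
  define e where "e n = s / 2 / 2 ^ Suc n" for n
  have e: "e n > 0" for n using s(1) by (simp add: e_def)
  define good where "good c n r \<longleftrightarrow> r > 0 \<and> (\<forall>z q \<eta>. generic z \<longrightarrow> q \<in> topspace M \<longrightarrow> d (\<mu> c z) q < r \<longrightarrow> \<eta> > 0 \<longrightarrow>
    (\<exists>c'\<in>carrier G. \<rho> c c' < e n \<and> d (\<mu> c' z) q < \<eta>))" for c n r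
  \<comment> \<open>How close a target must be for \<open>c\<close> to be adjusted towards it by
    less than \<open>e n\<close>. Fixing this number for all \<open>c\<close> in advance lets each
    side aim at the tolerance of the other.\<close>
  define D where "D c n = (SOME r. good c n r)" for c n
  have "good c n (D c n)" if c: "c \<in> carrier G" for c n
  proof -
    have "\<exists>r. good c n r"
      by (rule generic_approach[OF c e[of n]]) (unfold good_def, blast)
    then show ?thesis unfolding D_def by (rule someI_ex)
  qed
  then have D: "D c n > 0" and approach: "generic z \<Longrightarrow> q \<in> topspace M \<Longrightarrow> d (\<mu> c z) q < D c n \<Longrightarrow> \<eta> > 0 \<Longrightarrow>
      \<exists>c'\<in>carrier G. \<rho> c c' < e n \<and> d (\<mu> c' z) q < \<eta>"
    if "c \<in> carrier G" for c n z q \<eta>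
    using that unfolding good_def by blast+
  show thesis
  proof (rule that[OF D[OF one_closed, of 0]])
    fix z w assume z: "generic z" and w: "generic w" and zw: "d z w < D \<one> 0"
    have zM: "z \<in> topspace M" and wM: "w \<in> topspace M" using z w by (auto simp: generic_def)
    \<comment> \<open>The invariant bounds the distance by the tolerance of the first component, the
      next to move. The last clause pins the start at the identity, as the choice principle does not
      prescribe the initial value.\<close>
    define P where "P n = (\<lambda>c. fst c \<in> carrier G \<and> snd c \<in> carrier G \<and>
      d (\<mu> (fst c) z) (\<mu> (snd c) w) < D (fst c) n \<and> (n = 0 \<longrightarrow> c = (\<one>, \<one>)))" for n :: nat
    define Q where "Q n = (\<lambda>c c'. \<rho> (fst c) (fst c') < e n \<and> \<rho> (snd c) (snd c') < e n \<and>
      d (\<mu> (fst c') z) (\<mu> (snd c') w) < 1 / Suc n)" for n :: nat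
    have "\<exists>c. \<forall>n. P n (c n) \<and> Q n (c n) (c (Suc n))"
    proof (rule dependent_nat_choice)
      show "\<exists>c. P 0 c" using zw zM wM by (auto simp: P_def)
      fix c and n :: nat assume c: "P n c"
      have ab: "fst c \<in> carrier G" "snd c \<in> carrier G" "d (\<mu> (fst c) z) (\<mu> (snd c) w) < D (fst c) n"
        using c by (simp_all add: P_def)
      \<comment> \<open>First \<open>a\<close> moves to within the tolerance of \<open>b\<close>;
        then \<open>b\<close> moves to within that of the new \<open>a'\<close>, which restores the
        invariant, and within \<open>1 / Suc n\<close>, which makes the limits agree.\<close>
      obtain a' where a': "a' \<in> carrier G" "\<rho> (fst c) a' < e n" "d (\<mu> a' z) (\<mu> (snd c) w) < D (snd c) n"
        using approach[OF ab(1) z _ ab(3) D[OF ab(2), of n]] ab(2) wM by auto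
      have "d (\<mu> (snd c) w) (\<mu> a' z) < D (snd c) n" using a'(3) by (simp add: M.commute)
      moreover have "min (D a' (Suc n)) (1 / Suc n) > 0" using D[OF a'(1)] by simp
      ultimately obtain b' where b': "b' \<in> carrier G" "\<rho> (snd c) b' < e n"
        "d (\<mu> b' w) (\<mu> a' z) < min (D a' (Suc n)) (1 / Suc n)"
        using approach[OF ab(2) w, of "\<mu> a' z"] a'(1) zM by (meson act_closed)
      have "P (Suc n) (a', b') \<and> Q n c (a', b')"
        using a' b' by (simp add: P_def Q_def M.commute[of "\<mu> a' z"])
      then show "\<exists>c'. P (Suc n) c' \<and> Q n c c'" by blast
    qed
    then obtain c where c: "\<And>n. P n (c n)" "\<And>n. Q n (c n) (c (Suc n))" by blast
    define a b where "a n = fst (c n)" and "b n = snd (c n)" for n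
    have ab: "a n \<in> carrier G" "b n \<in> carrier G" for n using c(1)[of n] by (auto simp: P_def a_def b_def)
    have ab0: "a 0 = \<one>" "b 0 = \<one>" using c(1)[of 0] by (auto simp: P_def a_def b_def)
    have stepa: "\<rho> (a n) (a (Suc n)) \<le> s / 2 / 2 ^ Suc n" and stepb: "\<rho> (b n) (b (Suc n)) \<le> s / 2 / 2 ^ Suc n"
      and near: "d (\<mu> (a (Suc n)) z) (\<mu> (b (Suc n)) w) < 1 / Suc n" for n
      using c(2)[of n] by (simp_all add: Q_def a_def b_def e_def)
    obtain a' where a': "limitin T a a' sequentially" "a' \<in> carrier G" "\<rho> \<one> a' \<le> s / 2"
      using G.geometric_convergence[OF complete_G ab(1) stepa] unfolding metric_topology_G ab0 by metis
    obtain b' where b': "limitin T b b' sequentially" "b' \<in> carrier G" "\<rho> \<one> b' \<le> s / 2"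
      using G.geometric_convergence[OF complete_G ab(2) stepb] unfolding metric_topology_G ab0 by metis
    have "d (\<mu> a' z) (\<mu> b' w) \<le> 0 + \<epsilon>" if \<epsilon>: "\<epsilon> > 0" for \<epsilon>
    proof -
      have az: "\<mu> a' z \<in> topspace M" and bw: "\<mu> b' w \<in> topspace M" using a' b' zM wM by auto
      have "limitin M (\<lambda>n. \<mu> (a n) z) (\<mu> a' z) sequentially"
        using continuous_map_limit[OF continuous_orbit_map[OF zM] a'(1)] by (simp add: o_def)
      then have ev1: "eventually (\<lambda>n. \<mu> (a n) z \<in> {y \<in> topspace M. d (\<mu> a' z) y < \<epsilon> / 3}) sequentially"
        by (rule limitinD[OF _ openin_M_ball[OF az]]) (use az \<epsilon> in simp)
      have "limitin M (\<lambda>n. \<mu> (b n) w) (\<mu> b' w) sequentially"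
        using continuous_map_limit[OF continuous_orbit_map[OF wM] b'(1)] by (simp add: o_def)
      then have ev2: "eventually (\<lambda>n. \<mu> (b n) w \<in> {y \<in> topspace M. d (\<mu> b' w) y < \<epsilon> / 3}) sequentially"
        by (rule limitinD[OF _ openin_M_ball[OF bw]]) (use bw \<epsilon> in simp)
      obtain N where N: "\<And>n. n \<ge> N \<Longrightarrow> d (\<mu> a' z) (\<mu> (a n) z) < \<epsilon> / 3 \<and> d (\<mu> b' w) (\<mu> (b n) w) < \<epsilon> / 3"
        using eventually_conj[OF ev1 ev2] unfolding eventually_sequentially by auto
      obtain k where k: "1 / real (Suc k) < \<epsilon> / 3" using \<epsilon> nat_approx_posE[of "\<epsilon> / 3"] by auto
      define n where "n = Suc (max N k)"
      have nr: "d (\<mu> (a n) z) (\<mu> (b n) w) < \<epsilon> / 3"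
      proof -
        have "1 / real (Suc (max N k)) \<le> 1 / real (Suc k)" by (simp add: frac_le)
        then show ?thesis using near[of "max N k"] k unfolding n_def by linarith
      qed
      have pts: "\<mu> (a n) z \<in> topspace M" "\<mu> (b n) w \<in> topspace M" using ab zM wM by auto
      have "d (\<mu> a' z) (\<mu> b' w) \<le> d (\<mu> a' z) (\<mu> (a n) z) + d (\<mu> (a n) z) (\<mu> b' w)"
        using M.triangle az bw pts by blast
      moreover have "d (\<mu> (a n) z) (\<mu> b' w) \<le> d (\<mu> (a n) z) (\<mu> (b n) w) + d (\<mu> (b n) w) (\<mu> b' w)"
        using M.triangle bw pts by blast
      moreover have "n \<ge> N" by (simp add: n_def)
      ultimately show ?thesis using N[of n] nr M.commute[of "\<mu> (b n) w" "\<mu> b' w"] by linarith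
    qed
    then have "d (\<mu> a' z) (\<mu> b' w) \<le> 0" by (rule field_le_epsilon)
    then have eq: "\<mu> a' z = \<mu> b' w"
      using M.nonneg[of "\<mu> a' z" "\<mu> b' w"] M.zero[of "\<mu> a' z" "\<mu> b' w"] a' b' zM wM by simp
    have "w = \<mu> (inv b') (\<mu> a' z)" unfolding eq using b'(2) wM by simp
    then have "w = \<mu> (inv b' \<otimes> a') z" using a'(2) b'(2) zM by (simp add: act_mult)
    moreover have "a' \<in> V" "b' \<in> V" using s a' b' by auto
    ultimately show "\<exists>u\<in>U. w = \<mu> u z" using V(2,3) by blast
  qed
qed

text \<open>By equivariance \<open>\<sigma> x0\<close> takes the same value on a function and on its
  translates by \<open>H\<close>. Effros' theorem makes \<open>\<sigma> x0\<close> approximable by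
  elements of \<open>H\<close> itself, and wherever such an element sends \<open>b\<close>, one
  function \<open>f k\<close> and its translate by \<open>\<eta> k\<close> differ by 1
  there.\<close>

lemma stabilizer_fixed_point:
  fixes Y :: "'y topology"
  assumes x0: "generic x0" and H_def: "H = stabilizer G \<mu> x0"
    and Y: "flow (G\<lparr>carrier := H\<rparr>) (subtopology T H) Y \<beta>" "topspace Y \<noteq> {}"
  shows "\<exists>y\<in>topspace Y. \<forall>h\<in>H. \<beta> h y = y"
proof (rule ccontr)
  assume no_fixed: "\<not> ?thesis"
  have x0M: "x0 \<in> topspace M" using x0 by (simp add: generic_def)
  have H: "subgroup H G" unfolding H_def using stabilizer_subgroup[OF x0M] .
  have HG: "H \<subseteq> carrier G" using subgroup.subset[OF H] .
  interpret Y: G_flow "G\<lparr>carrier := H\<rparr>" "subtopology T H" Y \<beta>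
    using topological_group_subgroup[OF H] Y(1) by (simp add: G_flow_def G_flow_axioms_def)
  have Hmult: "\<beta> (g \<otimes> h) y = \<beta> g (\<beta> h y)" if "g \<in> H" "h \<in> H" "y \<in> topspace Y" for g h y
    using Y.act_mult[of g h y] that by simp
  obtain \<sigma> where \<sigma>_eq: "\<And>f g p. f \<in> ruc \<Longrightarrow> g \<in> carrier G \<Longrightarrow> p \<in> topspace M \<Longrightarrow> \<sigma> (\<mu> g p) f = \<sigma> p (translate g f)"
    and \<sigma>_approx: "\<And>p V F e. openin M V \<Longrightarrow> p \<in> V \<Longrightarrow> finite F \<Longrightarrow> F \<subseteq> ruc \<Longrightarrow> e > 0 \<Longrightarrow>
      \<exists>g\<in>carrier G. \<mu> g x0 \<in> V \<and> (\<forall>f\<in>F. \<bar>f g - \<sigma> p f\<bar> < e)"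
    by (rule ambit_section[OF x0M]) (rule that)
  \<comment> \<open>As \<open>h\<close> moves \<open>y\<close>, a small \<open>O'\<close> around
    \<open>y\<close> has \<open>V O'\<close> and \<open>h O'\<close> disjoint, by the Hausdorff
    property and continuity of the action.\<close>
  have "\<exists>h V O'. h \<in> H \<and> nbhd_one V \<and> openin Y O' \<and> y \<in> O' \<and>
      (\<forall>v\<in>V \<inter> H. \<forall>p\<in>O'. \<forall>q\<in>O'. \<beta> v p \<noteq> \<beta> h q)" if y: "y \<in> topspace Y" for y
  proof -
    obtain h where h: "h \<in> H" "\<beta> h y \<noteq> y" using no_fixed y by blast
    have hy: "\<beta> h y \<in> topspace Y" using Y.act_closed[of h y] h y by simp
    obtain P P' where P: "openin Y P" "openin Y P'" "y \<in> P" "\<beta> h y \<in> P'" "disjnt P P'"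
      using Y.Hausdorff h(2) y hy unfolding Hausdorff_space_def by metis
    obtain V O' where V: "Y.nbhd_one V" "openin Y O'" "y \<in> O'" "\<And>v p. v \<in> V \<Longrightarrow> p \<in> O' \<Longrightarrow> \<beta> v p \<in> P"
      using Y.act_nbhd[OF y P(1,3)] by metis
    obtain U where U: "openin T U" "V = U \<inter> H"
      using V(1) unfolding Y.nbhd_one_def openin_subtopology by auto
    have "nbhd_one U" using U V(1) by (simp add: nbhd_one_def Y.nbhd_one_def)
    moreover have "openin Y {p \<in> topspace Y. \<beta> h p \<in> P'}"
      using Y.openin_act_preimage[of h P'] h P(2) by simp
    then have "openin Y (O' \<inter> {p \<in> topspace Y. \<beta> h p \<in> P'})" using V(2) by (rule openin_Int[rotated])
    moreover have "\<beta> v p \<noteq> \<beta> h q" if "v \<in> U \<inter> H" "p \<in> O'" "\<beta> h q \<in> P'" for v p q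
      using V(4)[of v p] that U(2) P(5) unfolding disjnt_def by auto
    ultimately show ?thesis using h(1) V(3) y P(4)
      by (intro exI[of _ h] exI[of _ U] exI[of _ "O' \<inter> {p \<in> topspace Y. \<beta> h p \<in> P'}"]) auto
  qed
  then have "\<forall>y\<in>topspace Y. \<exists>t. fst t \<in> H \<and> nbhd_one (fst (snd t)) \<and> openin Y (snd (snd t)) \<and> y \<in> snd (snd t) \<and>
      (\<forall>v\<in>fst (snd t) \<inter> H. \<forall>p\<in>snd (snd t). \<forall>q\<in>snd (snd t). \<beta> v p \<noteq> \<beta> (fst t) q)"
    by (metis fst_conv snd_conv)
  then obtain t where t: "\<forall>y\<in>topspace Y. fst (t y) \<in> H \<and> nbhd_one (fst (snd (t y))) \<and>
      openin Y (snd (snd (t y))) \<and> y \<in> snd (snd (t y)) \<and>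
      (\<forall>v\<in>fst (snd (t y)) \<inter> H. \<forall>p\<in>snd (snd (t y)). \<forall>q\<in>snd (snd (t y)). \<beta> v p \<noteq> \<beta> (fst (t y)) q)"
    by (elim bchoice[THEN exE])
  define \<eta> V O' where "\<eta> y = fst (t y)" and "V y = fst (snd (t y))" and "O' y = snd (snd (t y))" for y
  have \<eta>: "\<eta> y \<in> H" and V: "nbhd_one (V y)" and O': "openin Y (O' y)" "y \<in> O' y"
    and sep: "\<And>v p q. v \<in> V y \<inter> H \<Longrightarrow> p \<in> O' y \<Longrightarrow> q \<in> O' y \<Longrightarrow> \<beta> v p \<noteq> \<beta> (\<eta> y) q"
    if "y \<in> topspace Y" for y
    using bspec[OF t that] unfolding \<eta>_def V_def O'_def by simp_all
  have "\<exists>\<F>. finite \<F> \<and> \<F> \<subseteq> O' ` topspace Y \<and> topspace Y \<subseteq> \<Union>\<F>"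
    by (intro Y.compact[unfolded compact_space_alt, THEN spec, THEN mp] conjI ballI) (use O' in auto)
  then obtain \<F> where \<F>: "finite \<F>" "\<F> \<subseteq> O' ` topspace Y" "topspace Y \<subseteq> \<Union>\<F>" by (elim exE conjE)
  obtain K where K: "K \<subseteq> topspace Y" "finite K" "\<F> = O' ` K"
    using finite_subset_image[OF \<F>(1,2)] by (elim exE conjE)
  obtain b where b: "b \<in> topspace Y" using Y(2) by blast
  define A where "A k = {h \<in> H. \<beta> h b \<in> O' k}" for k
  have "\<exists>f. f \<in> ruc \<and> (\<forall>a\<in>A k. f a = 0 \<and> f (\<eta> k \<otimes> a) = 1)" if k: "k \<in> K" for k
  proof -
    have kY: "k \<in> topspace Y" using k K by blast
    have AH: "A k \<subseteq> H" by (auto simp: A_def)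
    \<comment> \<open>The functions live on all of \<open>G\<close>, so separation is needed for
      \<open>u\<close> in \<open>G\<close>. It reduces to \<open>H\<close>, because
      \<open>u a = \<eta> k a'\<close> with the other factors in \<open>H\<close> forces
      \<open>u\<close> into \<open>H\<close>.\<close>
    have "u \<otimes> a \<notin> (\<lambda>a. \<eta> k \<otimes> a) ` A k" if u: "u \<in> V k" and a: "a \<in> A k" for u a
    proof
      assume "u \<otimes> a \<in> (\<lambda>a. \<eta> k \<otimes> a) ` A k"
      then obtain a' where a': "a' \<in> A k" "u \<otimes> a = \<eta> k \<otimes> a'" by auto
      have inH: "a \<in> H" "a' \<in> H" "\<eta> k \<in> H" using a a' AH \<eta>[OF kY] by auto
      have uG: "u \<in> carrier G" using nbhd_one_subset[OF V[OF kY] u] .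
      have "u = u \<otimes> a \<otimes> inv a" using uG inH HG by (simp add: m_assoc subset_iff)
      then have "u = \<eta> k \<otimes> a' \<otimes> inv a" unfolding a'(2) .
      then have uH: "u \<in> H" using inH subgroup.m_closed[OF H] subgroup.m_inv_closed[OF H] by simp
      have "\<beta> u (\<beta> a b) = \<beta> (\<eta> k) (\<beta> a' b)"
        using Hmult[OF uH inH(1) b] Hmult[OF inH(3,2) b] a'(2) by simp
      then show False using sep[OF kY, of u "\<beta> a b" "\<beta> a' b"] u uH a a'(1) by (simp add: A_def)
    qed
    note disj = this
    obtain f where "f \<in> ruc" "\<And>a. a \<in> A k \<Longrightarrow> f a = 0" "\<And>b. b \<in> (\<lambda>a. \<eta> k \<otimes> a) ` A k \<Longrightarrow> f b = 1"
    proof (rule ruc_separation[OF V[OF kY], of "A k" "(\<lambda>a. \<eta> k \<otimes> a) ` A k"])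
      show "A k \<subseteq> carrier G" using AH HG by simp
      then show "(\<lambda>a. \<eta> k \<otimes> a) ` A k \<subseteq> carrier G" using \<eta>[OF kY] HG by auto
    qed (rule disj, assumption, assumption, rule that)
    then show ?thesis by blast
  qed
  then have "\<forall>k\<in>K. \<exists>f. f \<in> ruc \<and> (\<forall>a\<in>A k. f a = 0 \<and> f (\<eta> k \<otimes> a) = 1)" by (rule ballI)
  then obtain f where f': "\<forall>k\<in>K. f k \<in> ruc \<and> (\<forall>a\<in>A k. f k a = 0 \<and> f k (\<eta> k \<otimes> a) = 1)"
    by (elim bchoice[THEN exE])
  then have f: "\<And>k. k \<in> K \<Longrightarrow> f k \<in> ruc" "\<And>k a. k \<in> K \<Longrightarrow> a \<in> A k \<Longrightarrow> f k a = 0"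
    "\<And>k a. k \<in> K \<Longrightarrow> a \<in> A k \<Longrightarrow> f k (\<eta> k \<otimes> a) = 1"
    by simp_all
  have \<eta>K: "\<eta> k \<in> H" "\<eta> k \<in> carrier G" if "k \<in> K" for k using \<eta> that K(1) HG by auto
  \<comment> \<open>The functions and their translates must be approximated by the same group
    element.\<close>
  define F where "F = f ` K \<union> (\<lambda>k. translate (\<eta> k) (f k)) ` K"
  have F: "finite F" "F \<subseteq> ruc" using K(2) f(1) \<eta>K translate_ruc by (auto simp: F_def)
  have "\<forall>f'\<in>F. \<exists>U. nbhd_one U \<and> (\<forall>u\<in>U. \<forall>x\<in>carrier G. \<bar>f' (u \<otimes> x) - f' x\<bar> < 1 / 8)"
  proof
    fix f' assume "f' \<in> F"
    then have "f' \<in> ruc" using F(2) by blast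
    then obtain U where "nbhd_one U" "\<And>u x. u \<in> U \<Longrightarrow> x \<in> carrier G \<Longrightarrow> \<bar>f' (u \<otimes> x) - f' x\<bar> < 1 / 8"
      by (rule ruc_uniform[where e = "1 / 8"]) simp_all
    then show "\<exists>U. nbhd_one U \<and> (\<forall>u\<in>U. \<forall>x\<in>carrier G. \<bar>f' (u \<otimes> x) - f' x\<bar> < 1 / 8)" by blast
  qed
  then obtain W where "\<forall>f'\<in>F. nbhd_one (W f') \<and> (\<forall>u\<in>W f'. \<forall>x\<in>carrier G. \<bar>f' (u \<otimes> x) - f' x\<bar> < 1 / 8)"
    by (elim bchoice[THEN exE])
  then have W: "\<And>f'. f' \<in> F \<Longrightarrow> nbhd_one (W f')"
    "\<And>f' u x. f' \<in> F \<Longrightarrow> u \<in> W f' \<Longrightarrow> x \<in> carrier G \<Longrightarrow> \<bar>f' (u \<otimes> x) - f' x\<bar> < 1 / 8"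
    by simp_all
  obtain U where U: "nbhd_one U" "\<And>f'. f' \<in> F \<Longrightarrow> U \<subseteq> W f'"
    using nbhd_one_INT[OF F(1), of W] W(1) by metis
  obtain r where r: "r > 0" "\<And>z w. generic z \<Longrightarrow> generic w \<Longrightarrow> d z w < r \<Longrightarrow> \<exists>u\<in>U. w = \<mu> u z"
    by (rule generic_effros[OF U(1)]) (rule that)
  \<comment> \<open>Besides approximating \<open>\<sigma> x0\<close> on \<open>F\<close>,
    \<open>g\<close> keeps \<open>\<mu> g x0\<close> within Effros range of \<open>x0\<close>. So
    \<open>\<mu> g x0 = \<mu> u x0\<close> with \<open>u\<close> small, and
    \<open>inv u \<otimes> g\<close> fixes \<open>x0\<close>.\<close>
  obtain g where g: "g \<in> carrier G" "\<mu> g x0 \<in> {y \<in> topspace M. d x0 y < r}"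
    "\<And>f'. f' \<in> F \<Longrightarrow> \<bar>f' g - \<sigma> x0 f'\<bar> < 1 / 8"
    using \<sigma>_approx[OF openin_M_ball[OF x0M, of r] _ F, of x0 "1 / 8"] x0M r(1) by auto
  obtain u where u: "u \<in> U" "\<mu> g x0 = \<mu> u x0"
    using r(2)[OF x0 generic_invariant[OF x0 g(1)]] g(2) by auto
  have uG: "u \<in> carrier G" using nbhd_one_subset[OF U(1) u(1)] .
  define h where "h = inv u \<otimes> g"
  have hG: "h \<in> carrier G" and guh: "g = u \<otimes> h" using uG g(1) by (simp_all add: h_def flip: m_assoc)
  have "\<mu> h x0 = x0" using u(2) uG g(1) x0M by (simp add: h_def act_mult)
  then have hH: "h \<in> H" using hG by (simp add: H_def stabilizer_def)
  \<comment> \<open>One eighth for the choice of \<open>g\<close>, one for passing from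
    \<open>g = u h\<close> to \<open>h\<close> by uniform continuity. Two errors of a quarter cannot
    bridge the gap between 0 and 1 below.\<close>
  have close: "\<bar>f' h - \<sigma> x0 f'\<bar> < 1 / 4" if f': "f' \<in> F" for f'
    using W(2)[OF f' subsetD[OF U(2)[OF f'] u(1)] hG] g(3)[OF f'] unfolding guh by linarith
  have "\<beta> h b \<in> topspace Y" using Y.act_closed[of h b] hH b by simp
  then obtain k where k: "k \<in> K" "\<beta> h b \<in> O' k" using \<F>(3) unfolding K(3) by blast
  then have hA: "h \<in> A k" using hH by (simp add: A_def)
  have "\<mu> (\<eta> k) x0 = x0" using \<eta>K(1)[OF k(1)] by (simp add: H_def stabilizer_def)
  then have "\<sigma> x0 (translate (\<eta> k) (f k)) = \<sigma> x0 (f k)"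
    using \<sigma>_eq[OF f(1)[OF k(1)] \<eta>K(2)[OF k(1)] x0M] by simp
  moreover have "\<bar>f k h - \<sigma> x0 (f k)\<bar> < 1 / 4" using close k(1) by (auto simp: F_def)
  moreover have "\<bar>translate (\<eta> k) (f k) h - \<sigma> x0 (translate (\<eta> k) (f k))\<bar> < 1 / 4"
    using close k(1) by (auto simp: F_def)
  moreover have "translate (\<eta> k) (f k) h = 1" using f(3)[OF k(1) hA] hG by (simp add: translate_def)
  ultimately show False using f(2)[OF k(1) hA] by linarith
qed

text \<open>A fixed point is a closed orbit, so a minimal flow containing one is a single point; the
  one-point flow is therefore universal.\<close>

lemma extremely_amenable_stabilizer:
  assumes x0: "generic x0"
  shows "extremely_amenable (G\<lparr>carrier := stabilizer G \<mu> x0\<rparr>) (subtopology T (stabilizer G \<mu> x0))"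
proof -
  define H where "H = stabilizer G \<mu> x0"
  have x0M: "x0 \<in> topspace M" using x0 by (simp add: generic_def)
  have H: "subgroup H G" unfolding H_def using stabilizer_subgroup[OF x0M] .
  interpret H: topological_group "G\<lparr>carrier := H\<rparr>" "subtopology T H"
    by (rule topological_group_subgroup[OF H])
  \<comment> \<open>An arbitrary value of the type on which \<open>extremely_amenable\<close> looks
    for its flow.\<close>
  define pt :: "'a set set" where "pt = {}"
  define P where "P = discrete_topology {pt}"
  define \<pi> :: "'a \<Rightarrow> 'a set set \<Rightarrow> 'a set set" where "\<pi> = (\<lambda>_. \<lambda>x\<in>{pt}. pt)"
  have "flow (G\<lparr>carrier := H\<rparr>) (subtopology T H) P \<pi>"
  proof (rule H.flowI)
    have "continuous_map (prod_topology (subtopology T H) P) P (\<lambda>_. pt)" by (simp add: P_def)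
    then show "continuous_map (prod_topology (subtopology T H) P) P (\<lambda>(g, x). \<pi> g x)"
      by (rule continuous_map_eq) (auto simp: P_def \<pi>_def)
  qed (auto simp: P_def \<pi>_def compact_space_discrete_topology Hausdorff_space_discrete_topology)
  moreover have "P closure_of orbit (G\<lparr>carrier := H\<rparr>) \<pi> pt = {pt}"
    using H.one_closed by (auto simp: P_def \<pi>_def orbit_def discrete_topology_closure_of)
  ultimately have P: "minimal_flow (G\<lparr>carrier := H\<rparr>) (subtopology T H) P \<pi>"
    by (simp add: minimal_flow_def P_def)
  have "\<exists>f. continuous_map P Y f \<and> f ` topspace P = topspace Y \<and> equivariant (G\<lparr>carrier := H\<rparr>) P \<pi> \<beta> f"
    if Y: "minimal_flow (G\<lparr>carrier := H\<rparr>) (subtopology T H) Y \<beta>" for Y :: "'a set set topology" and \<beta>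
  proof -
    have fl: "flow (G\<lparr>carrier := H\<rparr>) (subtopology T H) Y \<beta>" and ne: "topspace Y \<noteq> {}"
      using Y by (auto simp: minimal_flow_def)
    obtain y where y: "y \<in> topspace Y" "\<And>h. h \<in> H \<Longrightarrow> \<beta> h y = y"
      using stabilizer_fixed_point[OF x0 H_def fl ne] by blast
    have "orbit (G\<lparr>carrier := H\<rparr>) \<beta> y = {y}"
      using y(2) subgroup.one_closed[OF H] by (auto simp: orbit_def)
    then have "Y closure_of {y} = topspace Y" using Y y(1) unfolding minimal_flow_def by metis
    moreover have "closedin Y {y}"
      by (rule closedin_Hausdorff_singleton) (use fl y(1) in \<open>simp_all add: flow_def\<close>)
    then have "Y closure_of {y} = {y}" by (rule closure_of_closedin)
    ultimately have "topspace Y = {y}" by simp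
    then show ?thesis using y by (intro exI[of _ "\<lambda>_. y"]) (auto simp: P_def equivariant_def)
  qed
  with P have "universal_minimal_flow (G\<lparr>carrier := H\<rparr>) (subtopology T H) P \<pi>"
    unfolding universal_minimal_flow_def by blast
  then show ?thesis unfolding extremely_amenable_def H_def[symmetric]
    by (intro exI[of _ P] exI[of _ \<pi>]) (simp add: P_def)
qed

end

section \<open>The completion of the coset space\<close>

text \<open>Here the action on the target is prescribed and not built from the map, so that it
  applies to the concrete action on filters.\<close>

lemma (in G_flow) flow_transfer:
  assumes f: "homeomorphic_map X Y f"
    and ext: "\<And>g. g \<in> carrier G \<Longrightarrow> \<gamma> g \<in> extensional (topspace Y)"
    and eq: "\<And>g x. g \<in> carrier G \<Longrightarrow> x \<in> topspace X \<Longrightarrow> f (\<alpha> g x) = \<gamma> g (f x)"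
  shows "flow G T Y \<gamma>"
proof (rule flowI)
  obtain k where k: "homeomorphic_maps X Y f k" using f by (auto simp: homeomorphic_map_maps)
  have kc: "continuous_map Y X k" and fc: "continuous_map X Y f" and fk: "\<And>y. y \<in> topspace Y \<Longrightarrow> f (k y) = y"
    using k by (auto simp: homeomorphic_maps_def)
  have kX: "k y \<in> topspace X" if "y \<in> topspace Y" for y using continuous_map_funspace[OF kc] that by auto
  have fY: "f x \<in> topspace Y" if "x \<in> topspace X" for x using continuous_map_funspace[OF fc] that by auto
  have \<gamma>: "\<gamma> g y = f (\<alpha> g (k y))" if "g \<in> carrier G" "y \<in> topspace Y" for g y
    using eq[OF that(1) kX[OF that(2)]] fk[OF that(2)] by simp
  show "compact_space Y" "Hausdorff_space Y"
    using homeomorphic_map_imp_homeomorphic_space[OF f] compact Hausdorff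
      homeomorphic_compact_space homeomorphic_Hausdorff_space by blast+
  show \<gamma>Y: "\<gamma> g y \<in> topspace Y" if "g \<in> carrier G" "y \<in> topspace Y" for g y
    unfolding \<gamma>[OF that] using that kX by (intro fY) simp
  show "\<gamma> \<one> y = y" if "y \<in> topspace Y" for y
    using \<gamma>[OF one_closed that] kX[OF that] fk[OF that] by simp
  show "\<gamma> (g \<otimes> h) y = \<gamma> g (\<gamma> h y)" if g: "g \<in> carrier G" and h: "h \<in> carrier G" and y: "y \<in> topspace Y" for g h y
  proof -
    have "\<gamma> (g \<otimes> h) y = f (\<alpha> g (\<alpha> h (k y)))" using \<gamma>[of "g \<otimes> h" y] g h y kX[OF y] by (simp add: act_mult)
    also have "\<dots> = \<gamma> g (f (\<alpha> h (k y)))" using eq g h kX[OF y] by simp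
    finally show ?thesis using \<gamma>[OF h y] by simp
  qed
  have "continuous_map (prod_topology T Y) (prod_topology T X) (\<lambda>p. (fst p, k (snd p)))"
    using continuous_map_compose[OF continuous_map_snd kc]
    by (auto intro!: continuous_map_pairedI continuous_map_fst simp: o_def)
  from continuous_map_compose[OF continuous_map_compose[OF this continuous_action] fc]
  show "continuous_map (prod_topology T Y) Y (\<lambda>(g, y). \<gamma> g y)"
    by (rule continuous_map_eq) (auto simp: \<gamma> topspace_eq_carrier)
qed (rule ext)

text \<open>
  The minimal Cauchy filters of \<open>S\<close> are the traces on \<open>S\<close> of the neighbourhood filters of \<open>X\<close>, so the
  completion of \<open>S\<close> is \<open>X\<close>.
\<close>
locale dense_uniform_embedding = Metric_space X d for X :: "'x set" and d +
  fixes S :: "'s set" and Q :: "('s \<times> 's) filter" and j :: "'s \<Rightarrow> 'x"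
  assumes compact_X: "compact_space mtopology"
    and j: "\<And>s. s \<in> S \<Longrightarrow> j s \<in> X"
    and dense: "\<And>x r. x \<in> X \<Longrightarrow> r > 0 \<Longrightarrow> \<exists>s\<in>S. d x (j s) < r"
    and eventually_Q: "\<And>E. eventually E Q \<longleftrightarrow> (\<exists>r>0. \<forall>s\<in>S. \<forall>s'\<in>S. d (j s) (j s') < r \<longrightarrow> E (s, s'))"
begin

definition trace :: "'x \<Rightarrow> 's filter" where
  "trace x = (INF r\<in>{0<..}. principal {s \<in> S. d x (j s) < r})"

lemma eventually_trace: "eventually P (trace x) \<longleftrightarrow> (\<exists>r>0. \<forall>s\<in>S. d x (j s) < r \<longrightarrow> P s)"
proof -
  have "eventually P (trace x) \<longleftrightarrow> (\<exists>r\<in>{0<..}. eventually P (principal {s \<in> S. d x (j s) < r}))"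
    unfolding trace_def
  proof (rule eventually_INF_base)
    fix a b :: real assume "a \<in> {0<..}" "b \<in> {0<..}"
    then show "\<exists>r\<in>{0<..}. principal {s \<in> S. d x (j s) < r} \<le>
        inf (principal {s \<in> S. d x (j s) < a}) (principal {s \<in> S. d x (j s) < b})"
      by (intro bexI[of _ "min a b"]) auto
  qed auto
  then show ?thesis by (auto simp: eventually_principal)
qed

lemma trace_not_bot: "x \<in> X \<Longrightarrow> trace x \<noteq> bot"
  using dense unfolding trivial_limit_def eventually_trace by blast

lemma cauchy_trace:
  assumes x: "x \<in> X"
  shows "cauchy_filter_on S Q (trace x)"
  unfolding cauchy_filter_on_def
proof (intro conjI)
  show "trace x \<noteq> bot" using trace_not_bot[OF x] .
  show "trace x \<le> principal S" unfolding le_principal eventually_trace by (intro exI[of _ 1]) auto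
  show "trace x \<times>\<^sub>F trace x \<le> Q"
  proof (rule filter_leI)
    fix E assume "eventually E Q"
    then obtain r where r: "r > 0" "\<And>s s'. s \<in> S \<Longrightarrow> s' \<in> S \<Longrightarrow> d (j s) (j s') < r \<Longrightarrow> E (s, s')"
      unfolding eventually_Q by blast
    have ev: "eventually (\<lambda>s. s \<in> S \<and> d x (j s) < r / 2) (trace x)"
      unfolding eventually_trace using r(1) by (intro exI[of _ "r / 2"]) auto
    show "eventually E (trace x \<times>\<^sub>F trace x)"
    proof -
      have "E (s, s')" if "s \<in> S \<and> d x (j s) < r / 2" "s' \<in> S \<and> d x (j s') < r / 2" for s s'
        using that triangle[of "j s" x "j s'"] j x commute[of "j s" x] by (intro r(2)) auto
      then show ?thesis unfolding eventually_prod_filter using ev by blast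
    qed
  qed
qed

text \<open>The image of \<open>F\<close> clusters at some \<open>x\<close>, since otherwise
  finitely many balls avoided by \<open>F\<close> would cover \<open>X\<close>; and a Cauchy filter
  converges to each of its cluster points.\<close>

lemma cauchy_le_trace:
  assumes F: "cauchy_filter_on S Q F"
  obtains x where "x \<in> X" "F \<le> trace x"
proof -
  have F0: "F \<noteq> bot" and FS: "eventually (\<lambda>s. s \<in> S) F" and FQ: "F \<times>\<^sub>F F \<le> Q"
    using F by (auto simp: cauchy_filter_on_def le_principal)
  have "\<exists>x\<in>X. \<forall>r>0. frequently (\<lambda>s. d x (j s) < r) F"
  proof (rule ccontr)
    assume "\<not> ?thesis"
    then have "\<forall>x\<in>X. \<exists>r>0. eventually (\<lambda>s. \<not> d x (j s) < r) F"
      unfolding not_frequently[symmetric] by blast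
    then obtain r where r: "\<forall>x\<in>X. r x > 0 \<and> eventually (\<lambda>s. \<not> d x (j s) < r x) F"
      by (elim bchoice[THEN exE])
    have "\<exists>\<F>. finite \<F> \<and> \<F> \<subseteq> (\<lambda>x. mball x (r x)) ` X \<and> topspace mtopology \<subseteq> \<Union>\<F>"
      by (intro compact_X[unfolded compact_space_alt, THEN spec, THEN mp] conjI ballI) (use r in auto)
    then obtain \<F> where \<F>: "finite \<F>" "\<F> \<subseteq> (\<lambda>x. mball x (r x)) ` X" "topspace mtopology \<subseteq> \<Union>\<F>"
      by (elim exE conjE)
    obtain K where K: "K \<subseteq> X" "finite K" "\<F> = (\<lambda>x. mball x (r x)) ` K"
      using finite_subset_image[OF \<F>(1,2)] by (elim exE conjE)
    have "eventually (\<lambda>s. \<forall>x\<in>K. \<not> d x (j s) < r x) F"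
      using r K by (intro eventually_ball_finite) auto
    with FS have "eventually (\<lambda>_. False) F"
    proof eventually_elim
      case (elim s)
      have "j s \<in> \<Union>\<F>" using \<F>(3) j[OF elim(1)] by auto
      then show False using elim(2) unfolding K(3) by auto
    qed
    then show False using F0 by (simp add: trivial_limit_def)
  qed
  then obtain x where x: "x \<in> X" "\<And>r. r > 0 \<Longrightarrow> frequently (\<lambda>s. d x (j s) < r) F" by blast
  have "F \<le> trace x"
  proof (rule filter_leI)
    fix P assume "eventually P (trace x)"
    then obtain r where r: "r > 0" "\<And>s. s \<in> S \<Longrightarrow> d x (j s) < r \<Longrightarrow> P s" unfolding eventually_trace by blast
    have "eventually (\<lambda>(s, s'). d (j s) (j s') < r / 2) Q"
      unfolding eventually_Q using r(1) by (intro exI[of _ "r / 2"]) auto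
    then have "eventually (\<lambda>(s, s'). d (j s) (j s') < r / 2) (F \<times>\<^sub>F F)" using FQ by (rule filter_leD[rotated])
    then obtain A where A: "eventually A F" "\<And>s s'. A s \<Longrightarrow> A s' \<Longrightarrow> d (j s) (j s') < r / 2"
      unfolding eventually_prod_same by auto
    have "frequently (\<lambda>s. d x (j s) < r / 2) F" by (rule x(2)) (use r(1) in simp)
    from frequently_ex[OF frequently_eventually_conj[OF this eventually_conj[OF A(1) FS]]]
    obtain s where s: "d x (j s) < r / 2" "A s" "s \<in> S" by blast
    show "eventually P F"
      using A(1) FS
    proof eventually_elim
      case (elim s')
      have "d x (j s') \<le> d x (j s) + d (j s) (j s')" using triangle x(1) j s(3) elim(2) by blast
      then show "P s'" using s(1) A(2)[OF s(2) elim(1)] by (intro r(2) elim(2)) linarith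
    qed
  qed
  then show thesis using that x(1) by blast
qed

lemma trace_le_imp_eq:
  assumes x: "x \<in> X" and y: "y \<in> X" and le: "trace x \<le> trace y"
  shows "x = y"
proof -
  have "d x y \<le> 0 + r" if r: "r > 0" for r
  proof -
    have a: "eventually (\<lambda>s. s \<in> S \<and> d y (j s) < r / 2) (trace y)"
      and b: "eventually (\<lambda>s. d x (j s) < r / 2) (trace x)"
      unfolding eventually_trace using r by (auto intro: exI[of _ "r / 2"])
    obtain s where s: "s \<in> S" "d y (j s) < r / 2" "d x (j s) < r / 2"
      using eventually_happens'[OF trace_not_bot[OF x] eventually_conj[OF filter_leD[OF le a] b]] by blast
    then show ?thesis using triangle[of x "j s" y] x y j commute[of "j s" y] by auto
  qed
  then have "d x y \<le> 0" by (rule field_le_epsilon)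
  then show ?thesis using nonneg[of x y] zero[OF x y] by linarith
qed

text \<open>Every Cauchy filter lies below a trace, and distinct traces are incomparable, so the
  traces are exactly the maximal elements for \<open>\<le>\<close>.\<close>

lemma completion_points_eq: "completion_points S Q = trace ` X"
proof
  show "completion_points S Q \<subseteq> trace ` X"
  proof
    fix F assume "F \<in> completion_points S Q"
    then have F: "cauchy_filter_on S Q F" "\<And>F'. cauchy_filter_on S Q F' \<Longrightarrow> F \<le> F' \<Longrightarrow> F' = F"
      by (auto simp: completion_points_def)
    obtain x where "x \<in> X" "F \<le> trace x" using cauchy_le_trace[OF F(1)] .
    then show "F \<in> trace ` X" using F(2)[OF cauchy_trace] by blast
  qed
  show "trace ` X \<subseteq> completion_points S Q"
  proof
    fix F assume "F \<in> trace ` X"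
    then obtain x where x: "x \<in> X" "F = trace x" by blast
    have "F' = F" if F': "cauchy_filter_on S Q F'" "F \<le> F'" for F'
    proof -
      obtain y where y: "y \<in> X" "F' \<le> trace y" using cauchy_le_trace[OF F'(1)] .
      then have "x = y" using F'(2) x trace_le_imp_eq order_trans by blast
      then show ?thesis using y(2) F'(2) x(2) by simp
    qed
    then show "F \<in> completion_points S Q" using cauchy_trace[OF x(1)] x(2) by (simp add: completion_points_def)
  qed
qed

lemma completion_uniformity_le:
  "completion_uniformity S Q \<le> principal (completion_points S Q \<times> completion_points S Q)"
  unfolding completion_uniformity_def by (rule INF_lower2[of UNIV]) auto

lemma eventually_completion_uniformity:
  "eventually P (completion_uniformity S Q) \<longleftrightarrow> (\<exists>r>0. \<forall>x\<in>X. \<forall>y\<in>X. d x y < r \<longrightarrow> P (trace x, trace y))"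
proof -
  define N where "N E = {(F, F'). F \<in> completion_points S Q \<and> F' \<in> completion_points S Q \<and>
      (\<exists>A. eventually (\<lambda>x. x \<in> A) F \<and> eventually (\<lambda>x. x \<in> A) F' \<and> A \<times> A \<subseteq> E)}" for E
  have "eventually P (completion_uniformity S Q) \<longleftrightarrow>
      (\<exists>E\<in>{E. eventually (\<lambda>z. z \<in> E) Q}. eventually P (principal (N E)))"
    unfolding completion_uniformity_def N_def[symmetric]
  proof (rule eventually_INF_base)
    show "{E. eventually (\<lambda>z. z \<in> E) Q} \<noteq> {}" by (auto intro!: exI[of _ UNIV])
    fix E E' assume "E \<in> {E. eventually (\<lambda>z. z \<in> E) Q}" "E' \<in> {E. eventually (\<lambda>z. z \<in> E) Q}"
    then have "E \<inter> E' \<in> {E. eventually (\<lambda>z. z \<in> E) Q}" by (simp add: eventually_conj_iff)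
    moreover have "N (E \<inter> E') \<subseteq> N E \<inter> N E'" unfolding N_def by blast
    ultimately show "\<exists>B\<in>{E. eventually (\<lambda>z. z \<in> E) Q}. principal (N B) \<le> inf (principal (N E)) (principal (N E'))"
      by (intro bexI[of _ "E \<inter> E'"]) auto
  qed
  also have "\<dots> \<longleftrightarrow> (\<exists>r>0. \<forall>x\<in>X. \<forall>y\<in>X. d x y < r \<longrightarrow> P (trace x, trace y))"
  proof
    assume "\<exists>E\<in>{E. eventually (\<lambda>z. z \<in> E) Q}. eventually P (principal (N E))"
    then obtain E r where r: "r > 0" "\<And>s s'. s \<in> S \<Longrightarrow> s' \<in> S \<Longrightarrow> d (j s) (j s') < r \<Longrightarrow> (s, s') \<in> E"
      and P: "\<And>z. z \<in> N E \<Longrightarrow> P z"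
      unfolding eventually_Q eventually_principal by blast
    \<comment> \<open>The common small member is the preimage of the ball of radius
      \<open>r / 2\<close> around \<open>x\<close>: it contains that of the ball of radius
      \<open>r / 4\<close> around \<open>y\<close>, and its points are pairwise closer than
      \<open>r\<close>.\<close>
    have "P (trace x, trace y)" if x: "x \<in> X" and y: "y \<in> X" and xy: "d x y < r / 4" for x y
    proof (rule P)
      define A where "A = {s \<in> S. d x (j s) < r / 2}"
      have "eventually (\<lambda>s. s \<in> A) (trace x)"
        unfolding eventually_trace A_def using r(1) by (intro exI[of _ "r / 2"]) auto
      moreover have "eventually (\<lambda>s. s \<in> A) (trace y)"
        unfolding eventually_trace
      proof (intro exI[of _ "r / 4"] conjI ballI impI)
        fix s assume s: "s \<in> S" "d y (j s) < r / 4"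
        then show "s \<in> A" using triangle[OF x y j[OF s(1)]] xy by (simp add: A_def)
      qed (use r in simp)
      moreover have "A \<times> A \<subseteq> E"
      proof safe
        fix s s' assume s: "s \<in> A" "s' \<in> A"
        then show "(s, s') \<in> E"
          using triangle[OF j x j, of s s'] commute[of "j s" x] by (intro r(2)) (auto simp: A_def)
      qed
      ultimately show "(trace x, trace y) \<in> N E"
        using x y unfolding N_def completion_points_eq by blast
    qed
    then show "\<exists>r>0. \<forall>x\<in>X. \<forall>y\<in>X. d x y < r \<longrightarrow> P (trace x, trace y)"
      using r(1) by (intro exI[of _ "r / 4"]) auto
  next
    assume "\<exists>r>0. \<forall>x\<in>X. \<forall>y\<in>X. d x y < r \<longrightarrow> P (trace x, trace y)"
    then obtain r where r: "r > 0" "\<And>x y. x \<in> X \<Longrightarrow> y \<in> X \<Longrightarrow> d x y < r \<Longrightarrow> P (trace x, trace y)" by blast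
    \<comment> \<open>A third for each leg of the path \<open>x\<close>, \<open>j s\<close>,
      \<open>j s'\<close>, \<open>y\<close>.\<close>
    define E where "E = {(s, s'). d (j s) (j s') < r / 3}"
    have "eventually (\<lambda>z. z \<in> E) Q"
      unfolding eventually_Q using r(1) by (intro exI[of _ "r / 3"]) (auto simp: E_def)
    moreover have "P z" if z: "z \<in> N E" for z
    proof -
      obtain x y A where x: "x \<in> X" and y: "y \<in> X" and zxy: "z = (trace x, trace y)"
        and A: "eventually (\<lambda>s. s \<in> A) (trace x)" "eventually (\<lambda>s. s \<in> A) (trace y)" "A \<times> A \<subseteq> E"
        using z unfolding N_def completion_points_eq by blast
      have near: "eventually (\<lambda>s. s \<in> S \<and> d p (j s) < r / 3) (trace p)" for p
        unfolding eventually_trace using r(1) by (intro exI[of _ "r / 3"]) auto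
      obtain s where s: "s \<in> A" "s \<in> S" "d x (j s) < r / 3"
        using eventually_happens'[OF trace_not_bot[OF x] eventually_conj[OF A(1) near]] by blast
      obtain s' where s': "s' \<in> A" "s' \<in> S" "d y (j s') < r / 3"
        using eventually_happens'[OF trace_not_bot[OF y] eventually_conj[OF A(2) near]] by blast
      have "d (j s) (j s') < r / 3" using A(3) s(1) s'(1) by (auto simp: E_def)
      moreover have "d x y \<le> d x (j s) + d (j s) y" "d (j s) y \<le> d (j s) (j s') + d (j s') y"
        using triangle x y j s(2) s'(2) by blast+
      ultimately have "d x y < r" using s(3) s'(3) commute[of "j s'" y] by linarith
      then show ?thesis unfolding zxy by (rule r(2)[OF x y])
    qed
    ultimately show "\<exists>E\<in>{E. eventually (\<lambda>z. z \<in> E) Q}. eventually P (principal (N E))"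
      unfolding eventually_principal by blast
  qed
  finally show ?thesis .
qed

lemma homeomorphic_trace:
  "homeomorphic_map mtopology (uniform_topology (completion_points S Q) (completion_uniformity S Q)) trace"
proof -
  let ?Y = "uniform_topology (completion_points S Q) (completion_uniformity S Q)"
  have inj: "inj_on trace X"
    using trace_le_imp_eq by (intro inj_onI) (metis order_refl)
  have tY: "topspace ?Y = trace ` X"
    using topspace_uniform_topology[OF completion_uniformity_le] by (simp add: completion_points_eq)
  have "openin ?Y (trace ` V) \<longleftrightarrow> openin mtopology V" if V: "V \<subseteq> X" for V
  proof -
    have mem: "trace y \<in> trace ` V \<longleftrightarrow> y \<in> V" if "y \<in> X" for y
      using inj that V by (auto simp: inj_on_def)
    have "eventually (\<lambda>(x', y). x' = trace x \<longrightarrow> y \<in> trace ` V) (completion_uniformity S Q) \<longleftrightarrow>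
        (\<exists>r>0. \<forall>y\<in>X. d x y < r \<longrightarrow> y \<in> V)" if x: "x \<in> V" for x
    proof -
      have xX: "x \<in> X" using x V by blast
      have eqx: "trace x' = trace x \<longleftrightarrow> x' = x" if "x' \<in> X" for x'
        using inj that xX by (auto simp: inj_on_def)
      show ?thesis
        unfolding eventually_completion_uniformity case_prod_conv
        using xX eqx mem by (metis (no_types, lifting))
    qed
    then show ?thesis
      unfolding openin_uniform_topology openin_mtopology_iff completion_points_eq
      using V by (simp add: image_mono)
  qed
  note open_iff = this
  show ?thesis
  proof (rule bijective_open_imp_homeomorphic_map)
    show "continuous_map mtopology ?Y trace"
      unfolding continuous_map_def
    proof (intro conjI allI impI)
      show "trace \<in> topspace mtopology \<rightarrow> topspace ?Y" using tY by auto
      fix W assume W: "openin ?Y W"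
      let ?V = "{x \<in> topspace mtopology. trace x \<in> W}"
      have "trace ` ?V = W" using openin_subset[OF W] unfolding tY by auto
      then show "openin mtopology ?V" using open_iff[of ?V] W by auto
    qed
    show "open_map mtopology ?Y trace"
      unfolding open_map_def using open_iff openin_subset by force
  qed (use tY inj in auto)
qed

end

text \<open>The image filter lies below every competitor in the infimum, so it is the quotient as
  soon as it is a uniformity. In general its composition axiom can fail.\<close>

lemma quotient_uniformity_eq:
  assumes "uniformity_of (p ` S) (filtermap (map_prod p p) U)"
  shows "quotient_uniformity S U p = filtermap (map_prod p p) U"
  unfolding quotient_uniformity_def
  by (rule antisym) (use assms in \<open>auto intro: Inf_lower Inf_greatest\<close>)

section \<open>The uniformity of the coset space\<close>

context topological_group
begin

lemma eventually_right_uniformity: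
  "eventually E (right_uniformity G T) \<longleftrightarrow>
     (\<exists>U. nbhd_one U \<and> (\<forall>g\<in>carrier G. \<forall>h\<in>carrier G. g \<otimes> inv h \<in> U \<longrightarrow> E (g, h)))"
proof -
  define N where "N U = {(g, h). g \<in> carrier G \<and> h \<in> carrier G \<and> g \<otimes> inv h \<in> U}" for U
  have "eventually E (right_uniformity G T) \<longleftrightarrow> (\<exists>U\<in>{U. nbhd_one U}. eventually E (principal (N U)))"
    unfolding right_uniformity_def N_def[symmetric] nbhd_one_def[symmetric]
  proof (rule eventually_INF_base)
    show "{U. nbhd_one U} \<noteq> {}" using nbhd_one_carrier by blast
    fix U V assume "U \<in> {U. nbhd_one U}" "V \<in> {U. nbhd_one U}"
    then show "\<exists>B\<in>{U. nbhd_one U}. principal (N B) \<le> inf (principal (N U)) (principal (N V))"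
      by (intro bexI[of _ "U \<inter> V"]) (auto simp: nbhd_one_Int N_def)
  qed
  then show ?thesis by (auto simp: eventually_principal N_def)
qed

lemma lcosets_eq: "lcosets H = (\<lambda>g. g <# H) ` carrier G"
  by (auto simp: LCOSETS_def)

text \<open>The right uniformity is invariant under right multiplication, hence under changing the
  representative of a coset by \<open>H\<close>. This lets two entourages be composed downstairs, so
  the image filter is a uniformity.\<close>

lemma eventually_coset_uniformity:
  assumes H: "subgroup H G"
  shows "eventually E (coset_uniformity G T H) \<longleftrightarrow>
     (\<exists>U. nbhd_one U \<and> (\<forall>g\<in>carrier G. \<forall>h\<in>carrier G. g \<otimes> inv h \<in> U \<longrightarrow> E (g <# H, h <# H)))"
proof -
  define p where "p g = g <# H" for g
  let ?Q = "filtermap (map_prod p p) (right_uniformity G T)"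
  have ev: "eventually E ?Q \<longleftrightarrow>
     (\<exists>U. nbhd_one U \<and> (\<forall>g\<in>carrier G. \<forall>h\<in>carrier G. g \<otimes> inv h \<in> U \<longrightarrow> E (p g, p h)))" for E
    unfolding eventually_filtermap eventually_right_uniformity by simp
  have "uniformity_of (p ` carrier G) ?Q"
    unfolding uniformity_of_def
  proof (intro conjI allI impI ballI)
    show "?Q \<le> principal (p ` carrier G \<times> p ` carrier G)"
      unfolding le_principal ev using nbhd_one_carrier by (intro exI[of _ "carrier G"]) auto
    fix E assume "eventually E ?Q"
    then obtain U where U: "nbhd_one U" "\<And>g h. g \<in> carrier G \<Longrightarrow> h \<in> carrier G \<Longrightarrow> g \<otimes> inv h \<in> U \<Longrightarrow> E (p g, p h)"
      unfolding ev by blast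
    show "E (x, x)" if "x \<in> p ` carrier G" for x
      using that U by (auto simp: nbhd_one_def)
    obtain V where V: "nbhd_one V" "\<And>v. v \<in> V \<Longrightarrow> inv v \<in> V" "V \<subseteq> U"
      using nbhd_one_cube_root[OF U(1)] by metis
    have "E (p h, p g)" if "g \<in> carrier G" "h \<in> carrier G" "g \<otimes> inv h \<in> V" for g h
      using V(2)[OF that(3)] V(3) that(1,2) by (intro U(2)) (auto simp: inv_mult_group)
    then show "eventually (\<lambda>(x, y). E (y, x)) ?Q" unfolding ev using V(1) by auto
    obtain W where W: "nbhd_one W" "\<And>v w. v \<in> W \<Longrightarrow> w \<in> W \<Longrightarrow> v \<otimes> w \<in> U"
      using nbhd_one_sqrt[OF U(1)] by metis
    define D where "D z \<longleftrightarrow> (\<exists>g h. z = (p g, p h) \<and> g \<in> carrier G \<and> h \<in> carrier G \<and> g \<otimes> inv h \<in> W)" for z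
    have "eventually D ?Q" unfolding ev using W(1) by (intro exI[of _ W]) (auto simp: D_def)
    moreover have "E (x, z)" if D1: "D (x, y)" and D2: "D (y, z)" for x y z
    proof -
      obtain g h where gh: "x = p g" "y = p h" "g \<in> carrier G" "h \<in> carrier G" "g \<otimes> inv h \<in> W"
        using D1 by (auto simp: D_def)
      obtain g' h' where gh': "y = p g'" "z = p h'" "g' \<in> carrier G" "h' \<in> carrier G" "g' \<otimes> inv h' \<in> W"
        using D2 by (auto simp: D_def)
      have "h \<in> g' <# H" using lcos_self[OF gh(4) H] gh(2) gh'(1) by (simp add: p_def)
      then obtain k where k: "k \<in> H" "h = g' \<otimes> k" by (auto simp: l_coset_def)
      have kG: "k \<in> carrier G" using subgroup.mem_carrier[OF H k(1)] .
      \<comment> \<open>The representatives \<open>h\<close> and \<open>g'\<close> of the middle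
        coset differ by \<open>k\<close>; moving \<open>g\<close> by \<open>inv k\<close> within its
        coset makes the two quotients telescope.\<close>
      have "g \<otimes> inv k \<in> g <# H" using subgroup.m_inv_closed[OF H k(1)] by (auto simp: l_coset_def)
      then have pg: "p (g \<otimes> inv k) = x"
        using l_repr_independence[OF _ gh(3) H] gh(1) by (simp add: p_def)
      have "g \<otimes> inv k \<otimes> inv h' = (g \<otimes> inv h) \<otimes> (g' \<otimes> inv h')"
      proof -
        have "inv g' \<otimes> (g' \<otimes> inv h') = inv h'" using gh' by (simp flip: m_assoc)
        then show ?thesis using gh gh' kG k(2) by (simp add: inv_mult_group m_assoc)
      qed
      then have "E (p (g \<otimes> inv k), p h')"
        using W(2)[OF gh(5) gh'(5)] gh(3) gh'(4) kG by (intro U(2)) auto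
      then show ?thesis using pg gh'(2) by simp
    qed
    ultimately show "\<exists>D. eventually D ?Q \<and> (\<forall>x y z. D (x, y) \<longrightarrow> D (y, z) \<longrightarrow> E (x, z))" by blast
  qed
  then have eq: "coset_uniformity G T H = ?Q"
    unfolding coset_uniformity_def p_def by (rule quotient_uniformity_eq)
  show ?thesis unfolding eq ev unfolding p_def by (rule refl)
qed

end

section \<open>The universal minimal flow as completion of the coset space\<close>

context polish_universal_minimal
begin

interpretation M: Metric_space "topspace M" d by (rule metric_M)

text \<open>Joint continuity made uniform over \<open>M\<close> by compactness. It yields uniform
  continuity of the orbit map on cosets, the easy half of the uniform isomorphism.\<close>

lemma small_displacement:
  assumes r: "r > 0"
  obtains U where "nbhd_one U" "\<And>u x. u \<in> U \<Longrightarrow> x \<in> topspace M \<Longrightarrow> d x (\<mu> u x) < r"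
proof -
  have "\<forall>x\<in>topspace M. \<exists>t. nbhd_one (fst t) \<and> openin M (snd t) \<and> x \<in> snd t \<and>
      (\<forall>v\<in>fst t. \<forall>y\<in>snd t. d y (\<mu> v y) < r)"
  proof
    fix x assume x: "x \<in> topspace M"
    let ?B = "{y \<in> topspace M. d x y < r / 2}"
    have B: "openin M ?B" by (rule openin_M_ball[OF x])
    have xB: "x \<in> ?B" using x r by simp
    obtain V W where V: "nbhd_one V" "openin M W" "x \<in> W" "\<And>v y. v \<in> V \<Longrightarrow> y \<in> W \<Longrightarrow> \<mu> v y \<in> ?B"
      using act_nbhd[OF x B xB] by metis
    have "d y (\<mu> v y) < r" if v: "v \<in> V" and y: "y \<in> W \<inter> ?B" for v y
      using V(4)[OF v, of y] y M.triangle[of y x "\<mu> v y"] M.commute[of y x] x by auto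
    then show "\<exists>t. nbhd_one (fst t) \<and> openin M (snd t) \<and> x \<in> snd t \<and>
        (\<forall>v\<in>fst t. \<forall>y\<in>snd t. d y (\<mu> v y) < r)"
      using V(1,3) xB openin_Int[OF V(2) B] by (intro exI[of _ "(V, W \<inter> ?B)"]) auto
  qed
  then obtain t where t: "\<forall>x\<in>topspace M. nbhd_one (fst (t x)) \<and> openin M (snd (t x)) \<and> x \<in> snd (t x) \<and>
      (\<forall>v\<in>fst (t x). \<forall>y\<in>snd (t x). d y (\<mu> v y) < r)"
    by (elim bchoice[THEN exE])
  have "\<exists>\<F>. finite \<F> \<and> \<F> \<subseteq> (\<lambda>x. snd (t x)) ` topspace M \<and> topspace M \<subseteq> \<Union>\<F>"
    by (intro compact[unfolded compact_space_alt, THEN spec, THEN mp] conjI ballI) (use t in auto)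
  then obtain \<F> where \<F>: "finite \<F>" "\<F> \<subseteq> (\<lambda>x. snd (t x)) ` topspace M" "topspace M \<subseteq> \<Union>\<F>"
    by (elim exE conjE)
  obtain K where K: "K \<subseteq> topspace M" "finite K" "\<F> = (\<lambda>x. snd (t x)) ` K"
    using finite_subset_image[OF \<F>(1,2)] by (elim exE conjE)
  obtain U where U: "nbhd_one U" "\<And>x. x \<in> K \<Longrightarrow> U \<subseteq> fst (t x)"
    using nbhd_one_INT[OF K(2), of "\<lambda>x. fst (t x)"] t K(1) by (metis subsetD)
  show thesis
  proof (rule that[OF U(1)])
    fix u y assume u: "u \<in> U" and y: "y \<in> topspace M"
    then obtain x where "x \<in> K" "y \<in> snd (t x)" using \<F>(3) unfolding K(3) by blast
    then show "d y (\<mu> u y) < r" using t K(1) U(2) u by blast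
  qed
qed

lemma coset_completion_isomorphic:
  assumes x0: "generic x0"
  defines "H \<equiv> stabilizer G \<mu> x0"
  shows "\<exists>f. homeomorphic_map M (coset_completion G T H) f \<and>
    equivariant G M \<mu> (coset_completion_action G T H) f"
proof -
  have x0M: "x0 \<in> topspace M" using x0 by (simp add: generic_def)
  have H: "subgroup H G" unfolding H_def using stabilizer_subgroup[OF x0M] .
  have HG: "H \<subseteq> carrier G" using subgroup.subset[OF H] .
  \<comment> \<open>The choice of representative is harmless because elements of \<open>H\<close>
    fix \<open>x0\<close>.\<close>
  define j where "j C = \<mu> (SOME g. g \<in> C) x0" for C
  have j: "j (g <# H) = \<mu> g x0" if g: "g \<in> carrier G" for g
  proof -
    have "(SOME k. k \<in> g <# H) \<in> g <# H" using lcos_self[OF g H] by (rule someI)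
    then obtain h where h: "h \<in> H" "(SOME k. k \<in> g <# H) = g \<otimes> h" by (auto simp: l_coset_def)
    then have "h \<in> carrier G" "\<mu> h x0 = x0" by (auto simp: H_def stabilizer_def)
    then show ?thesis using h(2) g x0M by (simp add: j_def act_mult)
  qed
  let ?S = "lcosets H" and ?Q = "coset_uniformity G T H"
  interpret D: dense_uniform_embedding "topspace M" d ?S ?Q j
  proof
    show "compact_space M.mtopology" unfolding metric_topology_M by (rule compact)
    show "j C \<in> topspace M" if "C \<in> ?S" for C using that j x0M by (auto simp: lcosets_eq)
    show "\<exists>C\<in>?S. d x (j C) < r" if x: "x \<in> topspace M" and r: "r > 0" for x r
    proof -
      have "x \<in> M closure_of orbit G \<mu> x0" using minimal x0M x by (auto simp: minimal_flow_def)
      then obtain y where "y \<in> orbit G \<mu> x0" "y \<in> {y \<in> topspace M. d x y < r}"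
        using openin_M_ball[OF x, of r] by (rule in_closure_ofE) (use x r in simp)
      then obtain g where "g \<in> carrier G" "d x (\<mu> g x0) < r" by (auto simp: orbit_def)
      then show ?thesis using j by (intro bexI[of _ "g <# H"]) (auto simp: lcosets_eq)
    qed
    fix E
    show "eventually E ?Q \<longleftrightarrow> (\<exists>r>0. \<forall>C\<in>?S. \<forall>C'\<in>?S. d (j C) (j C') < r \<longrightarrow> E (C, C'))"
    proof
      assume "eventually E ?Q"
      then obtain U where U: "nbhd_one U"
        "\<And>g h. g \<in> carrier G \<Longrightarrow> h \<in> carrier G \<Longrightarrow> g \<otimes> inv h \<in> U \<Longrightarrow> E (g <# H, h <# H)"
        unfolding eventually_coset_uniformity[OF H] by blast
      obtain r where r: "r > 0" "\<And>z w. generic z \<Longrightarrow> generic w \<Longrightarrow> d z w < r \<Longrightarrow> \<exists>u\<in>U. w = \<mu> u z"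
        by (rule generic_effros[OF U(1)]) (rule that)
      have "E (g <# H, h <# H)" if g: "g \<in> carrier G" and h: "h \<in> carrier G"
        and gh: "d (j (g <# H)) (j (h <# H)) < r" for g h
      proof -
        have "d (\<mu> h x0) (\<mu> g x0) < r" using gh j g h by (simp add: M.commute)
        then obtain u where u: "u \<in> U" "\<mu> g x0 = \<mu> u (\<mu> h x0)"
          using r(2)[OF generic_invariant[OF x0 h] generic_invariant[OF x0 g]] by blast
        have uG: "u \<in> carrier G" using nbhd_one_subset[OF U(1) u(1)] .
        \<comment> \<open>\<open>g\<close> and \<open>u h\<close> send \<open>x0\<close> to the same
          point and so represent the same coset. With representatives \<open>u h\<close> and
          \<open>h\<close> the quotient is exactly \<open>u\<close>.\<close>
        have "\<mu> (inv (u \<otimes> h) \<otimes> g) x0 = x0"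
        proof -
          have "\<mu> g x0 = \<mu> (u \<otimes> h) x0" using u(2) uG h x0M by (simp add: act_mult)
          then show ?thesis using uG g h x0M act_mult[of "inv (u \<otimes> h)" g x0] by simp
        qed
        then have "inv (u \<otimes> h) \<otimes> g \<in> H" using uG g h by (simp add: H_def stabilizer_def)
        moreover have "g = (u \<otimes> h) \<otimes> (inv (u \<otimes> h) \<otimes> g)" using uG g h by (simp flip: m_assoc)
        ultimately have "g \<in> (u \<otimes> h) <# H" unfolding l_coset_def by blast
        then have "(u \<otimes> h) <# H = g <# H" using uG h by (intro l_repr_independence[OF _ _ H]) auto
        moreover have "(u \<otimes> h) \<otimes> inv h = u" using uG h by (simp add: m_assoc)
        ultimately show ?thesis using U(2)[of "u \<otimes> h" h] uG h u(1) by simp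
      qed
      then show "\<exists>r>0. \<forall>C\<in>?S. \<forall>C'\<in>?S. d (j C) (j C') < r \<longrightarrow> E (C, C')"
        using r(1) by (auto simp: lcosets_eq)
    next
      assume "\<exists>r>0. \<forall>C\<in>?S. \<forall>C'\<in>?S. d (j C) (j C') < r \<longrightarrow> E (C, C')"
      then obtain r where r: "r > 0" "\<And>C C'. C \<in> ?S \<Longrightarrow> C' \<in> ?S \<Longrightarrow> d (j C) (j C') < r \<Longrightarrow> E (C, C')" by blast
      obtain U where U: "nbhd_one U" "\<And>u x. u \<in> U \<Longrightarrow> x \<in> topspace M \<Longrightarrow> d x (\<mu> u x) < r"
        using small_displacement[OF r(1)] by metis
      have "E (g <# H, h <# H)" if g: "g \<in> carrier G" and h: "h \<in> carrier G" and u: "g \<otimes> inv h \<in> U" for g h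
      proof (rule r(2))
        have "\<mu> (g \<otimes> inv h) (\<mu> h x0) = \<mu> g x0" using g h x0M by (simp add: m_assoc flip: act_mult)
        then show "d (j (g <# H)) (j (h <# H)) < r"
          using U(2)[OF u, of "\<mu> h x0"] g h x0M j by (simp add: M.commute)
      qed (use g h in \<open>auto simp: lcosets_eq\<close>)
      then show "eventually E ?Q" unfolding eventually_coset_uniformity[OF H] using U(1) by blast
    qed
  qed
  have hom: "homeomorphic_map M (coset_completion G T H) D.trace"
    using D.homeomorphic_trace unfolding metric_topology_M coset_completion_def .
  \<comment> \<open>\<open>g\<close> permutes the cosets compatibly with \<open>j\<close> and acts
    on \<open>M\<close> by a homeomorphism, so direct images carry neighbourhood traces to
    neighbourhood traces.\<close>
  have "filtermap (\<lambda>C. g <# C) (D.trace x) = D.trace (\<mu> g x)" if g: "g \<in> carrier G" and x: "x \<in> topspace M" for g x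
  proof -
    have act: "k <# C \<in> ?S" "j (k <# C) = \<mu> k (j C)" "inv k <# (k <# C) = C" "k <# (inv k <# C) = C"
      if "k \<in> carrier G" "C \<in> ?S" for k C
    proof -
      obtain a where a: "a \<in> carrier G" "C = a <# H" using \<open>C \<in> ?S\<close> by (auto simp: lcosets_eq)
      have eq: "k' <# C = (k' \<otimes> a) <# H" if "k' \<in> carrier G" for k'
        unfolding a(2) using lcos_m_assoc[OF HG that a(1)] .
      show "k <# C \<in> ?S" using eq[OF \<open>k \<in> carrier G\<close>] a(1) \<open>k \<in> carrier G\<close> by (auto simp: lcosets_eq)
      show "j (k <# C) = \<mu> k (j C)"
        using eq[OF \<open>k \<in> carrier G\<close>] a \<open>k \<in> carrier G\<close> j x0M by (simp add: act_mult)
      show "inv k <# (k <# C) = C" "k <# (inv k <# C) = C"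
        using a \<open>k \<in> carrier G\<close> HG by (simp_all add: lcos_m_assoc flip: m_assoc)
    qed
    have cont: "\<exists>r'>0. \<forall>y\<in>topspace M. d z y < r' \<longrightarrow> d (\<mu> k z) (\<mu> k y) < r"
      if k: "k \<in> carrier G" and z: "z \<in> topspace M" and r: "r > 0" for k z r
    proof -
      have "openin M {y \<in> topspace M. \<mu> k y \<in> {w \<in> topspace M. d (\<mu> k z) w < r}}"
        using openin_act_preimage[OF k openin_M_ball] k z by simp
      then show ?thesis using k z r by (elim openin_M_E[of _ z]) auto
    qed
    have "eventually P (filtermap (\<lambda>C. g <# C) (D.trace x)) \<longleftrightarrow> eventually P (D.trace (\<mu> g x))" for P
    proof
      assume "eventually P (filtermap (\<lambda>C. g <# C) (D.trace x))"
      then obtain r where r: "r > 0" "\<And>C. C \<in> ?S \<Longrightarrow> d x (j C) < r \<Longrightarrow> P (g <# C)"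
        unfolding eventually_filtermap D.eventually_trace by blast
      obtain r' where r': "r' > 0" "\<And>y. y \<in> topspace M \<Longrightarrow> d (\<mu> g x) y < r' \<Longrightarrow> d x (\<mu> (inv g) y) < r"
        using cont[of "inv g" "\<mu> g x" r] g x r(1) by auto
      have "P C" if C: "C \<in> ?S" "d (\<mu> g x) (j C) < r'" for C
        using r(2)[of "inv g <# C"] r'(2)[OF D.j[OF C(1)] C(2)] act[of "inv g" C] act(4)[of g C] g C(1) by simp
      then show "eventually P (D.trace (\<mu> g x))" unfolding D.eventually_trace using r'(1) by blast
    next
      assume "eventually P (D.trace (\<mu> g x))"
      then obtain r where r: "r > 0" "\<And>C. C \<in> ?S \<Longrightarrow> d (\<mu> g x) (j C) < r \<Longrightarrow> P C"
        unfolding D.eventually_trace by blast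
      obtain r' where r': "r' > 0" "\<And>y. y \<in> topspace M \<Longrightarrow> d x y < r' \<Longrightarrow> d (\<mu> g x) (\<mu> g y) < r"
        using cont[of g x r] g x r(1) by auto
      have "P (g <# C)" if C: "C \<in> ?S" "d x (j C) < r'" for C
        using r(2)[of "g <# C"] r'(2)[OF D.j[OF C(1)] C(2)] act[OF g C(1)] by simp
      then show "eventually P (filtermap (\<lambda>C. g <# C) (D.trace x))"
        unfolding eventually_filtermap D.eventually_trace using r'(1) by blast
    qed
    then show ?thesis by (simp add: filter_eq_iff)
  qed
  moreover have "D.trace x \<in> topspace (coset_completion G T H)" if "x \<in> topspace M" for x
    using homeomorphic_imp_surjective_map[OF hom] that by blast
  ultimately have "equivariant G M \<mu> (coset_completion_action G T H) D.trace"
    by (simp add: equivariant_def coset_completion_action_def)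
  with hom show ?thesis by blast
qed

theorem exists_extremely_amenable_stabilizer:
  "\<exists>H. subgroup H G \<and> closedin T H \<and> co_precompact G T H \<and>
     extremely_amenable (G\<lparr>carrier := H\<rparr>) (subtopology T H) \<and>
     flow_isomorphic G T M \<mu> (coset_completion G T H) (coset_completion_action G T H)"
proof -
  obtain x0 where x0: "generic x0" using generic_exists by blast
  have x0M: "x0 \<in> topspace M" using x0 by (simp add: generic_def)
  define H where "H = stabilizer G \<mu> x0"
  have sub: "subgroup H G" unfolding H_def using stabilizer_subgroup[OF x0M] .
  have "closedin M {x0}" using closedin_Hausdorff_singleton[OF Hausdorff x0M] .
  from closedin_continuous_map_preimage[OF continuous_orbit_map[OF x0M] this]
  have cl: "closedin T H" by (simp add: H_def stabilizer_def topspace_eq_carrier)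
  obtain f where f: "homeomorphic_map M (coset_completion G T H) f"
    and eq: "equivariant G M \<mu> (coset_completion_action G T H) f"
    using coset_completion_isomorphic[OF x0] unfolding H_def by blast
  have "flow G T (coset_completion G T H) (coset_completion_action G T H)"
    by (rule flow_transfer[OF f])
      (use eq in \<open>simp_all add: equivariant_def coset_completion_action_def\<close>)
  then have "flow_isomorphic G T M \<mu> (coset_completion G T H) (coset_completion_action G T H)"
    using is_flow f eq unfolding flow_isomorphic_def by blast
  moreover have "co_precompact G T H"
    using homeomorphic_compact_space[OF homeomorphic_map_imp_homeomorphic_space[OF f]] compact
    by (simp add: co_precompact_def)
  moreover have "extremely_amenable (G\<lparr>carrier := H\<rparr>) (subtopology T H)"
    unfolding H_def by (rule extremely_amenable_stabilizer[OF x0])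
  ultimately show ?thesis using sub cl by blast
qed

end

theorem theorem1p1:
  fixes G :: "('a, 'b) monoid_scheme"
    and T :: "'a topology"
    and M :: "'m topology"
    and \<mu> :: "'a \<Rightarrow> 'm \<Rightarrow> 'm"
  assumes "polish_group G T"
    and "universal_minimal_flow G T M \<mu>"
    and "metrizable_space M"
  shows "\<exists>H. subgroup H G \<and> closedin T H \<and> co_precompact G T H \<and>
           extremely_amenable (G\<lparr>carrier := H\<rparr>) (subtopology T H) \<and>
           flow_isomorphic G T M \<mu> (coset_completion G T H) (coset_completion_action G T H)"
proof -
  have tg: "topological_group G T" and "completely_metrizable_space T"
    using assms(1) by (simp_all add: polish_group_def)
  then obtain X \<rho> where \<rho>: "Metric_space X \<rho>" "Metric_space.mcomplete X \<rho>" "T = Metric_space.mtopology X \<rho>"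
    unfolding completely_metrizable_space_def by blast
  have X: "carrier G = X"
    using Metric_space.topspace_mtopology[OF \<rho>(1)] topological_group.topspace_eq_carrier[OF tg] \<rho>(3) by simp
  obtain Y d where d: "Metric_space Y d" "M = Metric_space.mtopology Y d"
    using assms(3) unfolding metrizable_space_def by blast
  have Y: "topspace M = Y" using Metric_space.topspace_mtopology[OF d(1)] d(2) by simp
  have "polish_universal_minimal G T M \<mu> d \<rho>"
    by (intro polish_universal_minimal.intro universal_minimal.intro universal_minimal_axioms.intro
        polish_universal_minimal_axioms.intro, unfold X Y)
      (rule tg assms(2) d(1) d(2)[symmetric] \<rho>(1,2) \<rho>(3)[symmetric])+
  then show ?thesis by (rule polish_universal_minimal.exists_extremely_amenable_stabilizer)
qed

end
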